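(* Let $N$ be a $4$-dimensional neutral space form with constant sectional curvature $L_0$. Let $M$ be a Lorentz surface and $F:M\rightarrow N$ a time-like and conformal immersion of $M$ into $N$ with zero mean curvature vector. Then the following are equivalent: (a) $F$ satisfies both $K\neq L_0$ (at every point) and $R^{\perp}=0$, where $K$ is the curvature of the induced metric and $R^{\perp}$ is the curvature tensor of the normal connection; (b) around each point of $M$, the induced metric $g$ is represented as $g=e^{2\lambda}d\check{w}\,d\overline{\check{w}}$ in some local paracomplex coordinate $\check{w}=u+jv$, for a real-valued function $\lambda$ satisfying $$\lambda_{uu}-\lambda_{vv}=-L_0e^{2\lambda}+\varepsilon e^{-2\lambda}\qquad(\varepsilon\in\{+1,-1\}),\qquad (\ast)$$ and the functions $\alpha_k,\beta_k,\mu_k$ $(k=1,2)$ of $F$ satisfy $(\ast\ast)$: there exist functions $P_+,P_-,Q_+,Q_-$, a constant $c$ and signs $\varepsilon'_+,\varepsilon'_-\in\{+1,-1\}$ such that $$-2\lambda=P_++Q_+=P_-+Q_-,\qquad Q_-=P_++c,\qquad Q_+=P_-+c,$$ $$\mu_1=\tfrac{1}{2\sqrt2}\bigl((Q_+-Q_-)_s-(P_+-P_-)_t\bigr),\qquad \mu_2=\tfrac{1}{2\sqrt2}\bigl((Q_+-Q_-)_s+(P_+-P_-)_t\bigr),$$ $$\alpha_1=\tfrac12(X_++X_-),\quad \alpha_2=\tfrac12(Y_++Y_-),\quad \beta_1=\tfrac12(Y_+-Y_-),\quad \beta_2=\tfrac12(X_+-X_-),$$ where $X_{\pm}:=\tfrac{\varepsilon'_{\pm}}{2}(e^{P_{\pm}}+\varepsilon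 e^{Q_{\pm}})$ and $Y_{\pm}:=\tfrac{\varepsilon'_{\pm}}{2}(e^{P_{\pm}}-\varepsilon e^{Q_{\pm}})$, with the same $\varepsilon$ as in $(\ast)$. In addition, a function $\lambda$ of two variables $u,v$ satisfying $(\ast)$ and functions $\alpha_k,\beta_k,\mu_k$ $(k=1,2)$ of $u,v$ given by $(\ast\ast)$ locally define a time-like surface in $N$ with zero mean curvature vector, $K\neq L_0$ and $R^{\perp}=0$ (i.e. near each point there is such an immersion having these functions as its associated functions), which is unique up to an isometry of $N$.
   Context: All objects are smooth. Paracomplex numbers: $a+jb$ with $a,b\in\mathbb{R}$, $j^2=1$; conjugate $a-jb$. Space form: $N$ has neutral metric $h$ (signature $(2,2)$) and is taken to be $E^4_2$ if $L_0=0$, $\{x\in E^5_2 : \langle x,x\rangle =1/L_0\}$ if $L_0>0$, $\{x\in E^5_3 : \langle x,x\rangle =1/L_0\}$ if $L_0<0$, where $E^m_k$ is the $m$-dimensional pseudo-Euclidean space of index $k$ (i.e. $k$ minus signs). $\nabla$ is the Levi-Civita connection of $N$. Lorentz surface: a surface $M$ with an atlas of compatible local paracomplex coordinates $\check{w}=u+jv$. "$F$ time-like and conformal" means that the induced metric is $g=F^*h=e^{2\lambda}d\check{w}\,d\overline{\check{w}}=e^{2\lambda}(du^2-dv^2)$ for a real-valued function $\lambda$ in each such coordinate. We put $s=\frac{1}{\sqrt2}(u+v)$, $t=\frac{1}{\sqrt2}(u-v)$; subscripts $u,v,s,t$ denote partial derivatives. Associated functions: given a local paracomplex coordinate, put $T_1=dF(\partial_u)$,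 $T_2=dF(\partial_v)$ and choose local normal vector fields $N_1,N_2$ of $F$ with $h(N_1,N_1)=-h(N_2,N_2)=e^{2\lambda}$, $h(N_1,N_2)=0$. Since the mean curvature vector is zero, there are real functions $\alpha_k,\beta_k,\mu_k$ $(k=1,2)$ with $$\nabla_{T_1}T_1=\lambda_uT_1+\lambda_vT_2+\alpha_1N_1+\beta_1N_2,\quad \nabla_{T_1}T_2=\nabla_{T_2}T_1=\lambda_vT_1+\lambda_uT_2+\alpha_2N_1+\beta_2N_2,$$ $$\nabla_{T_2}T_2=\lambda_uT_1+\lambda_vT_2+\alpha_1N_1+\beta_1N_2,$$ $$\nabla_{T_1}N_1=-\alpha_1T_1+\alpha_2T_2+\lambda_uN_1+\mu_1N_2,\quad \nabla_{T_1}N_2=\beta_1T_1-\beta_2T_2+\mu_1N_1+\lambda_uN_2,$$ $$\nabla_{T_2}N_1=-\alpha_2T_1+\alpha_1T_2+\lambda_vN_1+\mu_2N_2,\quad \nabla_{T_2}N_2=\beta_2T_1-\beta_1T_2+\mu_2N_1+\lambda_vN_2.$$ These are the functions $\alpha_k,\beta_k,\mu_k$ of $F$ (with respect to the coordinate and the frame $N_1,N_2$). That given functions $\lambda,\alpha_k,\beta_k,\mu_k$ of $(u,v)$ locally define a surface means: every point of their domain has a connected neighborhood $U$ and a time-like conformal immersion $F:U\to N$ with zero mean curvature vector and induced metric $e^{2\lambda}(du^2-dv^2)$, admitting normal vector fields $N_1,N_2$ on $U$ with $h(N_1,N_1)=-h(N_2,N_2)=e^{2\lambda}$, $h(N_1,N_2)=0$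 for which these functions are the associated functions; uniqueness means any two such $F$ on $U$ differ by an isometry of $N$. *)

theory Defs
  imports "HOL-Analysis.Analysis"
begin

section \<open>Smooth maps\<close>

abbreviation dirder :: "('a::real_normed_vector \<Rightarrow> 'b::real_normed_vector) \<Rightarrow> 'a \<Rightarrow> 'a \<Rightarrow> 'b"
  where "dirder f e p \<equiv> frechet_derivative f (at p) e"

primrec differentiable_upto ::
  "nat \<Rightarrow> 'a::real_normed_vector set \<Rightarrow> ('a \<Rightarrow> 'b::real_normed_vector) \<Rightarrow> bool" where
  "differentiable_upto 0 U f \<longleftrightarrow> continuous_on U f"
| "differentiable_upto (Suc k) U f \<longleftrightarrow>
     (\<forall>p\<in>U. f differentiable (at p)) \<and> (\<forall>e. differentiable_upto k U (dirder f e))"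

text \<open>Class \<open>C\<close>-infinity; only used on open sets.\<close>

definition smooth_on :: "'a::real_normed_vector set \<Rightarrow> ('a \<Rightarrow> 'b::real_normed_vector) \<Rightarrow> bool"
  where "smooth_on U f \<longleftrightarrow> (\<forall>k. differentiable_upto k U f)"


section \<open>Paracomplex numbers and Lorentz surfaces\<close>

text \<open>The pair \<open>(u, v)\<close> stands for the paracomplex number \<open>u + j v\<close>, where \<open>j * j = 1\<close>.\<close>

type_synonym paracomplex = "real \<times> real"

definition pc_mult :: "paracomplex \<Rightarrow> paracomplex \<Rightarrow> paracomplex"
  where "pc_mult z w = (fst z * fst w + snd z * snd w, fst z * snd w + snd z * fst w)"

definition paraholomorphic_on :: "paracomplex set \<Rightarrow> (paracomplex \<Rightarrow> paracomplex) \<Rightarrow> bool"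
  where "paraholomorphic_on U f \<longleftrightarrow>
    smooth_on U f \<and> (\<forall>p\<in>U. \<exists>z. (f has_derivative pc_mult z) (at p))"

type_synonym 'm chart = "'m set \<times> ('m \<Rightarrow> paracomplex)"

abbreviation chart_image :: "'m chart \<Rightarrow> paracomplex set"
  where "chart_image C \<equiv> snd C ` fst C"

abbreviation chart_inv :: "'m chart \<Rightarrow> paracomplex \<Rightarrow> 'm"
  where "chart_inv C \<equiv> inv_into (fst C) (snd C)"

definition is_chart :: "'m::topological_space chart \<Rightarrow> bool"
  where "is_chart C \<longleftrightarrow>
    open (fst C) \<and> open (chart_image C) \<and> homeomorphism (fst C) (chart_image C) (snd C) (chart_inv C)"

definition compatible_charts :: "'m chart \<Rightarrow> 'm chart \<Rightarrow> bool"
  where "compatible_charts C D \<longleftrightarrow>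
    paraholomorphic_on (snd C ` (fst C \<inter> fst D)) (snd D \<circ> chart_inv C) \<and>
    paraholomorphic_on (snd D ` (fst C \<inter> fst D)) (snd C \<circ> chart_inv D)"

text \<open>The surface is the whole type \<open>'m\<close>, with an atlas \<open>A\<close> of local paracomplex coordinates.\<close>

definition lorentz_surface :: "'m::{t2_space, second_countable_topology} chart set \<Rightarrow> bool"
  where "lorentz_surface A \<longleftrightarrow>
    (\<forall>C\<in>A. is_chart C) \<and> (\<Union>C\<in>A. fst C) = UNIV \<and> (\<forall>C\<in>A. \<forall>D\<in>A. compatible_charts C D)"

definition local_coordinate :: "'m::{t2_space, second_countable_topology} chart set \<Rightarrow> 'm chart \<Rightarrow> bool"
  where "local_coordinate A C \<longleftrightarrow> is_chart C \<and> (\<forall>D\<in>A. compatible_charts C D)"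


section \<open>Pseudo-Euclidean spaces and space forms\<close>

text \<open>\<open>S\<close> is the set of the indices that carry a minus sign, so the index of the form is \<open>card S\<close>.\<close>

definition pinner :: "'n::finite set \<Rightarrow> real^'n \<Rightarrow> real^'n \<Rightarrow> real"
  where "pinner S x y = (\<Sum>i\<in>UNIV. (if i \<in> S then - 1 else 1) * (x $ i) * (y $ i))"

definition space_form :: "'n::finite set \<Rightarrow> real \<Rightarrow> (real^'n) set"
  where "space_form S L0 = (if L0 = 0 then UNIV else {x. pinner S x x = 1 / L0})"

definition tangent_sf :: "'n::finite set \<Rightarrow> real \<Rightarrow> real^'n \<Rightarrow> (real^'n) set"
  where "tangent_sf S L0 x = (if L0 = 0 then UNIV else {X. pinner S X x = 0})"

definition smooth_extension_near ::
  "(real^'n::finite) set \<Rightarrow> (real^'n \<Rightarrow> real^'n) \<Rightarrow> real^'n \<Rightarrow> (real^'n \<Rightarrow> real^'n) \<Rightarrow> bool"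
  where "smooth_extension_near N \<Phi> x G \<longleftrightarrow>
    (\<exists>W. open W \<and> x \<in> W \<and> smooth_on W G \<and> (\<forall>y\<in>W \<inter> N. G y = \<Phi> y))"

text \<open>A diffeomorphism of the space form that preserves its metric; smoothness and the derivative
  along the space form are taken through local smooth extensions to the ambient space.\<close>

definition isometry_sf :: "'n::finite set \<Rightarrow> real \<Rightarrow> (real^'n \<Rightarrow> real^'n) \<Rightarrow> bool"
  where "isometry_sf S L0 \<Phi> \<longleftrightarrow>
    bij_betw \<Phi> (space_form S L0) (space_form S L0) \<and>
    (\<forall>x\<in>space_form S L0. \<exists>G. smooth_extension_near (space_form S L0) \<Phi> x G \<and>
       (\<forall>X\<in>tangent_sf S L0 x. \<forall>Y\<in>tangent_sf S L0 x.
          pinner S (dirder G X x) (dirder G Y x) = pinner S X Y)) \<and>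
    (\<forall>x\<in>space_form S L0. \<exists>G.
       smooth_extension_near (space_form S L0) (inv_into (space_form S L0) \<Phi>) x G)"


section \<open>Curvature of a metric on a plane domain\<close>

text \<open>\<open>g p X Y\<close> is the value of the metric at \<open>p\<close> on \<open>X, Y\<close>. For constant vector fields \<open>X, Y\<close>
  all brackets vanish, so the Koszul formula determines the covariant derivative as below.\<close>

definition christoffel ::
  "(paracomplex \<Rightarrow> paracomplex \<Rightarrow> paracomplex \<Rightarrow> real) \<Rightarrow> paracomplex \<Rightarrow> paracomplex \<Rightarrow> paracomplex \<Rightarrow> paracomplex"
  where "christoffel g X Y p = (THE Z. \<forall>W. g p Z W =
    (dirder (\<lambda>q. g q Y W) X p + dirder (\<lambda>q. g q X W) Y p - dirder (\<lambda>q. g q X Y) W p) / 2)"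

text \<open>Covariant derivative of the vector field \<open>Y\<close> in the constant direction \<open>X\<close>.\<close>

definition levi_civita ::
  "(paracomplex \<Rightarrow> paracomplex \<Rightarrow> paracomplex \<Rightarrow> real) \<Rightarrow> paracomplex \<Rightarrow> (paracomplex \<Rightarrow> paracomplex) \<Rightarrow> paracomplex \<Rightarrow> paracomplex"
  where "levi_civita g X Y p = dirder Y X p + christoffel g X (Y p) p"

definition riemann ::
  "(paracomplex \<Rightarrow> paracomplex \<Rightarrow> paracomplex \<Rightarrow> real) \<Rightarrow> paracomplex \<Rightarrow> paracomplex \<Rightarrow> paracomplex \<Rightarrow> paracomplex \<Rightarrow> paracomplex"
  where "riemann g X Y Z p =
    levi_civita g X (levi_civita g Y (\<lambda>_. Z)) p - levi_civita g Y (levi_civita g X (\<lambda>_. Z)) p"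

definition gauss_curvature ::
  "(paracomplex \<Rightarrow> paracomplex \<Rightarrow> paracomplex \<Rightarrow> real) \<Rightarrow> paracomplex \<Rightarrow> real"
  where "gauss_curvature g p =
    (let X = (1, 0); Y = (0, 1) in
      g p (riemann g X Y Y p) X / (g p X X * g p Y Y - (g p X Y)\<^sup>2))"


section \<open>Surfaces in a space form, in coordinates\<close>

abbreviation d_u :: "(paracomplex \<Rightarrow> 'b::real_normed_vector) \<Rightarrow> paracomplex \<Rightarrow> 'b"
  where "d_u f \<equiv> dirder f (1, 0)"

abbreviation d_v :: "(paracomplex \<Rightarrow> 'b::real_normed_vector) \<Rightarrow> paracomplex \<Rightarrow> 'b"
  where "d_v f \<equiv> dirder f (0, 1)"

text \<open>Since \<open>s = (u + v) / sqrt 2\<close> and \<open>t = (u - v) / sqrt 2\<close>,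
  we have \<open>u = (s + t) / sqrt 2\<close> and \<open>v = (s - t) / sqrt 2\<close>.\<close>

abbreviation d_s :: "(paracomplex \<Rightarrow> 'b::real_normed_vector) \<Rightarrow> paracomplex \<Rightarrow> 'b"
  where "d_s f \<equiv> dirder f (1 / sqrt 2, 1 / sqrt 2)"

abbreviation d_t :: "(paracomplex \<Rightarrow> 'b::real_normed_vector) \<Rightarrow> paracomplex \<Rightarrow> 'b"
  where "d_t f \<equiv> dirder f (1 / sqrt 2, - (1 / sqrt 2))"

definition induced_metric ::
  "'n::finite set \<Rightarrow> (paracomplex \<Rightarrow> real^'n) \<Rightarrow> paracomplex \<Rightarrow> paracomplex \<Rightarrow> paracomplex \<Rightarrow> real"
  where "induced_metric S f p X Y = pinner S (dirder f X p) (dirder f Y p)"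

text \<open>Levi-Civita derivative of the space form, for a field \<open>W\<close> along \<open>f\<close> that is tangent to the
  space form: the projection of the ambient derivative along the position vector, whose square
  is \<open>1 / L0\<close> (and the ambient derivative itself if \<open>L0 = 0\<close>).\<close>

definition cov ::
  "'n::finite set \<Rightarrow> real \<Rightarrow> (paracomplex \<Rightarrow> real^'n) \<Rightarrow> paracomplex \<Rightarrow> (paracomplex \<Rightarrow> real^'n) \<Rightarrow> paracomplex \<Rightarrow> real^'n"
  where "cov S L0 f e W p = dirder W e p - (L0 * pinner S (dirder W e p) (f p)) *\<^sub>R f p"

text \<open>Component normal to the surface; meaningful where the induced metric is nondegenerate.\<close>

definition normal_part ::
  "'n::finite set \<Rightarrow> (paracomplex \<Rightarrow> real^'n) \<Rightarrow> paracomplex \<Rightarrow> real^'n \<Rightarrow> real^'n"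
  where "normal_part S f p x =
    (THE n. pinner S n (d_u f p) = 0 \<and> pinner S n (d_v f p) = 0 \<and> x - n \<in> span {d_u f p, d_v f p})"

definition normal_space ::
  "'n::finite set \<Rightarrow> real \<Rightarrow> (paracomplex \<Rightarrow> real^'n) \<Rightarrow> paracomplex \<Rightarrow> (real^'n) set"
  where "normal_space S L0 f p =
    {n \<in> tangent_sf S L0 (f p). pinner S n (d_u f p) = 0 \<and> pinner S n (d_v f p) = 0}"

definition second_fundamental_form ::
  "'n::finite set \<Rightarrow> real \<Rightarrow> (paracomplex \<Rightarrow> real^'n) \<Rightarrow> paracomplex \<Rightarrow> paracomplex \<Rightarrow> paracomplex \<Rightarrow> real^'n"
  where "second_fundamental_form S L0 f p X Y = normal_part S f p (cov S L0 f X (dirder f Y) p)"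

text \<open>Half the trace of the second fundamental form, with the inverse metric written out.\<close>

definition mean_curvature_vector ::
  "'n::finite set \<Rightarrow> real \<Rightarrow> (paracomplex \<Rightarrow> real^'n) \<Rightarrow> paracomplex \<Rightarrow> real^'n"
  where "mean_curvature_vector S L0 f p =
    (let X = (1, 0); Y = (0, 1); g = induced_metric S f p; b = second_fundamental_form S L0 f p in
      (1 / (2 * (g X X * g Y Y - (g X Y)\<^sup>2))) *\<^sub>R
        (g Y Y *\<^sub>R b X X - (2 * g X Y) *\<^sub>R b X Y + g X X *\<^sub>R b Y Y))"

definition normal_connection ::
  "'n::finite set \<Rightarrow> real \<Rightarrow> (paracomplex \<Rightarrow> real^'n) \<Rightarrow> paracomplex \<Rightarrow> (paracomplex \<Rightarrow> real^'n) \<Rightarrow> paracomplex \<Rightarrow> real^'n"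
  where "normal_connection S L0 f X \<xi> p = normal_part S f p (cov S L0 f X \<xi> p)"

text \<open>\<open>X, Y\<close> are constant vector fields, so there is no bracket term.\<close>

definition normal_curvature ::
  "'n::finite set \<Rightarrow> real \<Rightarrow> (paracomplex \<Rightarrow> real^'n) \<Rightarrow> paracomplex \<Rightarrow> paracomplex \<Rightarrow> (paracomplex \<Rightarrow> real^'n) \<Rightarrow> paracomplex \<Rightarrow> real^'n"
  where "normal_curvature S L0 f X Y \<xi> p =
    normal_connection S L0 f X (normal_connection S L0 f Y \<xi>) p -
    normal_connection S L0 f Y (normal_connection S L0 f X \<xi>) p"

definition normal_flat_on ::
  "'n::finite set \<Rightarrow> real \<Rightarrow> paracomplex set \<Rightarrow> (paracomplex \<Rightarrow> real^'n) \<Rightarrow> bool"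
  where "normal_flat_on S L0 U f \<longleftrightarrow>
    (\<forall>V \<xi>. open V \<and> V \<subseteq> U \<and> smooth_on V \<xi> \<and> (\<forall>p\<in>V. \<xi> p \<in> normal_space S L0 f p) \<longrightarrow>
      (\<forall>X Y. \<forall>p\<in>V. normal_curvature S L0 f X Y \<xi> p = 0))"

text \<open>The induced metric is \<open>exp (2 lam) (du du - dv dv)\<close>.\<close>

definition conformal_metric_on ::
  "'n::finite set \<Rightarrow> paracomplex set \<Rightarrow> (paracomplex \<Rightarrow> real^'n) \<Rightarrow> (paracomplex \<Rightarrow> real) \<Rightarrow> bool"
  where "conformal_metric_on S U f lam \<longleftrightarrow>
    smooth_on U lam \<and>
    (\<forall>p\<in>U. \<forall>X Y. induced_metric S f p X Y = exp (2 * lam p) * (fst X * fst Y - snd X * snd Y))"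

definition zmc_immersion_on ::
  "'n::finite set \<Rightarrow> real \<Rightarrow> paracomplex set \<Rightarrow> (paracomplex \<Rightarrow> real^'n) \<Rightarrow> (paracomplex \<Rightarrow> real) \<Rightarrow> bool"
  where "zmc_immersion_on S L0 U f lam \<longleftrightarrow>
    smooth_on U f \<and> f ` U \<subseteq> space_form S L0 \<and>
    (\<forall>p\<in>U. inj (frechet_derivative f (at p))) \<and>
    conformal_metric_on S U f lam \<and>
    (\<forall>p\<in>U. mean_curvature_vector S L0 f p = 0)"

definition K_neq_and_normal_flat_on ::
  "'n::finite set \<Rightarrow> real \<Rightarrow> paracomplex set \<Rightarrow> (paracomplex \<Rightarrow> real^'n) \<Rightarrow> bool"
  where "K_neq_and_normal_flat_on S L0 U f \<longleftrightarrow>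
    (\<forall>p\<in>U. gauss_curvature (induced_metric S f) p \<noteq> L0) \<and> normal_flat_on S L0 U f"

definition normal_frame_on ::
  "'n::finite set \<Rightarrow> real \<Rightarrow> paracomplex set \<Rightarrow> (paracomplex \<Rightarrow> real^'n) \<Rightarrow> (paracomplex \<Rightarrow> real) \<Rightarrow>
   (paracomplex \<Rightarrow> real^'n) \<Rightarrow> (paracomplex \<Rightarrow> real^'n) \<Rightarrow> bool"
  where "normal_frame_on S L0 U f lam N1 N2 \<longleftrightarrow>
    smooth_on U N1 \<and> smooth_on U N2 \<and>
    (\<forall>p\<in>U. N1 p \<in> normal_space S L0 f p \<and> N2 p \<in> normal_space S L0 f p \<and>
       pinner S (N1 p) (N1 p) = exp (2 * lam p) \<and>
       pinner S (N2 p) (N2 p) = - exp (2 * lam p) \<and>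
       pinner S (N1 p) (N2 p) = 0)"

text \<open>The functions \<open>a\<^sub>k, b\<^sub>k, m\<^sub>k\<close> are those of \<open>f\<close> with respect to some normal frame on \<open>U\<close>.\<close>

definition associated_functions_on ::
  "'n::finite set \<Rightarrow> real \<Rightarrow> paracomplex set \<Rightarrow> (paracomplex \<Rightarrow> real^'n) \<Rightarrow> (paracomplex \<Rightarrow> real) \<Rightarrow>
   (paracomplex \<Rightarrow> real) \<Rightarrow> (paracomplex \<Rightarrow> real) \<Rightarrow> (paracomplex \<Rightarrow> real) \<Rightarrow>
   (paracomplex \<Rightarrow> real) \<Rightarrow> (paracomplex \<Rightarrow> real) \<Rightarrow> (paracomplex \<Rightarrow> real) \<Rightarrow> bool"
  where "associated_functions_on S L0 U f lam a1 a2 b1 b2 m1 m2 \<longleftrightarrow>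
    (\<exists>N1 N2. normal_frame_on S L0 U f lam N1 N2 \<and>
      (\<forall>p\<in>U. let T1 = d_u f; T2 = d_v f; D1 = cov S L0 f (1, 0); D2 = cov S L0 f (0, 1);
           lu = d_u lam p; lv = d_v lam p in
         D1 T1 p = lu *\<^sub>R T1 p + lv *\<^sub>R T2 p + a1 p *\<^sub>R N1 p + b1 p *\<^sub>R N2 p \<and>
         D1 T2 p = lv *\<^sub>R T1 p + lu *\<^sub>R T2 p + a2 p *\<^sub>R N1 p + b2 p *\<^sub>R N2 p \<and>
         D2 T1 p = lv *\<^sub>R T1 p + lu *\<^sub>R T2 p + a2 p *\<^sub>R N1 p + b2 p *\<^sub>R N2 p \<and>
         D2 T2 p = lu *\<^sub>R T1 p + lv *\<^sub>R T2 p + a1 p *\<^sub>R N1 p + b1 p *\<^sub>R N2 p \<and>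
         D1 N1 p = - a1 p *\<^sub>R T1 p + a2 p *\<^sub>R T2 p + lu *\<^sub>R N1 p + m1 p *\<^sub>R N2 p \<and>
         D1 N2 p = b1 p *\<^sub>R T1 p - b2 p *\<^sub>R T2 p + m1 p *\<^sub>R N1 p + lu *\<^sub>R N2 p \<and>
         D2 N1 p = - a2 p *\<^sub>R T1 p + a1 p *\<^sub>R T2 p + lv *\<^sub>R N1 p + m2 p *\<^sub>R N2 p \<and>
         D2 N2 p = b2 p *\<^sub>R T1 p - b1 p *\<^sub>R T2 p + m2 p *\<^sub>R N1 p + lv *\<^sub>R N2 p))"


section \<open>The equations for the conformal factor and for the associated functions\<close>

definition star_on :: "real \<Rightarrow> paracomplex set \<Rightarrow> real \<Rightarrow> (paracomplex \<Rightarrow> real) \<Rightarrow> bool"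
  where "star_on L0 U eps lam \<longleftrightarrow>
    eps \<in> {1, -1} \<and> smooth_on U lam \<and>
    (\<forall>p\<in>U. d_u (d_u lam) p - d_v (d_v lam) p =
       - L0 * exp (2 * lam p) + eps * exp (- 2 * lam p))"

text \<open>The suffixes \<open>p\<close> and \<open>m\<close> stand for the subscripts \<open>+\<close> and \<open>-\<close>.\<close>

definition double_star_on ::
  "paracomplex set \<Rightarrow> real \<Rightarrow> (paracomplex \<Rightarrow> real) \<Rightarrow>
   (paracomplex \<Rightarrow> real) \<Rightarrow> (paracomplex \<Rightarrow> real) \<Rightarrow> (paracomplex \<Rightarrow> real) \<Rightarrow>
   (paracomplex \<Rightarrow> real) \<Rightarrow> (paracomplex \<Rightarrow> real) \<Rightarrow> (paracomplex \<Rightarrow> real) \<Rightarrow> bool"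
  where "double_star_on U eps lam a1 a2 b1 b2 m1 m2 \<longleftrightarrow>
    (\<exists>Pp Pm Qp Qm :: paracomplex \<Rightarrow> real. \<exists>c ep em :: real.
      ep \<in> {1, -1} \<and> em \<in> {1, -1} \<and>
      smooth_on U Pp \<and> smooth_on U Pm \<and> smooth_on U Qp \<and> smooth_on U Qm \<and>
      (\<forall>p\<in>U.
        let Xp = ep / 2 * (exp (Pp p) + eps * exp (Qp p));
            Xm = em / 2 * (exp (Pm p) + eps * exp (Qm p));
            Yp = ep / 2 * (exp (Pp p) - eps * exp (Qp p));
            Ym = em / 2 * (exp (Pm p) - eps * exp (Qm p));
            Qs = d_s (\<lambda>q. Qp q - Qm q) p;
            Pt = d_t (\<lambda>q. Pp q - Pm q) p
        in - 2 * lam p = Pp p + Qp p \<and> - 2 * lam p = Pm p + Qm p \<and>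
           Qm p = Pp p + c \<and> Qp p = Pm p + c \<and>
           m1 p = 1 / (2 * sqrt 2) * (Qs - Pt) \<and>
           m2 p = 1 / (2 * sqrt 2) * (Qs + Pt) \<and>
           a1 p = 1 / 2 * (Xp + Xm) \<and> a2 p = 1 / 2 * (Yp + Ym) \<and>
           b1 p = 1 / 2 * (Yp - Ym) \<and> b2 p = 1 / 2 * (Xp - Xm)))"

end

theory Submission
  imports Defs
begin

text \<open>In null coordinates a surface with zero mean curvature vector is governed by the two null components
  \<open>A\<close>, \<open>B\<close> of its second fundamental form: the Gauss equation gives \<open>K - L0\<close> as a nonzero multiple of
  \<open>\<langle>A, B\<rangle>\<close>, and the Ricci equation gives the normal curvature as a multiple of \<open>A \<and> B\<close>. The condition
  \<open>K \<noteq> L0\<close>, \<open>R = 0\<close> on the normal bundle therefore says that \<open>A\<close> and \<open>B\<close> are parallel and not null. By the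
  Codazzi equations \<open>\<langle>A, A\<rangle>\<close> and \<open>\<langle>B, B\<rangle>\<close> depend on one null coordinate each, so both can be normalized to
  the same sign by reparametrizing the null coordinates; then \<open>A\<close> is parallel in the normal bundle, and so is the
  complementary normal direction, which is in fact a constant vector. Conversely, the Gauss-Weingarten equations form a
  linear system whose integrability condition is the equation for the conformal factor. The same constant
  tensor built from two solutions yields the Gram relations of the constructed frame, the
  constant normal vector and the isometry between two solutions.\<close>

section \<open>Calculus of smooth maps\<close>

text \<open>Codazzi makes \<open>A\<close> parallel along one null direction and \<open>B\<close>
  along the other; \<open>A\<close> is parallel along both only once \<open>B\<close> is a constant
  multiple of it. A change of null coordinates with factors m and n scales \<open>A\<close> and
  \<open>B\<close> by m^2 and n^2, hence their squares by m^4 and n^4. Each square depends only on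
  the null coordinate whose factor can be adjusted against it, which is why fourth roots occur. With
  both squares equal to the same sign d, B = A or B = - A, and the Codazzi equation of
  \<open>B\<close> supplies the missing equation for \<open>A\<close>. The equations of the
  statement contain a free constant c, so the converse is carried out for every nonzero d, where d
  is the product of the two signs and exp (- c); only the normal form has d = 1 or d = - 1. The
  moving frame has four members when \<open>L0 = 0\<close> and five otherwise. A factor
  \<open>L0\<close> before each product with the position vector lets one set of relations serve
  both cases. These relations say that a certain sum of rank-one operators is the identity. The sum
  has zero derivative, so the relations persist along the surface without an appeal to uniqueness
  for differential equations.\<close>

lemma dirder_eqI: "(f has_derivative f') (at p) \<Longrightarrow> dirder f e p = f' e"
  using frechet_derivative_at by metis

lemma differentiable_has_dirder:
  "f differentiable (at p) \<Longrightarrow> (f has_derivative (\<lambda>e. dirder f e p)) (at p)"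
  by (simp add: frechet_derivative_works)

lemma dirder_linear:
  assumes "f differentiable (at p)"
  shows "dirder f (a *\<^sub>R x + b *\<^sub>R y) p = a *\<^sub>R dirder f x p + b *\<^sub>R dirder f y p"
  by (simp add: linear_add[OF linear_frechet_derivative[OF assms]]
      linear_scale[OF linear_frechet_derivative[OF assms]])

text \<open>The value of \<open>frechet_derivative\<close> is chosen from the set of all
  derivatives, and functions that agree near p have the same set. So the equality also holds where
  there is no derivative and the chosen value is arbitrary.\<close>

lemma dirder_cong_open:
  assumes "open U" "p \<in> U" "\<And>q. q \<in> U \<Longrightarrow> f q = g q"
  shows "dirder f e p = dirder g e p"
proof (cases "f differentiable (at p)")
  case True
  then show ?thesis
    using frechet_derivative_transform_within_open[OF True assms(1,2,3)] by simp
next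
  case False
  have "\<And>f'. (f has_derivative f') (at p) \<longleftrightarrow> (g has_derivative f') (at p)"
    using assms has_derivative_transform_within_open[of f _ p UNIV U g]
      has_derivative_transform_within_open[of g _ p UNIV U f] by metis
  then show ?thesis by (simp add: frechet_derivative_def)
qed

lemma differentiable_cong_open:
  assumes "open U" "p \<in> U" "\<And>q. q \<in> U \<Longrightarrow> f q = g q" "f differentiable (at p)"
  shows "g differentiable (at p)"
proof -
  obtain f' where "(f has_derivative f') (at p)" using assms(4) by (auto simp: differentiable_def)
  from has_derivative_transform_within_open[OF this assms(1,2)] assms(3)
  show ?thesis unfolding differentiable_def by blast
qed

lemma differentiable_upto_cong:
  assumes "open U" "\<And>q. q \<in> U \<Longrightarrow> f q = g q" "differentiable_upto k U f"
  shows "differentiable_upto k U g"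
  using assms(2,3)
proof (induction k arbitrary: f g)
  case 0
  then show ?case using continuous_on_eq[of U f g] by simp
next
  case (Suc k)
  have "differentiable_upto k U (dirder g e)" for e
    using Suc.IH[of "dirder f e" "dirder g e"] Suc.prems dirder_cong_open[OF assms(1), of _ f g e]
    by simp
  then show ?case
    using Suc.prems differentiable_cong_open[OF assms(1), of _ f g] by simp
qed

lemma differentiable_upto_subset:
  "V \<subseteq> U \<Longrightarrow> differentiable_upto k U f \<Longrightarrow> differentiable_upto k V f"
  by (induction k arbitrary: f) (auto intro: continuous_on_subset)

lemma differentiable_upto_SucD: "differentiable_upto (Suc k) U f \<Longrightarrow> differentiable_upto k U f"
proof (induction k arbitrary: f)
  case 0
  then show ?case
    by (auto intro!: continuous_at_imp_continuous_on differentiable_imp_continuous_within)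
next
  case (Suc k)
  then show ?case by (metis differentiable_upto.simps(2))
qed

lemma smooth_on_cong:
  "open U \<Longrightarrow> (\<And>q. q \<in> U \<Longrightarrow> f q = g q) \<Longrightarrow> smooth_on U f \<Longrightarrow> smooth_on U g"
  unfolding smooth_on_def using differentiable_upto_cong by blast

lemma smooth_on_subset: "V \<subseteq> U \<Longrightarrow> smooth_on U f \<Longrightarrow> smooth_on V f"
  unfolding smooth_on_def using differentiable_upto_subset by blast

lemma smooth_on_differentiable: "smooth_on U f \<Longrightarrow> p \<in> U \<Longrightarrow> f differentiable (at p)"
  unfolding smooth_on_def by (metis differentiable_upto.simps(2))

lemma smooth_on_dirder: "smooth_on U f \<Longrightarrow> smooth_on U (dirder f e)"
  unfolding smooth_on_def by (metis differentiable_upto.simps(2))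

lemma smooth_on_continuous_on: "smooth_on U f \<Longrightarrow> continuous_on U f"
  unfolding smooth_on_def by (metis differentiable_upto.simps(1))

lemma smooth_on_has_derivative:
  "smooth_on U f \<Longrightarrow> p \<in> U \<Longrightarrow> (f has_derivative (\<lambda>e. dirder f e p)) (at p)"
  by (simp add: differentiable_has_dirder smooth_on_differentiable)

lemma differentiable_upto_SucI:
  assumes "open U" "\<And>p. p \<in> U \<Longrightarrow> (f has_derivative (\<lambda>e. f' e p)) (at p)"
    "\<And>e. differentiable_upto k U (f' e)"
  shows "differentiable_upto (Suc k) U f"
proof -
  have "differentiable_upto k U (dirder f e)" for e
    by (rule differentiable_upto_cong[OF assms(1) _ assms(3)[of e]])
      (simp add: dirder_eqI[OF assms(2)])
  then show ?thesis using assms(2) by (auto simp: differentiable_def)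
qed

lemma smooth_onI:
  assumes "open U" "\<And>p. p \<in> U \<Longrightarrow> (f has_derivative (\<lambda>e. f' e p)) (at p)"
    "\<And>e. smooth_on U (f' e)"
  shows "smooth_on U f"
  unfolding smooth_on_def
proof
  fix k show "differentiable_upto k U f"
    by (rule differentiable_upto_SucD, rule differentiable_upto_SucI[OF assms(1,2)])
      (use assms(3) in \<open>auto simp: smooth_on_def\<close>)
qed

section \<open>Algebraic operations, composition and elementary functions preserve
  smoothness\<close>

lemma differentiable_upto_const: "differentiable_upto k U (\<lambda>_. c)"
  by (induction k arbitrary: c) auto

lemma differentiable_upto_bounded_linear:
  assumes "bounded_linear L" "open U" "differentiable_upto k U f"
  shows "differentiable_upto k U (\<lambda>p. L (f p))"
  using assms(3)
proof (induction k arbitrary: f)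
  case 0
  then show ?case by (simp add: bounded_linear.continuous_on[OF assms(1)])
next
  case (Suc k)
  show ?case
    by (rule differentiable_upto_SucI[OF assms(2), where f' = "\<lambda>e p. L (dirder f e p)"])
      (use Suc in \<open>auto intro!: bounded_linear.has_derivative[OF assms(1)] differentiable_has_dirder\<close>)
qed

lemma differentiable_upto_add:
  assumes "open U" "differentiable_upto k U f" "differentiable_upto k U g"
  shows "differentiable_upto k U (\<lambda>p. f p + g p)"
  using assms(2,3)
proof (induction k arbitrary: f g)
  case 0
  then show ?case by (simp add: continuous_on_add)
next
  case (Suc k)
  show ?case
    by (rule differentiable_upto_SucI[OF assms(1), where f' = "\<lambda>e p. dirder f e p + dirder g e p"])
      (use Suc in \<open>auto intro!: has_derivative_add differentiable_has_dirder\<close>)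
qed

lemma differentiable_upto_bilinear:
  assumes "bounded_bilinear bil" "open U" "differentiable_upto k U f" "differentiable_upto k U g"
  shows "differentiable_upto k U (\<lambda>p. bil (f p) (g p))"
  using assms(3,4)
proof (induction k arbitrary: f g)
  case 0
  then show ?case by (simp add: bounded_bilinear.continuous_on[OF assms(1)])
next
  case (Suc k)
  show ?case
  proof (rule differentiable_upto_SucI[OF assms(2),
        where f' = "\<lambda>e p. bil (f p) (dirder g e p) + bil (dirder f e p) (g p)"])
    show "((\<lambda>p. bil (f p) (g p)) has_derivative
        (\<lambda>e. bil (f p) (dirder g e p) + bil (dirder f e p) (g p))) (at p)" if "p \<in> U" for p
      using Suc.prems that
      by (auto intro!: bounded_bilinear.FDERIV[OF assms(1)] differentiable_has_dirder)
    show "differentiable_upto k U (\<lambda>p. bil (f p) (dirder g e p) + bil (dirder f e p) (g p))" for e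
      using Suc by (intro differentiable_upto_add[OF assms(2)] Suc.IH)
        (auto intro: differentiable_upto_SucD)
  qed
qed

lemma smooth_on_const: "smooth_on U (\<lambda>_. c)"
  by (simp add: smooth_on_def differentiable_upto_const)

lemma smooth_on_linear_comp:
  "bounded_linear L \<Longrightarrow> open U \<Longrightarrow> smooth_on U f \<Longrightarrow> smooth_on U (\<lambda>p. L (f p))"
  by (simp add: smooth_on_def differentiable_upto_bounded_linear)

lemma smooth_on_id: "open U \<Longrightarrow> smooth_on U (\<lambda>p. p)"
  by (rule smooth_onI[where f' = "\<lambda>e _. e"]) (auto intro: smooth_on_const)

lemma smooth_on_bounded_linear: "bounded_linear L \<Longrightarrow> open U \<Longrightarrow> smooth_on U L"
  using smooth_on_linear_comp[of L U "\<lambda>p. p"] smooth_on_id[of U] by simp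

lemma smooth_on_add:
  "open U \<Longrightarrow> smooth_on U f \<Longrightarrow> smooth_on U g \<Longrightarrow> smooth_on U (\<lambda>p. f p + g p)"
  by (simp add: smooth_on_def differentiable_upto_add)

lemma smooth_on_bilinear:
  "bounded_bilinear bil \<Longrightarrow> open U \<Longrightarrow> smooth_on U f \<Longrightarrow> smooth_on U g \<Longrightarrow>
    smooth_on U (\<lambda>p. bil (f p) (g p))"
  by (simp add: smooth_on_def differentiable_upto_bilinear)

lemma smooth_on_minus: "open U \<Longrightarrow> smooth_on U f \<Longrightarrow> smooth_on U (\<lambda>p. - f p)"
  by (rule smooth_on_linear_comp) (auto intro: bounded_linear_minus bounded_linear_ident)

lemma smooth_on_diff:
  "open U \<Longrightarrow> smooth_on U f \<Longrightarrow> smooth_on U g \<Longrightarrow> smooth_on U (\<lambda>p. f p - g p)"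
  using smooth_on_add[OF _ _ smooth_on_minus, of U f g] by simp

lemma smooth_on_scaleR:
  "open U \<Longrightarrow> smooth_on U f \<Longrightarrow> smooth_on U g \<Longrightarrow> smooth_on U (\<lambda>p. f p *\<^sub>R g p)"
  by (rule smooth_on_bilinear[OF bounded_bilinear_scaleR])

lemma smooth_on_mult:
  fixes f g :: "_ \<Rightarrow> real"
  shows "open U \<Longrightarrow> smooth_on U f \<Longrightarrow> smooth_on U g \<Longrightarrow> smooth_on U (\<lambda>p. f p * g p)"
  by (rule smooth_on_bilinear[OF bounded_bilinear_mult])

lemma smooth_on_Pair:
  assumes "open U" "smooth_on U f" "smooth_on U g"
  shows "smooth_on U (\<lambda>p. (f p, g p))"
proof -
  have "smooth_on U (\<lambda>p. (f p, 0) + (0, g p))"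
    using assms by (intro smooth_on_add smooth_on_linear_comp[where L = "\<lambda>x. (x, 0)"]
        smooth_on_linear_comp[where L = "\<lambda>x. (0, x)"] bounded_linear_Pair bounded_linear_zero
        bounded_linear_ident)
  then show ?thesis by simp
qed

lemma differentiable_upto_sum:
  assumes "open U" "\<And>i. i \<in> I \<Longrightarrow> differentiable_upto k U (f i)"
  shows "differentiable_upto k U (\<lambda>p. \<Sum>i\<in>I. f i p)"
  using assms(2)
  by (induction I rule: infinite_finite_induct)
    (auto intro!: differentiable_upto_const differentiable_upto_add assms(1))

text \<open>The direction in which \<open>g\<close> is differentiated varies with the point.
  Expanding it in the basis of the Euclidean codomain of \<open>f\<close> turns the chain rule into
  a finite sum of derivatives in fixed directions, to which the induction hypothesis applies. Only
  \<open>f\<close> is of limited order; bootstrap arguments call for this asymmetric form.\<close>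

lemma differentiable_upto_compose:
  fixes f :: "'a::real_normed_vector \<Rightarrow> 'b::euclidean_space"
  assumes "open U" "differentiable_upto k U f" "smooth_on V g" "f ` U \<subseteq> V"
  shows "differentiable_upto k U (\<lambda>p. g (f p))"
  using assms(2,3)
proof (induction k arbitrary: g)
  case 0
  then show ?case
    using assms(4) continuous_on_compose2 smooth_on_continuous_on
    by (metis differentiable_upto.simps(1))
next
  case (Suc k)
  let ?f' = "\<lambda>e p. \<Sum>b\<in>Basis. (dirder f e p \<bullet> b) *\<^sub>R dirder g b (f p)"
  show ?case
  proof (rule differentiable_upto_SucI[OF assms(1), where f' = ?f'])
    fix p assume p: "p \<in> U"
    have g: "(g has_derivative (\<lambda>e. dirder g e (f p))) (at (f p))"
      using p assms(4) by (intro smooth_on_has_derivative[OF Suc.prems(2)]) auto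
    have lin: "linear (\<lambda>e. dirder g e (f p))"
      using g by (rule has_derivative_linear)
    have "((\<lambda>p. g (f p)) has_derivative (\<lambda>e. dirder g (dirder f e p) (f p))) (at p)"
      by (rule has_derivative_compose[where g = g and f = f, OF _ g], rule differentiable_has_dirder)
        (use Suc.prems p in auto)
    moreover have "dirder g (dirder f e p) (f p) = ?f' e p" for e
    proof -
      have "dirder g (dirder f e p) (f p) = dirder g (\<Sum>b\<in>Basis. (dirder f e p \<bullet> b) *\<^sub>R b) (f p)"
        by (simp only: euclidean_representation)
      then show ?thesis
        by (simp add: linear_sum[OF lin] linear_scale[OF lin])
    qed
    ultimately show "((\<lambda>p. g (f p)) has_derivative (\<lambda>e. ?f' e p)) (at p)" by simp
  next
    fix e
    have "differentiable_upto k U (\<lambda>p. dirder g b (f p))" for b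
      by (rule Suc.IH) (use Suc.prems in \<open>auto intro: differentiable_upto_SucD smooth_on_dirder
          simp del: differentiable_upto.simps\<close>)
    moreover have "differentiable_upto k U (\<lambda>p. dirder f e p \<bullet> b)" for b
      by (rule differentiable_upto_bounded_linear[OF bounded_linear_inner_left assms(1)])
        (use Suc.prems in auto)
    ultimately show "differentiable_upto k U (?f' e)"
      by (intro differentiable_upto_sum differentiable_upto_bilinear[OF bounded_bilinear_scaleR] assms(1))
  qed
qed

lemma smooth_on_compose:
  fixes f :: "'a::real_normed_vector \<Rightarrow> 'b::euclidean_space"
  assumes "open U" "smooth_on U f" "smooth_on V g" "f ` U \<subseteq> V"
  shows "smooth_on U (\<lambda>p. g (f p))"
  using assms differentiable_upto_compose[OF assms(1) _ assms(3,4)] by (simp add: smooth_on_def)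

text \<open>A solution of a system that expresses its derivative smoothly through the solution itself
  gains one order of differentiability from each order it already has.\<close>

lemma smooth_on_bootstrap:
  assumes "open U" "continuous_on U f" "\<And>p. p \<in> U \<Longrightarrow> (f has_derivative (\<lambda>e. f' e p)) (at p)"
    "\<And>k e. differentiable_upto k U f \<Longrightarrow> differentiable_upto k U (f' e)"
  shows "smooth_on U f"
  unfolding smooth_on_def
proof
  fix k show "differentiable_upto k U f"
    by (induction k) (use assms in \<open>auto intro: differentiable_upto_SucI simp del: differentiable_upto.simps(2)\<close>)
qed

lemma smooth_on_exp: "smooth_on UNIV (exp :: real \<Rightarrow> real)"
  by (rule smooth_on_bootstrap[where f' = "\<lambda>e x. e * exp x"])
    (auto intro!: derivative_eq_intros continuous_intros
      differentiable_upto_bounded_linear[OF bounded_linear_mult_right])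

lemma smooth_on_inverse: "smooth_on {x. x \<noteq> 0} (inverse :: real \<Rightarrow> real)"
  by (rule smooth_on_bootstrap[where f' = "\<lambda>e x. - (inverse x * e * inverse x)"])
    (auto intro!: derivative_eq_intros continuous_intros open_Collect_neq
      differentiable_upto_bilinear[OF bounded_bilinear_mult] differentiable_upto_const
      differentiable_upto_bounded_linear[OF bounded_linear_minus[OF bounded_linear_ident]])

lemma smooth_on_ln: "smooth_on {0<..} (ln :: real \<Rightarrow> real)"
proof (rule smooth_onI[where f' = "\<lambda>e x. e * inverse x"])
  show "smooth_on {0<..} (\<lambda>x. e * inverse x)" for e :: real
    by (intro smooth_on_mult smooth_on_const open_greaterThan)
      (rule smooth_on_subset[OF _ smooth_on_inverse], auto)
qed (auto intro!: derivative_eq_intros simp: divide_inverse)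

lemma smooth_on_exp_comp: "open U \<Longrightarrow> smooth_on U f \<Longrightarrow> smooth_on U (\<lambda>p. exp (f p :: real))"
  by (rule smooth_on_compose[OF _ _ smooth_on_exp]) auto

lemma smooth_on_inverse_comp:
  "open U \<Longrightarrow> smooth_on U f \<Longrightarrow> (\<And>p. p \<in> U \<Longrightarrow> f p \<noteq> 0) \<Longrightarrow> smooth_on U (\<lambda>p. inverse (f p :: real))"
  by (rule smooth_on_compose[OF _ _ smooth_on_inverse]) auto

lemma smooth_on_ln_comp:
  "open U \<Longrightarrow> smooth_on U f \<Longrightarrow> (\<And>p. p \<in> U \<Longrightarrow> f p > 0) \<Longrightarrow> smooth_on U (\<lambda>p. ln (f p :: real))"
  by (rule smooth_on_compose[OF _ _ smooth_on_ln]) auto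

lemmas smooth_on_intros = smooth_on_const smooth_on_id smooth_on_add smooth_on_diff smooth_on_minus
  smooth_on_scaleR smooth_on_mult smooth_on_exp_comp smooth_on_Pair smooth_on_dirder

section \<open>Rules for directional derivatives\<close>

lemma dirder_const [simp]: "dirder (\<lambda>_. c) e p = 0"
  by simp

lemma dirder_bilinear:
  assumes "bounded_bilinear bil" "f differentiable (at p)" "g differentiable (at p)"
  shows "dirder (\<lambda>q. bil (f q) (g q)) e p = bil (f p) (dirder g e p) + bil (dirder f e p) (g p)"
  by (rule dirder_eqI[OF bounded_bilinear.FDERIV[OF assms(1)
          differentiable_has_dirder[OF assms(2)] differentiable_has_dirder[OF assms(3)]]])

lemma dirder_add [simp]:
  "f differentiable (at p) \<Longrightarrow> g differentiable (at p) \<Longrightarrow>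
    dirder (\<lambda>q. f q + g q) e p = dirder f e p + dirder g e p"
  by (rule dirder_eqI[OF has_derivative_add]) (rule differentiable_has_dirder, assumption)+

lemma dirder_diff [simp]:
  "f differentiable (at p) \<Longrightarrow> g differentiable (at p) \<Longrightarrow>
    dirder (\<lambda>q. f q - g q) e p = dirder f e p - dirder g e p"
  by (rule dirder_eqI[OF has_derivative_diff]) (rule differentiable_has_dirder, assumption)+

lemma dirder_minus [simp]:
  "f differentiable (at p) \<Longrightarrow> dirder (\<lambda>q. - f q) e p = - dirder f e p"
  by (rule dirder_eqI[OF has_derivative_minus]) (rule differentiable_has_dirder)

lemma dirder_scaleR [simp]:
  "f differentiable (at p) \<Longrightarrow> g differentiable (at p) \<Longrightarrow>
    dirder (\<lambda>q. f q *\<^sub>R g q) e p = f p *\<^sub>R dirder g e p + dirder f e p *\<^sub>R g p"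
  by (rule dirder_bilinear[OF bounded_bilinear_scaleR])

lemma dirder_mult [simp]:
  fixes f g :: "_ \<Rightarrow> real"
  shows "f differentiable (at p) \<Longrightarrow> g differentiable (at p) \<Longrightarrow>
    dirder (\<lambda>q. f q * g q) e p = f p * dirder g e p + dirder f e p * g p"
  by (rule dirder_bilinear[OF bounded_bilinear_mult])

lemma has_derivative_exp_comp:
  "f differentiable (at p) \<Longrightarrow>
    ((\<lambda>q. exp (f q :: real)) has_derivative (\<lambda>e. exp (f p) * dirder f e p)) (at p)"
  by (rule has_derivative_eq_rhs[OF has_derivative_exp[OF differentiable_has_dirder]]) auto

lemma differentiable_exp_comp [simp]:
  "f differentiable (at p) \<Longrightarrow> (\<lambda>q. exp (f q :: real)) differentiable (at p)"
  using has_derivative_exp_comp by (auto simp: differentiable_def)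

lemma dirder_exp [simp]:
  "f differentiable (at p) \<Longrightarrow> dirder (\<lambda>q. exp (f q :: real)) e p = exp (f p) * dirder f e p"
  by (rule dirder_eqI[OF has_derivative_exp_comp])

lemma has_derivative_divide_const:
  "f differentiable (at p) \<Longrightarrow>
    ((\<lambda>q. f q / c :: real) has_derivative (\<lambda>e. dirder f e p / c)) (at p)"
  by (rule bounded_linear.has_derivative[OF bounded_linear_divide differentiable_has_dirder])

lemma differentiable_divide_const [simp]:
  "f differentiable (at p) \<Longrightarrow> (\<lambda>q. f q / c :: real) differentiable (at p)"
  using has_derivative_divide_const unfolding differentiable_def by blast

lemma dirder_divide_const [simp]:
  "f differentiable (at p) \<Longrightarrow> dirder (\<lambda>q. f q / c :: real) e p = dirder f e p / c"
  by (rule dirder_eqI[OF has_derivative_divide_const])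

lemma dirder_compose:
  assumes "f differentiable (at p)" "g differentiable (at (f p))"
  shows "dirder (\<lambda>q. g (f q)) e p = dirder g (dirder f e p) (f p)"
  by (rule dirder_eqI[OF has_derivative_compose[where f = f and g = g, OF
        differentiable_has_dirder[OF assms(1)] differentiable_has_dirder[OF assms(2)]]])

section \<open>Symmetry of second derivatives\<close>

text \<open>The second difference of \<open>f\<close> over a small parallelogram is h^2 times a
  mixed derivative at some point of it, and this works in either order of the two directions. Both
  mixed derivatives are continuous, so values differing by 2 e at p cannot both be approximated
  within e by a common number.\<close>

lemma symmetric_dirder_real:
  fixes f :: "'a::real_normed_vector \<Rightarrow> real"
  assumes U: "open U" "p \<in> U" and f: "smooth_on U f"
  shows "dirder (dirder f a) b p = dirder (dirder f b) a p"
proof (rule ccontr)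
  let ?L = "\<lambda>a b q. dirder (dirder f a) b q"
  assume "?L a b p \<noteq> ?L b a p"
  define e where "e = \<bar>?L a b p - ?L b a p\<bar> / 2"
  have e: "e > 0" using \<open>?L a b p \<noteq> ?L b a p\<close> by (simp add: e_def)
  have cont: "continuous_on U (?L x y)" for x y
    by (intro smooth_on_continuous_on smooth_on_dirder f)
  have "\<exists>d>0. \<forall>q. dist q p < d \<longrightarrow> q \<in> U \<and> \<bar>?L x y q - ?L x y p\<bar> < e" for x y
  proof -
    obtain d1 where "d1 > 0" "ball p d1 \<subseteq> U" using U open_contains_ball by blast
    moreover obtain d2 where "d2 > 0" "\<And>q. q \<in> U \<Longrightarrow> dist q p < d2 \<Longrightarrow> dist (?L x y q) (?L x y p) < e"
      using cont[of x y] U e unfolding continuous_on_iff by metis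
    ultimately show ?thesis
      by (intro exI[of _ "min d1 d2"]) (auto simp: subset_iff dist_real_def dist_commute)
  qed
  then obtain d1 d2 where d: "d1 > 0" "d2 > 0"
    "\<And>q. dist q p < d1 \<Longrightarrow> q \<in> U \<and> \<bar>?L a b q - ?L a b p\<bar> < e"
    "\<And>q. dist q p < d2 \<Longrightarrow> q \<in> U \<and> \<bar>?L b a q - ?L b a p\<bar> < e" by metis
  define d where "d = min d1 d2"
  \<comment> \<open>With this h the parallelogram with sides h a and h b stays within distance d of
    p; the summand 1 covers the case that a and b are both zero.\<close>
  define h where "h = d / (2 * (norm a + norm b + 1))"
  have h: "h > 0" using d by (simp add: h_def d_def add_nonneg_pos)
  have near: "dist (p + x *\<^sub>R a + y *\<^sub>R b) p < d" if "0 \<le> x" "x \<le> h" "0 \<le> y" "y \<le> h" for x y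
  proof -
    have "norm (x *\<^sub>R a + y *\<^sub>R b) \<le> x * norm a + y * norm b"
      using that by (metis abs_of_nonneg norm_scaleR norm_triangle_ineq)
    also have "\<dots> \<le> h * norm a + h * norm b"
      using that by (intro add_mono mult_right_mono) auto
    also have "\<dots> = d * ((norm a + norm b) / (2 * (norm a + norm b + 1)))"
      by (simp add: h_def distrib_left add_divide_distrib)
    also have "\<dots> < d * 1"
    proof (rule mult_strict_left_mono)
      have "m / (2 * (m + 1)) < 1" if "0 \<le> m" for m :: real
        using that by (simp add: field_simps)
      from this[of "norm a + norm b"] show "(norm a + norm b) / (2 * (norm a + norm b + 1)) < 1"
        by simp
    qed (use d d_def in auto)
    finally show ?thesis by (simp add: dist_norm add.assoc)
  qed
  \<comment> \<open>The mean value theorem is used twice: in direction a for the difference of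
    \<open>f\<close> along two opposite sides, then in direction b for
    \<open>dirder f a\<close>.\<close>
  have main: "\<exists>x y. 0 \<le> x \<and> x \<le> h \<and> 0 \<le> y \<and> y \<le> h \<and>
      f (p + h *\<^sub>R a + h *\<^sub>R b) - f (p + h *\<^sub>R a) - f (p + h *\<^sub>R b) + f p
        = h * h * ?L a b (p + x *\<^sub>R a + y *\<^sub>R b)"
    if nr: "\<And>x y. 0 \<le> x \<Longrightarrow> x \<le> h \<Longrightarrow> 0 \<le> y \<Longrightarrow> y \<le> h \<Longrightarrow> p + x *\<^sub>R a + y *\<^sub>R b \<in> U" for a b
  proof -
    define g where "g x = f (p + x *\<^sub>R a + h *\<^sub>R b) - f (p + x *\<^sub>R a)" for x
    have 1: "((\<lambda>x. f (p + x *\<^sub>R a + y *\<^sub>R b)) has_real_derivative dirder f a (p + x *\<^sub>R a + y *\<^sub>R b)) (at x)"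
      if "0 \<le> x" "x \<le> h" "0 \<le> y" "y \<le> h" for x y
    proof -
      have dd: "(f has_derivative (\<lambda>e. dirder f e (p + x *\<^sub>R a + y *\<^sub>R b))) (at (p + x *\<^sub>R a + y *\<^sub>R b))"
        by (rule smooth_on_has_derivative[OF f nr[OF that]])
      have "((\<lambda>x. f (p + x *\<^sub>R a + y *\<^sub>R b)) has_derivative
          (\<lambda>s. dirder f (s *\<^sub>R a) (p + x *\<^sub>R a + y *\<^sub>R b))) (at x)"
        by (rule has_derivative_compose[where g = f and f = "\<lambda>x. p + x *\<^sub>R a + y *\<^sub>R b", OF _ dd]) (auto intro!: derivative_eq_intros)
      then show ?thesis
        by (simp add: has_field_derivative_def linear_scale[OF has_derivative_linear[OF dd]] mult_commute_abs)
    qed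
    have 2: "((\<lambda>y. dirder f a (p + x *\<^sub>R a + y *\<^sub>R b)) has_real_derivative
        ?L a b (p + x *\<^sub>R a + y *\<^sub>R b)) (at y)" if "0 \<le> x" "x \<le> h" "0 \<le> y" "y \<le> h" for x y
    proof -
      have dd: "(dirder f a has_derivative (\<lambda>e. dirder (dirder f a) e (p + x *\<^sub>R a + y *\<^sub>R b)))
          (at (p + x *\<^sub>R a + y *\<^sub>R b))"
        by (rule smooth_on_has_derivative[OF smooth_on_dirder[OF f] nr[OF that]])
      have "((\<lambda>y. dirder f a (p + x *\<^sub>R a + y *\<^sub>R b)) has_derivative
          (\<lambda>s. dirder (dirder f a) (s *\<^sub>R b) (p + x *\<^sub>R a + y *\<^sub>R b))) (at y)"
        by (rule has_derivative_compose[where g = "dirder f a" and f = "\<lambda>y. p + x *\<^sub>R a + y *\<^sub>R b", OF _ dd]) (auto intro!: derivative_eq_intros)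
      then show ?thesis
        by (simp add: has_field_derivative_def linear_scale[OF has_derivative_linear[OF dd]] mult_commute_abs)
    qed
    have "\<exists>x. 0 < x \<and> x < h \<and> g h - g 0 =
        (h - 0) * (dirder f a (p + x *\<^sub>R a + h *\<^sub>R b) - dirder f a (p + x *\<^sub>R a))"
    proof (rule MVT2[OF h])
      fix x assume "0 \<le> x" "x \<le> h"
      then show "(g has_real_derivative
          dirder f a (p + x *\<^sub>R a + h *\<^sub>R b) - dirder f a (p + x *\<^sub>R a)) (at x)"
        using 1[of x h] 1[of x 0] h unfolding g_def by (auto intro!: derivative_eq_intros)
    qed
    then obtain x where x: "0 < x" "x < h" and
      gx: "g h - g 0 = h * (dirder f a (p + x *\<^sub>R a + h *\<^sub>R b) - dirder f a (p + x *\<^sub>R a))" by auto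
    have "\<exists>y. 0 < y \<and> y < h \<and>
        dirder f a (p + x *\<^sub>R a + h *\<^sub>R b) - dirder f a (p + x *\<^sub>R a + 0 *\<^sub>R b) =
        (h - 0) * ?L a b (p + x *\<^sub>R a + y *\<^sub>R b)"
      by (rule MVT2[OF h]) (use 2 x in auto)
    then obtain y where "0 < y" "y < h"
      "dirder f a (p + x *\<^sub>R a + h *\<^sub>R b) - dirder f a (p + x *\<^sub>R a) = h * ?L a b (p + x *\<^sub>R a + y *\<^sub>R b)"
      by auto
    then show ?thesis using gx x
      by (intro exI[of _ x] exI[of _ y]) (simp add: g_def algebra_simps)
  qed
  have inU: "p + x *\<^sub>R a + y *\<^sub>R b \<in> U" if "0 \<le> x" "x \<le> h" "0 \<le> y" "y \<le> h" for x y
    using d(3) near[OF that] by (simp add: d_def)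
  have inU': "p + x *\<^sub>R b + y *\<^sub>R a \<in> U" if "0 \<le> x" "x \<le> h" "0 \<le> y" "y \<le> h" for x y
    using inU[OF that(3,4,1,2)] by (simp add: algebra_simps)
  obtain x y where xy: "0 \<le> x" "x \<le> h" "0 \<le> y" "y \<le> h"
    "f (p + h *\<^sub>R a + h *\<^sub>R b) - f (p + h *\<^sub>R a) - f (p + h *\<^sub>R b) + f p
        = h * h * ?L a b (p + x *\<^sub>R a + y *\<^sub>R b)"
    using main[of a b, OF inU] by blast
  obtain x' y' where xy': "0 \<le> x'" "x' \<le> h" "0 \<le> y'" "y' \<le> h"
    "f (p + h *\<^sub>R b + h *\<^sub>R a) - f (p + h *\<^sub>R b) - f (p + h *\<^sub>R a) + f p
        = h * h * ?L b a (p + x' *\<^sub>R b + y' *\<^sub>R a)"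
    using main[of b a, OF inU'] by blast
  have eq: "p + h *\<^sub>R b + h *\<^sub>R a = p + h *\<^sub>R a + h *\<^sub>R b" by (simp add: algebra_simps)
  have "h * h * ?L a b (p + x *\<^sub>R a + y *\<^sub>R b) = h * h * ?L b a (p + x' *\<^sub>R b + y' *\<^sub>R a)"
    using xy(5) xy'(5) unfolding eq by linarith
  then have "?L a b (p + x *\<^sub>R a + y *\<^sub>R b) = ?L b a (p + x' *\<^sub>R b + y' *\<^sub>R a)"
    using h by simp
  moreover have "\<bar>?L a b (p + x *\<^sub>R a + y *\<^sub>R b) - ?L a b p\<bar> < e"
    using d(3) near[OF xy(1-4)] by (simp add: d_def)
  moreover have "\<bar>?L b a (p + x' *\<^sub>R b + y' *\<^sub>R a) - ?L b a p\<bar> < e"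
    using d(4)[of "p + x' *\<^sub>R b + y' *\<^sub>R a"] near[OF xy'(3,4,1,2)]
    by (simp add: d_def add.commute add.left_commute)
  moreover have "\<bar>?L a b p - ?L b a p\<bar> = 2 * e" by (simp add: e_def)
  ultimately show False by linarith
qed

lemma symmetric_dirder:
  fixes f :: "'a::real_normed_vector \<Rightarrow> 'b::euclidean_space"
  assumes "open U" "p \<in> U" "smooth_on U f"
  shows "dirder (dirder f a) b p = dirder (dirder f b) a p"
proof (rule euclidean_eqI)
  fix i :: 'b
  have *: "dirder (\<lambda>q. g q \<bullet> i) x q = dirder g x q \<bullet> i" if "smooth_on U g" "q \<in> U" for g :: "'a \<Rightarrow> 'b" and x q
    by (rule dirder_eqI[OF has_derivative_inner_left[OF smooth_on_has_derivative[OF that]]])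
  have **: "dirder (dirder (\<lambda>q. f q \<bullet> i) x) y p = dirder (dirder f x) y p \<bullet> i" for x y
    using dirder_cong_open[OF assms(1,2) *[OF assms(3)]]
    by (simp add: *[OF smooth_on_dirder[OF assms(3)] assms(2)])
  have "smooth_on U (\<lambda>q. f q \<bullet> i)"
    by (rule smooth_on_linear_comp[OF bounded_linear_inner_left assms(1,3)])
  from symmetric_dirder_real[OF assms(1,2) this]
  show "dirder (dirder f a) b p \<bullet> i = dirder (dirder f b) a p \<bullet> i"
    by (simp add: **)
qed

section \<open>Flat linear systems on a rectangle\<close>

text \<open>Rescaling to a fixed interval moves the variable upper limit into the integrand, where
  continuity of parameter integrals can be applied.\<close>

lemma integral_affine_unit:
  fixes f :: "real \<Rightarrow> 'b::banach"
  assumes "continuous_on {a..t} f" "a \<le> t"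
  shows "integral {a..t} f = (t - a) *\<^sub>R integral {0..1} (\<lambda>x. f (a + x * (t - a)))"
proof (cases "a = t")
  case False
  then have t: "t - a > 0" using assms(2) by simp
  have "(f has_integral integral {a..t} f) (cbox a t)"
    using assms(1) by (simp add: integrable_continuous_real integrable_integral)
  from has_integral_affinity'[OF this t, of a]
  have "((\<lambda>x. f (a + x * (t - a))) has_integral (integral {a..t} f /\<^sub>R (t - a))) {0..1}"
    using t by (simp add: mult.commute add.commute)
  then show ?thesis using t by (simp add: integral_unique)
qed simp

lemma continuous_on_integral_upper:
  fixes g :: "real \<times> real \<Rightarrow> 'b::banach"
  assumes "continuous_on ({a1..b1} \<times> {a2..b2}) g"
  shows "continuous_on ({a1..b1} \<times> {a2..b2}) (\<lambda>p. integral {a2..snd p} (\<lambda>x. g (fst p, x)))"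
proof -
  let ?R = "{a1..b1} \<times> {a2..b2}"
  have inR: "(s, a2 + x * (t - a2)) \<in> ?R" if "(s, t) \<in> ?R" "x \<in> {0..1}" for s t x
  proof -
    have "0 \<le> x * (t - a2)" "x * (t - a2) \<le> t - a2"
      using that by (auto intro!: mult_left_le_one_le)
    then show ?thesis using that by auto
  qed
  have eq: "integral {a2..snd p} (\<lambda>x. g (fst p, x)) =
      (snd p - a2) *\<^sub>R integral (cbox 0 1) (\<lambda>x. g (fst p, a2 + x * (snd p - a2)))" if "p \<in> ?R" for p
  proof -
    have "continuous_on {a2..snd p} (\<lambda>x. g (fst p, x))"
      using that by (intro continuous_on_compose2[OF assms]) (auto intro!: continuous_intros)
    then show ?thesis using integral_affine_unit[of a2 "snd p" "\<lambda>x. g (fst p, x)"] that by auto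
  qed
  have "continuous_on (?R \<times> cbox 0 1) (\<lambda>(p, x). g (fst p, a2 + x * (snd p - a2)))"
    unfolding case_prod_beta
  proof (rule continuous_on_compose2[OF assms])
    show "continuous_on (?R \<times> cbox 0 1) (\<lambda>z::(real \<times> real) \<times> real. (fst (fst z), a2 + snd z * (snd (fst z) - a2)))"
      by (intro continuous_intros)
    show "(\<lambda>z::(real \<times> real) \<times> real. (fst (fst z), a2 + snd z * (snd (fst z) - a2))) ` (?R \<times> cbox 0 1) \<subseteq> ?R"
      using inR by force
  qed
  then have "continuous_on ?R (\<lambda>p. integral (cbox 0 1) (\<lambda>x. g (fst p, a2 + x * (snd p - a2))))"
    by (rule integral_continuous_on_param)
  then show ?thesis
    by (subst continuous_on_cong[OF refl eq]) (auto intro!: continuous_intros)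
qed

text \<open>The equation prescribes \<open>y\<close> by integration along an L-shaped path: along
  the bottom edge with \<open>U\<close>, then upwards with \<open>V\<close>. Each leg contributes at
  most 1/4 to the Lipschitz constant of the integral operator, which makes it a contraction. Whether
  \<open>y\<close> also satisfies the first equation off the bottom edge is left open here.\<close>

lemma volterra_fixed_point:
  fixes bil :: "'c::real_normed_vector \<Rightarrow> 'b::banach \<Rightarrow> 'b" and U V :: "real \<times> real \<Rightarrow> 'c"
  assumes bil: "bounded_bilinear bil" and ab: "a1 < b1" "a2 < b2"
    and U: "continuous_on ({a1..b1} \<times> {a2..b2}) U" and V: "continuous_on ({a1..b1} \<times> {a2..b2}) V"
    and bnd: "\<And>p x. p \<in> {a1..b1} \<times> {a2..b2} \<Longrightarrow> norm (bil (U p) x) \<le> K * norm x"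
      "\<And>p x. p \<in> {a1..b1} \<times> {a2..b2} \<Longrightarrow> norm (bil (V p) x) \<le> K * norm x"
    and K: "K \<ge> 0" "K * (b1 - a1) \<le> 1/4" "K * (b2 - a2) \<le> 1/4"
  obtains y where "continuous_on ({a1..b1} \<times> {a2..b2}) y"
    "\<And>s t. s \<in> {a1..b1} \<Longrightarrow> t \<in> {a2..b2} \<Longrightarrow> y (s, t) = y0
      + integral {a1..s} (\<lambda>x. bil (U (x, a2)) (y (x, a2)))
      + integral {a2..t} (\<lambda>x. bil (V (s, x)) (y (s, x)))"
proof -
  let ?R = "{a1..b1} \<times> {a2..b2}" and ?c = "clamp (a1, a2) (b1, b2)"
  have R: "cbox (a1, a2) (b1, b2) = ?R" by (simp add: cbox_Pair_eq)
  have cR: "?c p \<in> ?R" for p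
    unfolding R[symmetric] using ab by (intro clamp_in_interval) (auto simp: Basis_prod_def)
  have cid: "p \<in> ?R \<Longrightarrow> ?c p = p" for p
    using R clamp_cancel_cbox by blast
  define I1 where "I1 y p = integral {a1..fst p} (\<lambda>x. bil (U (x, a2)) (y (x, a2)))" for y and p :: "real \<times> real"
  define I2 where "I2 y p = integral {a2..snd p} (\<lambda>x. bil (V (fst p, x)) (y (fst p, x)))" for y and p :: "real \<times> real"
  define G where "G y p = y0 + I1 y p + I2 y p" for y p
  have cUy: "continuous_on S (\<lambda>x. bil (U (h x)) (y (h x)))"
    if "continuous_on ?R y" "continuous_on S h" "h ` S \<subseteq> ?R" for y h and S :: "'d::topological_space set"
    using continuous_on_compose2[OF U that(2,3)] continuous_on_compose2[OF that]
    by (rule bounded_bilinear.continuous_on[OF bil])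
  have cVy: "continuous_on S (\<lambda>x. bil (V (h x)) (y (h x)))"
    if "continuous_on ?R y" "continuous_on S h" "h ` S \<subseteq> ?R" for y h and S :: "'d::topological_space set"
    using continuous_on_compose2[OF V that(2,3)] continuous_on_compose2[OF that]
    by (rule bounded_bilinear.continuous_on[OF bil])
  have contG: "continuous_on ?R (G y)" if y: "continuous_on ?R y" for y
  proof -
    have "continuous_on ?R (I2 y)" unfolding I2_def
      by (rule continuous_on_integral_upper[where g = "\<lambda>p. bil (V p) (y p)"])
        (rule cVy[OF y], auto)
    moreover have "continuous_on ({a2..b2} \<times> {a1..b1}) (\<lambda>p. integral {a1..snd p} (\<lambda>x. bil (U (x, a2)) (y (x, a2))))"
      by (rule continuous_on_integral_upper[where g = "\<lambda>p. bil (U (snd p, a2)) (y (snd p, a2))", simplified])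
        (rule cUy[OF y], use ab in \<open>auto intro!: continuous_intros\<close>)
    then have "continuous_on ?R (I1 y)" unfolding I1_def
      using continuous_on_compose2[of _ _ ?R "\<lambda>p. (snd p, fst p)"]
      by (fastforce intro!: continuous_intros)
    ultimately show ?thesis unfolding G_def by (intro continuous_intros)
  qed
  \<comment> \<open>Clamping the argument to the rectangle extends continuous functions on it to
    bounded continuous functions on the plane, a complete space.\<close>
  define \<Phi> where "\<Phi> y = Bcontfun (\<lambda>p. G (apply_bcontfun y) (?c p))" for y :: "(real \<times> real) \<Rightarrow>\<^sub>C 'b"
  have \<Phi>: "apply_bcontfun (\<Phi> y) p = G (apply_bcontfun y) (?c p)" for y p
  proof -
    have c: "continuous_on (cbox (a1, a2) (b1, b2)) (G (apply_bcontfun y))"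
      unfolding R by (rule contG) simp
    have "(\<lambda>p. G (apply_bcontfun y) (?c p)) \<in> bcontfun"
      unfolding bcontfun_def using clamp_continuous_on[OF c]
        clamp_bounded[OF compact_imp_bounded[OF compact_continuous_image[OF c compact_cbox]]] by simp
    then show ?thesis by (simp add: \<Phi>_def Bcontfun_inverse)
  qed
  have "\<exists>!y. \<Phi> y = y"
  proof (rule banach_fix_type[of "1/2"])
    show "\<forall>y z. dist (\<Phi> y) (\<Phi> z) \<le> 1/2 * dist y z"
    proof (intro allI dist_bound)
      fix y z :: "(real \<times> real) \<Rightarrow>\<^sub>C 'b" and p
      obtain s t where st: "?c p = (s, t)" "s \<in> {a1..b1}" "t \<in> {a2..b2}"
        using cR[of p] by (metis SigmaE)
      have d: "norm (y q - z q) \<le> dist y z" for q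
        using dist_bounded[of y q z] by (simp add: dist_norm)
      have e1: "I1 y (s, t) - I1 z (s, t) = integral {a1..s} (\<lambda>x. bil (U (x, a2)) (y (x, a2) - z (x, a2)))"
        unfolding I1_def using st ab
        by (subst integral_diff[symmetric])
          (auto simp: bounded_bilinear.diff_right[OF bil] intro!: integrable_continuous_real cUy continuous_intros)
      have "norm (I1 y (s, t) - I1 z (s, t)) \<le> (K * dist y z) * (s - a1)"
        unfolding e1
      proof (rule integral_bound)
        show "continuous_on {a1..s} (\<lambda>x. bil (U (x, a2)) (y (x, a2) - z (x, a2)))"
          using st ab by (intro cUy[of "\<lambda>p. y p - z p"] continuous_intros) auto
        fix x assume "x \<in> {a1..s}"
        then have "norm (bil (U (x, a2)) (y (x, a2) - z (x, a2))) \<le> K * norm (y (x, a2) - z (x, a2))"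
          using st ab by (intro bnd) auto
        also have "\<dots> \<le> K * dist y z" using d K by (intro mult_left_mono) auto
        finally show "norm (bil (U (x, a2)) (y (x, a2) - z (x, a2))) \<le> K * dist y z" .
      qed (use st in auto)
      also have "\<dots> \<le> (K * dist y z) * (b1 - a1)"
        using st K by (intro mult_left_mono) auto
      also have "\<dots> \<le> 1/4 * dist y z"
        using mult_right_mono[OF K(2), of "dist y z"] by (simp add: mult.commute mult.left_commute)
      finally have n1: "norm (I1 y (s, t) - I1 z (s, t)) \<le> 1/4 * dist y z" .
      have e2: "I2 y (s, t) - I2 z (s, t) = integral {a2..t} (\<lambda>x. bil (V (s, x)) (y (s, x) - z (s, x)))"
        unfolding I2_def using st ab
        by (subst integral_diff[symmetric])
          (auto simp: bounded_bilinear.diff_right[OF bil] intro!: integrable_continuous_real cVy continuous_intros)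
      have "norm (I2 y (s, t) - I2 z (s, t)) \<le> (K * dist y z) * (t - a2)"
        unfolding e2
      proof (rule integral_bound)
        show "continuous_on {a2..t} (\<lambda>x. bil (V (s, x)) (y (s, x) - z (s, x)))"
          using st ab by (intro cVy[of "\<lambda>p. y p - z p"] continuous_intros) auto
        fix x assume "x \<in> {a2..t}"
        then have "norm (bil (V (s, x)) (y (s, x) - z (s, x))) \<le> K * norm (y (s, x) - z (s, x))"
          using st ab by (intro bnd) auto
        also have "\<dots> \<le> K * dist y z" using d K by (intro mult_left_mono) auto
        finally show "norm (bil (V (s, x)) (y (s, x) - z (s, x))) \<le> K * dist y z" .
      qed (use st in auto)
      also have "\<dots> \<le> (K * dist y z) * (b2 - a2)"
        using st K by (intro mult_left_mono) auto
      also have "\<dots> \<le> 1/4 * dist y z"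
        using mult_right_mono[OF K(3), of "dist y z"] by (simp add: mult.commute mult.left_commute)
      finally have n2: "norm (I2 y (s, t) - I2 z (s, t)) \<le> 1/4 * dist y z" .
      have "\<Phi> y p - \<Phi> z p = (I1 y (s, t) - I1 z (s, t)) + (I2 y (s, t) - I2 z (s, t))"
        by (simp add: \<Phi> st G_def)
      then have "norm (\<Phi> y p - \<Phi> z p) \<le> 1/4 * dist y z + 1/4 * dist y z"
        using n1 n2 norm_triangle_mono by metis
      then show "dist (\<Phi> y p) (\<Phi> z p) \<le> 1/2 * dist y z"
        by (simp add: dist_norm)
    qed
  qed auto
  then obtain y where y: "\<Phi> y = y" by blast
  show ?thesis
  proof (rule that)
    show "continuous_on ?R (apply_bcontfun y)" by simp
    fix s t assume "s \<in> {a1..b1}" "t \<in> {a2..b2}"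
    then have "?c (s, t) = (s, t)" using cid by auto
    then show "y (s, t) = y0 + integral {a1..s} (\<lambda>x. bil (U (x, a2)) (y (x, a2)))
        + integral {a2..t} (\<lambda>x. bil (V (s, x)) (y (s, x)))"
      using \<Phi>[of y "(s, t)"] y by (simp add: G_def I1_def I2_def)
  qed
qed

text \<open>The t-equation is immediate for the solution of the integral equation. The s-equation is
  the point: it holds by construction on the bottom edge only, and flatness has to carry it upwards.
  \<open>U'\<close> and \<open>V'\<close> are the cross derivatives U_t and V_s, so
  \<open>flat\<close> is the equality of the two formal mixed derivatives of a solution.\<close>

lemma flat_system_on_rectangle:
  fixes bil :: "'c::real_normed_vector \<Rightarrow> 'b::banach \<Rightarrow> 'b" and U V U' V' :: "real \<times> real \<Rightarrow> 'c"
  assumes bil: "bounded_bilinear bil" and ab: "a1 < b1" "a2 < b2"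
    and U: "continuous_on ({a1..b1} \<times> {a2..b2}) U" and V: "continuous_on ({a1..b1} \<times> {a2..b2}) V"
    and U': "continuous_on ({a1..b1} \<times> {a2..b2}) U'" and V': "continuous_on ({a1..b1} \<times> {a2..b2}) V'"
    and dU: "\<And>s t. s \<in> {a1..b1} \<Longrightarrow> t \<in> {a2..b2} \<Longrightarrow>
      ((\<lambda>t. U (s, t)) has_vector_derivative U' (s, t)) (at t within {a2..b2})"
    and dV: "\<And>s t. s \<in> {a1..b1} \<Longrightarrow> t \<in> {a2..b2} \<Longrightarrow>
      ((\<lambda>s. V (s, t)) has_vector_derivative V' (s, t)) (at s within {a1..b1})"
    and flat: "\<And>p x. p \<in> {a1..b1} \<times> {a2..b2} \<Longrightarrow>
      bil (U' p) x + bil (U p) (bil (V p) x) = bil (V' p) x + bil (V p) (bil (U p) x)"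
    and bnd: "\<And>p x. p \<in> {a1..b1} \<times> {a2..b2} \<Longrightarrow> norm (bil (U p) x) \<le> K * norm x"
      "\<And>p x. p \<in> {a1..b1} \<times> {a2..b2} \<Longrightarrow> norm (bil (V p) x) \<le> K * norm x"
      "\<And>p x. p \<in> {a1..b1} \<times> {a2..b2} \<Longrightarrow> norm (bil (V' p) x) \<le> K * norm x"
    and K: "K \<ge> 0" "K * (b1 - a1) \<le> 1/4" "K * (b2 - a2) \<le> 1/4" "b1 - a1 \<le> 1"
  obtains y where "continuous_on ({a1..b1} \<times> {a2..b2}) y" "y (a1, a2) = y0"
    "\<And>s t. s \<in> {a1..b1} \<Longrightarrow> t \<in> {a2..b2} \<Longrightarrow>
      ((\<lambda>s. y (s, t)) has_vector_derivative bil (U (s, t)) (y (s, t))) (at s within {a1..b1})"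
    "\<And>s t. s \<in> {a1..b1} \<Longrightarrow> t \<in> {a2..b2} \<Longrightarrow>
      ((\<lambda>t. y (s, t)) has_vector_derivative bil (V (s, t)) (y (s, t))) (at t within {a2..b2})"
proof -
  let ?R = "{a1..b1} \<times> {a2..b2}"
  obtain y where cy: "continuous_on ?R y" and
    y: "\<And>s t. s \<in> {a1..b1} \<Longrightarrow> t \<in> {a2..b2} \<Longrightarrow> y (s, t) = y0
      + integral {a1..s} (\<lambda>x. bil (U (x, a2)) (y (x, a2)))
      + integral {a2..t} (\<lambda>x. bil (V (s, x)) (y (s, x)))"
    using volterra_fixed_point[OF bil ab U V bnd(1,2) K(1,2,3)] by blast
  have cb: "continuous_on S (\<lambda>x. bil (W (h x)) (z (h x)))"
    if "continuous_on ?R W" "continuous_on ?R z" "continuous_on S h" "h ` S \<subseteq> ?R"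
    for W z h and S :: "'d::topological_space set"
    using continuous_on_compose2[OF that(1,3,4)] continuous_on_compose2[OF that(2,3,4)]
    by (rule bounded_bilinear.continuous_on[OF bil])
  have yt: "((\<lambda>t. y (s, t)) has_vector_derivative bil (V (s, t)) (y (s, t))) (at t within {a2..b2})"
    if st: "s \<in> {a1..b1}" "t \<in> {a2..b2}" for s t
  proof -
    have "((\<lambda>t. integral {a2..t} (\<lambda>x. bil (V (s, x)) (y (s, x)))) has_vector_derivative
        bil (V (s, t)) (y (s, t))) (at t within {a2..b2})"
      by (rule integral_has_vector_derivative[OF cb[OF V cy]])
        (use st in \<open>auto intro!: continuous_intros\<close>)
    then have "((\<lambda>t. (y0 + integral {a1..s} (\<lambda>x. bil (U (x, a2)) (y (x, a2))))
        + integral {a2..t} (\<lambda>x. bil (V (s, x)) (y (s, x)))) has_vector_derivative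
        bil (V (s, t)) (y (s, t))) (at t within {a2..b2})"
      by (auto intro!: derivative_eq_intros)
    then show ?thesis
      using has_vector_derivative_transform[OF st(2) y[OF st(1)]] by simp
  qed
  \<comment> \<open>The function \<open>w\<close> has the desired s-derivative by definition and
    agrees with \<open>y\<close> on the left edge; the goal becomes w = y.\<close>
  define w where "w = (\<lambda>(s, t). y (a1, t) + integral {a1..s} (\<lambda>x. bil (U (x, t)) (y (x, t))))"
  have cw: "continuous_on ?R w"
  proof -
    have "continuous_on ({a2..b2} \<times> {a1..b1}) (\<lambda>p. integral {a1..snd p} (\<lambda>x. bil (U (x, fst p)) (y (x, fst p))))"
      by (rule continuous_on_integral_upper[where g = "\<lambda>p. bil (U (snd p, fst p)) (y (snd p, fst p))", simplified])
        (rule cb[OF U cy], auto intro!: continuous_intros)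
    then have "continuous_on ?R (\<lambda>p. integral {a1..fst p} (\<lambda>x. bil (U (x, snd p)) (y (x, snd p))))"
      using continuous_on_compose2[of _ _ ?R "\<lambda>p. (snd p, fst p)"]
      by (fastforce intro!: continuous_intros)
    moreover have "continuous_on ?R (\<lambda>p. y (a1, snd p))"
      using ab by (intro continuous_on_compose2[OF cy]) (auto intro!: continuous_intros)
    ultimately show ?thesis unfolding w_def case_prod_beta by (intro continuous_intros)
  qed
  have ws: "((\<lambda>s. w (s, t)) has_vector_derivative bil (U (s, t)) (y (s, t))) (at s within {a1..b1})"
    if st: "s \<in> {a1..b1}" "t \<in> {a2..b2}" for s t
  proof -
    have "((\<lambda>s. integral {a1..s} (\<lambda>x. bil (U (x, t)) (y (x, t)))) has_vector_derivative
        bil (U (s, t)) (y (s, t))) (at s within {a1..b1})"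
      by (rule integral_has_vector_derivative[OF cb[OF U cy]])
        (use st in \<open>auto intro!: continuous_intros\<close>)
    then show ?thesis unfolding w_def by (auto intro!: derivative_eq_intros)
  qed
  \<comment> \<open>The error in the t-equation for \<open>w\<close>; it is small when w - y
    is.\<close>
  define r where "r = (\<lambda>(s, t). integral {a1..s} (\<lambda>x. bil (V' (x, t)) (y (x, t) - w (x, t))))"
  have wt: "((\<lambda>t. w (s, t)) has_vector_derivative bil (V (s, t)) (w (s, t)) + r (s, t)) (at t within {a2..b2})"
    if st: "s \<in> {a1..b1}" "t \<in> {a2..b2}" for s t
  proof -
    let ?g = "\<lambda>t x. bil (U' (x, t)) (y (x, t)) + bil (U (x, t)) (bil (V (x, t)) (y (x, t)))"
    have c0: "continuous_on {a1..s} (\<lambda>x. bil (U (x, t)) (y (x, t)))" if "t \<in> {a2..b2}" for t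
      by (rule cb[OF U cy]) (use st that in \<open>auto intro!: continuous_intros\<close>)
    have cVy: "continuous_on ?R (\<lambda>p. bil (V p) (y p))"
      by (rule cb[OF V cy]) auto
    have "((\<lambda>t. integral (cbox a1 s) (\<lambda>x. bil (U (x, t)) (y (x, t)))) has_vector_derivative
        integral (cbox a1 s) (?g t)) (at t within {a2..b2})"
    proof (rule leibniz_rule_vector_derivative)
      fix t x assume tx: "t \<in> {a2..b2}" "x \<in> cbox a1 s"
      then have x: "x \<in> {a1..b1}" using st by auto
      have "((\<lambda>t. bil (U (x, t)) (y (x, t))) has_vector_derivative
          bil (U (x, t)) (bil (V (x, t)) (y (x, t))) + bil (U' (x, t)) (y (x, t))) (at t within {a2..b2})"
        by (rule bounded_bilinear.has_vector_derivative[OF bil dU[OF x tx(1)] yt[OF x tx(1)]])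
      then show "((\<lambda>t. bil (U (x, t)) (y (x, t))) has_vector_derivative ?g t x) (at t within {a2..b2})"
        by (simp add: add.commute)
    next
      show "continuous_on ({a2..b2} \<times> cbox a1 s) (\<lambda>(t, x). ?g t x)"
        unfolding case_prod_beta
        by (intro continuous_on_add cb[OF U' cy] cb[OF U cVy]) (use st in \<open>auto intro!: continuous_intros\<close>)
    qed (use st c0 in \<open>auto intro: integrable_continuous_real\<close>)
    then have 1: "((\<lambda>t. w (s, t)) has_vector_derivative
        bil (V (a1, t)) (y (a1, t)) + integral {a1..s} (?g t)) (at t within {a2..b2})"
      unfolding w_def using yt[of a1 t] st ab by (auto intro!: derivative_eq_intros)
    \<comment> \<open>Flatness rewrites the t-derivative of the integrand of \<open>w\<close> as the
      s-derivative of V w plus an error V' (y - w). Integration in s turns the former into a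
      boundary term, whose value on the left edge cancels against the t-derivative of
      \<open>y\<close> there.\<close>
    have 2: "((\<lambda>x. bil (V' (x, t)) (w (x, t)) + bil (V (x, t)) (bil (U (x, t)) (y (x, t))))
        has_integral bil (V (s, t)) (w (s, t)) - bil (V (a1, t)) (w (a1, t))) {a1..s}"
    proof (rule fundamental_theorem_of_calculus)
      fix x assume x: "x \<in> {a1..s}"
      then have x': "x \<in> {a1..b1}" using st by auto
      have "((\<lambda>x. bil (V (x, t)) (w (x, t))) has_vector_derivative
          bil (V (x, t)) (bil (U (x, t)) (y (x, t))) + bil (V' (x, t)) (w (x, t))) (at x within {a1..b1})"
        by (rule bounded_bilinear.has_vector_derivative[OF bil dV[OF x' st(2)] ws[OF x' st(2)]])
      then show "((\<lambda>x. bil (V (x, t)) (w (x, t))) has_vector_derivative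
          bil (V' (x, t)) (w (x, t)) + bil (V (x, t)) (bil (U (x, t)) (y (x, t)))) (at x within {a1..s})"
        using st by (auto simp: add.commute intro: has_vector_derivative_within_subset)
    qed (use st in auto)
    have 3: "((\<lambda>x. bil (V' (x, t)) (y (x, t) - w (x, t))) has_integral r (s, t)) {a1..s}"
      unfolding r_def case_prod_conv
      by (intro integrable_integral integrable_continuous_real cb[of V' "\<lambda>p. y p - w p"] V'
          continuous_on_diff cy cw)
        (use st in \<open>auto intro!: continuous_intros\<close>)
    have "?g t x = (bil (V' (x, t)) (w (x, t)) + bil (V (x, t)) (bil (U (x, t)) (y (x, t))))
        + bil (V' (x, t)) (y (x, t) - w (x, t))" if "x \<in> {a1..s}" for x
      using flat[of "(x, t)" "y (x, t)"] st that by (simp add: bounded_bilinear.diff_right[OF bil])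
    then have "(?g t has_integral (bil (V (s, t)) (w (s, t)) - bil (V (a1, t)) (w (a1, t))) + r (s, t)) {a1..s}"
      by (intro has_integral_eq[OF _ has_integral_add[OF 2 3]]) simp
    then have "integral {a1..s} (?g t) = bil (V (s, t)) (w (s, t)) - bil (V (a1, t)) (w (a1, t)) + r (s, t)"
      by (rule integral_unique)
    moreover have "w (a1, t) = y (a1, t)" by (simp add: w_def)
    ultimately show ?thesis using 1 by simp
  qed
  have wy: "w p = y p" if "p \<in> ?R" for p
  proof -
    \<comment> \<open>The difference satisfies D_t = V D - r and vanishes on the bottom
      edge.\<close>
    define D where "D p = y p - w p" for p
    have cD: "continuous_on ?R (\<lambda>p. norm (D p))"
      unfolding D_def by (intro continuous_intros cy cw)
    have "\<exists>q\<in>?R. \<forall>p\<in>?R. norm (D p) \<le> norm (D q)"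
      by (rule continuous_attains_sup[OF _ _ cD]) (use ab in \<open>auto intro: compact_Times\<close>)
    then obtain s t where st: "s \<in> {a1..b1}" "t \<in> {a2..b2}" and
      max: "\<And>p. p \<in> ?R \<Longrightarrow> norm (D p) \<le> norm (D (s, t))" by blast
    let ?m = "norm (D (s, t))"
    have Dt: "((\<lambda>t. D (s, t)) has_vector_derivative bil (V (s, t)) (D (s, t)) - r (s, t)) (at t within {a2..b2})"
      if "t \<in> {a2..b2}" for t
      unfolding D_def using yt[OF st(1) that] wt[OF st(1) that]
      by (auto intro!: derivative_eq_intros simp: bounded_bilinear.diff_right[OF bil])
    have rb: "norm (r (s, x)) \<le> K * ?m" if "x \<in> {a2..b2}" for x
    proof -
      have "norm (r (s, x)) \<le> (K * ?m) * (s - a1)"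
        unfolding r_def case_prod_conv
      proof (rule integral_bound)
        show "continuous_on {a1..s} (\<lambda>z. bil (V' (z, x)) (y (z, x) - w (z, x)))"
          by (intro cb[of V' "\<lambda>p. y p - w p"] V' continuous_on_diff cy cw)
            (use st that in \<open>auto intro!: continuous_intros\<close>)
        fix z assume z: "z \<in> {a1..s}"
        then have "norm (bil (V' (z, x)) (D (z, x))) \<le> K * norm (D (z, x))"
          using st that by (intro bnd) auto
        also have "\<dots> \<le> K * ?m" using z st that by (intro mult_left_mono max K) auto
        finally show "norm (bil (V' (z, x)) (y (z, x) - w (z, x))) \<le> K * ?m" by (simp add: D_def)
      qed (use st in auto)
      also have "\<dots> \<le> (K * ?m) * 1" using st K by (intro mult_left_mono) auto
      finally show ?thesis by simp
    qed
    \<comment> \<open>At a point where the norm of D is maximal, the bound 2 K ?m on D_t and the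
      small height of the rectangle give ?m at most ?m / 2, so D vanishes.\<close>
    have "norm (D (s, t) - D (s, a2)) \<le> (2 * K * ?m) * norm (t - a2)"
    proof (rule differentiable_bound[OF convex_real_interval(5)])
      fix x assume x: "x \<in> {a2..b2}"
      show "((\<lambda>t. D (s, t)) has_derivative (\<lambda>h. h *\<^sub>R (bil (V (s, x)) (D (s, x)) - r (s, x)))) (at x within {a2..b2})"
        using Dt[OF x] by (simp add: has_vector_derivative_def)
      have "norm (bil (V (s, x)) (D (s, x)) - r (s, x)) \<le> K * norm (D (s, x)) + K * ?m"
        using bnd(2)[of "(s, x)" "D (s, x)"] rb[OF x] st x norm_triangle_ineq4[of "bil (V (s, x)) (D (s, x))" "r (s, x)"]
        by auto
      also have "\<dots> \<le> K * ?m + K * ?m"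
        using st x by (intro add_right_mono mult_left_mono max K) auto
      finally have b: "norm (bil (V (s, x)) (D (s, x)) - r (s, x)) \<le> 2 * K * ?m" by simp
      show "onorm (\<lambda>h. h *\<^sub>R (bil (V (s, x)) (D (s, x)) - r (s, x))) \<le> 2 * K * ?m"
      proof (rule onorm_le)
        fix h :: real
        show "norm (h *\<^sub>R (bil (V (s, x)) (D (s, x)) - r (s, x))) \<le> 2 * K * ?m * norm h"
          using mult_left_mono[OF b, of "\<bar>h\<bar>"] by (simp add: mult.commute)
      qed
    qed (use st ab in auto)
    moreover have "D (s, a2) = 0"
      using y[OF st(1), of a2] y[of a1 a2] ab by (simp add: D_def w_def)
    ultimately have "?m \<le> (2 * K * ?m) * (t - a2)" using st by simp
    also have "\<dots> \<le> (2 * K * ?m) * (b2 - a2)" using st K by (intro mult_left_mono) auto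
    also have "\<dots> \<le> 1/2 * ?m" using mult_right_mono[OF K(3), of "?m"] by (simp add: algebra_simps)
    finally have "?m = 0" by simp
    then show ?thesis using max[OF that] by (simp add: D_def)
  qed
  show ?thesis
  proof (rule that[OF cy])
    show "y (a1, a2) = y0" using y[of a1 a2] ab by simp
  next
    fix s t assume st: "s \<in> {a1..b1}" "t \<in> {a2..b2}"
    show "((\<lambda>s. y (s, t)) has_vector_derivative bil (U (s, t)) (y (s, t))) (at s within {a1..b1})"
      using has_vector_derivative_transform[OF st(1) _ ws[OF st], of "\<lambda>s. y (s, t)"] wy st by auto
  qed (rule yt)
qed

text \<open>By linearity the size of the rectangle depends on bounds for the coefficients only, so
  one box serves all initial values. They are prescribed at the corner \<open>a\<close>, a boundary
  point of the box, and for this reason continuity up to the closed box is part of the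
  conclusion.\<close>

lemma flat_linear_system_local:
  fixes bil :: "'c::real_normed_vector \<Rightarrow> 'b::banach \<Rightarrow> 'b" and U V :: "real \<times> real \<Rightarrow> 'c"
  assumes bil: "bounded_bilinear bil" and \<Omega>: "open \<Omega>" "p0 \<in> \<Omega>"
    and U: "smooth_on \<Omega> U" and V: "smooth_on \<Omega> V"
    and flat: "\<And>p x. p \<in> \<Omega> \<Longrightarrow>
      bil (dirder U (0, 1) p) x + bil (U p) (bil (V p) x) = bil (dirder V (1, 0) p) x + bil (V p) (bil (U p) x)"
  obtains a b where "p0 \<in> box a b" "cbox a b \<subseteq> \<Omega>"
    "\<And>y0. \<exists>y. continuous_on (cbox a b) y \<and> y a = y0 \<and> smooth_on (box a b) y \<and>
      (\<forall>p\<in>box a b. dirder y (1, 0) p = bil (U p) (y p) \<and> dirder y (0, 1) p = bil (V p) (y p))"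
proof -
  interpret bil: bounded_bilinear bil by fact
  obtain r where r: "r > 0" "cball p0 r \<subseteq> \<Omega>" using \<Omega> open_contains_cball by blast
  obtain K0 where K0: "K0 \<ge> 0" "\<And>x y. norm (bil x y) \<le> norm x * norm y * K0"
    using bil.nonneg_bounded by blast
  have "\<exists>k>0. \<forall>p\<in>cball p0 r. norm (W p) \<le> k" if "smooth_on \<Omega> W" for W :: "real \<times> real \<Rightarrow> 'c"
  proof -
    have "bounded (W ` cball p0 r)"
      by (rule compact_imp_bounded[OF compact_continuous_image[OF continuous_on_subset[OF
            smooth_on_continuous_on[OF that] r(2)] compact_cball]])
    then show ?thesis by (auto simp: bounded_pos)
  qed
  from this[OF U] this[OF V] this[OF smooth_on_dirder[OF V, of "(1, 0)"]]
  obtain k1 k2 k3 where k: "k1 > 0" "k2 > 0" "k3 > 0" and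
    kb: "\<And>p. p \<in> cball p0 r \<Longrightarrow> norm (U p) \<le> k1" "\<And>p. p \<in> cball p0 r \<Longrightarrow> norm (V p) \<le> k2"
      "\<And>p. p \<in> cball p0 r \<Longrightarrow> norm (dirder V (1, 0) p) \<le> k3"
    by blast
  define K where "K = (k1 + k2 + k3) * (K0 + 1)"
  have K: "K > 0" unfolding K_def using k K0 by (intro mult_pos_pos) auto
  have bK: "norm (bil W x) \<le> K * norm x" if "norm W \<le> k1 + k2 + k3" for W x
  proof -
    have "norm (bil W x) \<le> (norm W * K0) * norm x" using K0(2)[of W x] by (simp add: mult_ac)
    also have "norm W * K0 \<le> K" unfolding K_def using that K0 k by (intro mult_mono) auto
    finally show ?thesis by (simp add: mult_right_mono)
  qed
  \<comment> \<open>Half the side length. The three bounds keep the square inside the ball of radius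
    r, its width at most 1, and K times its side at most 1/4.\<close>
  define h where "h = min (r / 2) (min (1 / 2) (1 / (8 * K)))"
  have h: "h > 0" using r K by (simp add: h_def)
  have hK: "K * (2 * h) \<le> 1 / 4"
  proof -
    have "h \<le> 1 / (8 * K)" by (simp add: h_def)
    then show ?thesis using K by (simp add: field_simps)
  qed
  obtain u0 v0 where p0: "p0 = (u0, v0)" by fastforce
  define a1 a2 b1 b2 where "a1 = u0 - h" and "a2 = v0 - h" and "b1 = u0 + h" and "b2 = v0 + h"
  note abd = a1_def a2_def b1_def b2_def
  have ab: "a1 < b1" "a2 < b2" using h by (auto simp: abd)
  let ?R = "{a1..b1} \<times> {a2..b2}"
  have R: "cbox (a1, a2) (b1, b2) = ?R" "box (a1, a2) (b1, b2) = {a1<..<b1} \<times> {a2<..<b2}"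
    by (auto simp: cbox_Pair_eq box_def Basis_prod_def)
  have Rr: "?R \<subseteq> cball p0 r"
  proof
    fix p assume p: "p \<in> ?R"
    have "dist p0 p \<le> \<bar>u0 - fst p\<bar> + \<bar>v0 - snd p\<bar>"
      unfolding p0 dist_norm norm_Pair
      using sqrt_sum_squares_le_sum_abs[of "u0 - fst p" "v0 - snd p"]
      by (cases p) (simp add: norm_Pair)
    also have "\<dots> \<le> h + h" using p by (intro add_mono) (auto simp: abd abs_le_iff)
    also have "\<dots> \<le> r" by (simp add: h_def)
    finally show "p \<in> cball p0 r" by simp
  qed
  then have R\<Omega>: "?R \<subseteq> \<Omega>" using r by blast
  show ?thesis
  proof (rule that[of "(a1, a2)" "(b1, b2)"])
    show "p0 \<in> box (a1, a2) (b1, b2)" unfolding R using h by (auto simp: p0 abd)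
    show "cbox (a1, a2) (b1, b2) \<subseteq> \<Omega>" using R\<Omega> by (simp add: R)
    fix y0
    have partial: "((\<lambda>t. W (s, t)) has_vector_derivative dirder W (0, 1) (s, t)) (at t within T)"
        "((\<lambda>s. W (s, t)) has_vector_derivative dirder W (1, 0) (s, t)) (at s within T)"
      if "smooth_on \<Omega> W" "(s, t) \<in> \<Omega>" for W :: "real \<times> real \<Rightarrow> 'c" and s t and T :: "real set"
    proof -
      have dd: "(W has_derivative (\<lambda>e. dirder W e (s, t))) (at (s, t))"
        by (rule smooth_on_has_derivative[OF that])
      have et: "(\<lambda>x. dirder W (0, x) (s, t)) = (\<lambda>x. x *\<^sub>R dirder W (0, 1) (s, t))"
        and es: "(\<lambda>x. dirder W (x, 0) (s, t)) = (\<lambda>x. x *\<^sub>R dirder W (1, 0) (s, t))"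
        by (simp_all add: linear_scale[OF has_derivative_linear[OF dd], symmetric])
      have "((\<lambda>t. W (s, t)) has_derivative (\<lambda>x. dirder W (0, x) (s, t))) (at t within T)"
        by (rule has_derivative_compose[where g = W and f = "\<lambda>t. (s, t)", OF _ dd])
          (rule has_derivative_Pair[OF has_derivative_const has_derivative_ident])
      then show "((\<lambda>t. W (s, t)) has_vector_derivative dirder W (0, 1) (s, t)) (at t within T)"
        unfolding has_vector_derivative_def et[symmetric] .
      have "((\<lambda>s. W (s, t)) has_derivative (\<lambda>x. dirder W (x, 0) (s, t))) (at s within T)"
        by (rule has_derivative_compose[where g = W and f = "\<lambda>s. (s, t)", OF _ dd])
          (rule has_derivative_Pair[OF has_derivative_ident has_derivative_const])
      then show "((\<lambda>s. W (s, t)) has_vector_derivative dirder W (1, 0) (s, t)) (at s within T)"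
        unfolding has_vector_derivative_def es[symmetric] .
    qed
    note cont = continuous_on_subset[OF smooth_on_continuous_on R\<Omega>]
    obtain y where cy: "continuous_on ?R y" and ya: "y (a1, a2) = y0" and
      ys: "\<And>s t. s \<in> {a1..b1} \<Longrightarrow> t \<in> {a2..b2} \<Longrightarrow>
        ((\<lambda>s. y (s, t)) has_vector_derivative bil (U (s, t)) (y (s, t))) (at s within {a1..b1})" and
      yt: "\<And>s t. s \<in> {a1..b1} \<Longrightarrow> t \<in> {a2..b2} \<Longrightarrow>
        ((\<lambda>t. y (s, t)) has_vector_derivative bil (V (s, t)) (y (s, t))) (at t within {a2..b2})"
    proof (rule flat_system_on_rectangle[OF bil ab cont[OF U] cont[OF V] cont[OF smooth_on_dirder[OF U]]
          cont[OF smooth_on_dirder[OF V]], of "(0, 1)" "(1, 0)" K y0])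
      fix p x assume "p \<in> ?R"
      then have p: "p \<in> cball p0 r" using Rr by blast
      show "norm (bil (U p) x) \<le> K * norm x" "norm (bil (V p) x) \<le> K * norm x"
        "norm (bil (dirder V (1, 0) p) x) \<le> K * norm x"
        using kb[OF p] k by (auto intro!: bK)
      show "bil (dirder U (0, 1) p) x + bil (U p) (bil (V p) x) = bil (dirder V (1, 0) p) x + bil (V p) (bil (U p) x)"
        using p r by (intro flat) auto
    next
      show "K \<ge> 0" "K * (b1 - a1) \<le> 1 / 4" "K * (b2 - a2) \<le> 1 / 4" "b1 - a1 \<le> 1"
        using K hK by (auto simp: abd h_def)
    qed (use R\<Omega> U V in \<open>auto intro!: partial\<close>)
    let ?B = "{a1<..<b1} \<times> {a2<..<b2}"
    have BR: "?B \<subseteq> ?R" by auto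
    have opB: "open ?B" by (intro open_Times open_greaterThanLessThan)
    have dy: "(y has_derivative (\<lambda>e. fst e *\<^sub>R bil (U p) (y p) + snd e *\<^sub>R bil (V p) (y p))) (at p)"
      if p: "p \<in> ?B" for p
    proof -
      obtain s t where st: "p = (s, t)" "s \<in> {a1<..<b1}" "t \<in> {a2<..<b2}" using p by blast
      \<comment> \<open>Two partial derivatives give the total derivative once one of them is
        continuous; here it is the one in t.\<close>
      have "((\<lambda>(s, t). y (s, t)) has_derivative
          (\<lambda>(x, z). x *\<^sub>R bil (U (s, t)) (y (s, t)) + blinfun_scaleR_left (bil (V (s, t)) (y (s, t))) z))
          (at (s, t) within ?B)"
      proof (rule has_derivative_partialsI[where fy = "\<lambda>s t. blinfun_scaleR_left (bil (V (s, t)) (y (s, t)))"])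
        show "((\<lambda>s. y (s, t)) has_derivative (\<lambda>x. x *\<^sub>R bil (U (s, t)) (y (s, t)))) (at s within {a1<..<b1})"
          using ys[of s t] st
          by (auto simp: has_vector_derivative_def intro: has_derivative_subset)
        show "((\<lambda>t. y (s, t)) has_derivative blinfun_apply (blinfun_scaleR_left (bil (V (s, t)) (y (s, t)))))
            (at t within {a2<..<b2})" if "s \<in> {a1<..<b1}" "t \<in> {a2<..<b2}" for s t
          using yt[of s t] that
          by (auto simp: has_vector_derivative_def intro: has_derivative_subset)
        have "continuous_on ?R (\<lambda>p. blinfun_scaleR_left (bil (V p) (y p)))"
          by (intro bounded_linear.continuous_on[OF bounded_linear_blinfun_scaleR_left] bil.continuous_on cont V cy)
        then have "continuous_on ?B (\<lambda>p. blinfun_scaleR_left (bil (V p) (y p)))"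
          using BR by (rule continuous_on_subset)
        then show "continuous (at (s, t) within ?B) (\<lambda>(s, t). blinfun_scaleR_left (bil (V (s, t)) (y (s, t))))"
          using st by (auto simp: continuous_on_eq_continuous_within case_prod_unfold)
      qed (use st in auto)
      then show ?thesis using at_within_open[OF p opB] st(1) by (simp add: case_prod_unfold)
    qed
    \<comment> \<open>The derivative is a smooth expression in the point, linear in \<open>y\<close>
      itself, so regularity bootstraps.\<close>
    have sm: "smooth_on ?B y"
    proof (rule smooth_on_bootstrap[OF opB continuous_on_subset[OF cy BR] dy])
      fix k e assume "differentiable_upto k ?B y"
      moreover have "differentiable_upto k ?B W" if "smooth_on \<Omega> W" for W :: "real \<times> real \<Rightarrow> 'c"
        using smooth_on_subset[OF order_trans[OF BR R\<Omega>] that] by (simp add: smooth_on_def)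
      ultimately show "differentiable_upto k ?B (\<lambda>p. fst e *\<^sub>R bil (U p) (y p) + snd e *\<^sub>R bil (V p) (y p))"
        using U V by (intro differentiable_upto_add opB differentiable_upto_bounded_linear[OF bounded_linear_scaleR_right]
            differentiable_upto_bilinear[OF bil]) auto
    qed
    show "\<exists>y. continuous_on (cbox (a1, a2) (b1, b2)) y \<and> y (a1, a2) = y0 \<and> smooth_on (box (a1, a2) (b1, b2)) y \<and>
      (\<forall>p\<in>box (a1, a2) (b1, b2). dirder y (1, 0) p = bil (U p) (y p) \<and> dirder y (0, 1) p = bil (V p) (y p))"
      unfolding R using cy ya sm dirder_eqI[OF dy] by (intro exI[of _ y]) auto
  qed
qed

section \<open>Pseudo-Euclidean linear algebra\<close>

lemma pinner_eq_inner: "pinner S x y = (\<chi> i. (if i \<in> S then - 1 else 1) * x $ i) \<bullet> y"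
  by (simp add: pinner_def inner_vec_def)

lemma bounded_bilinear_pinner:
  fixes S :: "'n::finite set"
  shows "bounded_bilinear (pinner S)"
proof -
  have "linear (\<lambda>x :: real^'n. \<chi> i. (if i \<in> S then - 1 else 1) * x $ i)"
    by (rule linearI) (auto simp: vec_eq_iff algebra_simps)
  then have "bounded_linear (\<lambda>x :: real^'n. \<chi> i. (if i \<in> S then - 1 else 1) * x $ i)"
    by (simp add: linear_conv_bounded_linear)
  from bounded_bilinear.comp[OF bounded_bilinear_inner this bounded_linear_ident]
  show ?thesis unfolding pinner_eq_inner[abs_def] .
qed

interpretation pinner: bounded_bilinear "pinner S" for S by (rule bounded_bilinear_pinner)

lemmas pinner_simps = pinner.add_left pinner.add_right pinner.diff_left pinner.diff_right
  pinner.scaleR_left pinner.scaleR_right pinner.minus_left pinner.minus_right pinner.zero_left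
  pinner.zero_right

lemma pinner_commute: "pinner S x y = pinner S y x"
  by (simp add: pinner_def mult_ac)

lemma pinner_nondegenerate:
  assumes "\<And>y. pinner S x y = 0" shows "x = 0"
proof -
  \<comment> \<open>Tested against x with the signs of the coordinates in \<open>S\<close> reversed,
    the form gives the Euclidean square of that vector.\<close>
  let ?x = "\<chi> i. (if i \<in> S then - 1 else 1) * x $ i"
  have "?x = 0" using assms[of ?x] by (simp add: pinner_eq_inner)
  then have *: "(if i \<in> S then - 1 else 1) * x $ i = 0" for i
    by (metis vec_lambda_beta zero_index)
  have "x $ i = 0" for i using *[of i] by (simp split: if_splits)
  then show ?thesis by (simp add: vec_eq_iff)
qed

lemma smooth_on_pinner:
  "open U \<Longrightarrow> smooth_on U f \<Longrightarrow> smooth_on U g \<Longrightarrow> smooth_on U (\<lambda>p. pinner S (f p) (g p))"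
  by (rule smooth_on_bilinear[OF bounded_bilinear_pinner])

lemma dirder_pinner [simp]:
  "f differentiable (at p) \<Longrightarrow> g differentiable (at p) \<Longrightarrow>
    dirder (\<lambda>q. pinner S (f q) (g q)) e p = pinner S (f p) (dirder g e p) + pinner S (dirder f e p) (g p)"
  by (rule dirder_bilinear[OF bounded_bilinear_pinner])

lemma differentiable_pinner [simp]:
  "f differentiable (at p) \<Longrightarrow> g differentiable (at p) \<Longrightarrow>
    (\<lambda>q. pinner S (f q) (g q)) differentiable (at p)"
  using pinner.FDERIV[OF differentiable_has_dirder differentiable_has_dirder]
  unfolding differentiable_def by blast

section \<open>Null directions\<close>

text \<open>The null derivatives are unnormalized: where f is differentiable, \<open>d_p\<close> and
  \<open>d_m\<close> are sqrt 2 times \<open>d_s\<close> and \<open>d_t\<close>. This keeps square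
  roots out of the structure equations.\<close>

abbreviation d_p :: "(paracomplex \<Rightarrow> 'b::real_normed_vector) \<Rightarrow> paracomplex \<Rightarrow> 'b"
  where "d_p f \<equiv> dirder f (1, 1)"

abbreviation d_m :: "(paracomplex \<Rightarrow> 'b::real_normed_vector) \<Rightarrow> paracomplex \<Rightarrow> 'b"
  where "d_m f \<equiv> dirder f (1, - 1)"

lemma dirder_null:
  assumes "f differentiable (at p)"
  shows "dirder f X p = ((fst X + snd X) / 2) *\<^sub>R d_p f p + ((fst X - snd X) / 2) *\<^sub>R d_m f p"
proof -
  have "X = ((fst X + snd X) / 2) *\<^sub>R (1, 1) + ((fst X - snd X) / 2) *\<^sub>R (1, - 1)"
    by (cases X) (simp add: field_simps)
  then show ?thesis using dirder_linear[OF assms] by metis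
qed

lemma dirder_coords:
  fixes f :: "paracomplex \<Rightarrow> 'b::real_normed_vector"
  assumes "f differentiable (at p)"
  shows "dirder f X p = fst X *\<^sub>R d_u f p + snd X *\<^sub>R d_v f p"
proof -
  have "X = fst X *\<^sub>R (1, 0) + snd X *\<^sub>R (0, 1)" by (cases X) simp
  then show ?thesis using dirder_linear[OF assms] by metis
qed

text \<open>In a null basis each vector is, up to the factor 1 / (2 E), dual to the other, whence
  the crossed coefficients. Since the normal part is a definite description, its uniqueness has to
  be derived as well.\<close>

lemma normal_part_null:
  fixes f :: "paracomplex \<Rightarrow> real^'n::finite"
  assumes f: "f differentiable (at p)"
    and pp: "pinner S (d_p f p) (d_p f p) = 0" and mm: "pinner S (d_m f p) (d_m f p) = 0"
    and pm: "pinner S (d_p f p) (d_m f p) = 2 * E" and E: "E \<noteq> 0"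
  shows "normal_part S f p x =
    x - (pinner S x (d_m f p) / (2 * E)) *\<^sub>R d_p f p - (pinner S x (d_p f p) / (2 * E)) *\<^sub>R d_m f p"
    (is "_ = ?n")
proof -
  let ?a = "d_p f p" and ?b = "d_m f p"
  have u: "d_u f p = (1/2) *\<^sub>R ?a + (1/2) *\<^sub>R ?b" and v: "d_v f p = (1/2) *\<^sub>R ?a - (1/2) *\<^sub>R ?b"
    using dirder_null[OF f, of "(1, 0)"] dirder_null[OF f, of "(0, 1)"] by auto
  have ab: "?a = d_u f p + d_v f p" "?b = d_u f p - d_v f p"
    by (simp_all add: u v algebra_simps flip: scaleR_add_left)
  have mp: "pinner S ?b ?a = 2 * E" using pm pinner_commute by metis
  have orth: "pinner S n (d_u f p) = 0 \<and> pinner S n (d_v f p) = 0 \<longleftrightarrow> pinner S n ?a = 0 \<and> pinner S n ?b = 0" for n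
    by (auto simp: u v pinner_simps)
  have span: "y \<in> span {d_u f p, d_v f p} \<longleftrightarrow> (\<exists>c d. y = c *\<^sub>R ?a + d *\<^sub>R ?b)" for y
  proof
    assume "y \<in> span {d_u f p, d_v f p}"
    then obtain c d where "y = c *\<^sub>R d_u f p + d *\<^sub>R d_v f p"
      by (auto simp: span_insert span_singleton algebra_simps)
    then have "y = ((c + d) / 2) *\<^sub>R ?a + ((c - d) / 2) *\<^sub>R ?b"
      by (simp add: u v algebra_simps add_divide_distrib diff_divide_distrib)
    then show "\<exists>c d. y = c *\<^sub>R ?a + d *\<^sub>R ?b" by blast
  next
    assume "\<exists>c d. y = c *\<^sub>R ?a + d *\<^sub>R ?b"
    moreover have "d_u f p \<in> span {d_u f p, d_v f p}" "d_v f p \<in> span {d_u f p, d_v f p}"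
      by (auto intro: span_base)
    ultimately show "y \<in> span {d_u f p, d_v f p}"
      unfolding ab by (metis span_add span_diff span_scale)
  qed
  show ?thesis
    unfolding normal_part_def span
  proof (rule the_equality)
    have "pinner S ?n ?a = 0 \<and> pinner S ?n ?b = 0"
      using E by (simp add: pinner_simps pp mm pm mp)
    moreover have "x - ?n = (pinner S x ?b / (2 * E)) *\<^sub>R ?a + (pinner S x ?a / (2 * E)) *\<^sub>R ?b"
      by simp
    ultimately show "pinner S ?n (d_u f p) = 0 \<and> pinner S ?n (d_v f p) = 0 \<and> (\<exists>c d. x - ?n = c *\<^sub>R ?a + d *\<^sub>R ?b)"
      using orth by blast
  next
    fix n assume n: "pinner S n (d_u f p) = 0 \<and> pinner S n (d_v f p) = 0 \<and> (\<exists>c d. x - n = c *\<^sub>R ?a + d *\<^sub>R ?b)"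
    then obtain c d where cd: "x - n = c *\<^sub>R ?a + d *\<^sub>R ?b" by blast
    have n0: "pinner S n ?a = 0" "pinner S n ?b = 0" using n orth by blast+
    have "pinner S (x - n) ?a = d * (2 * E)" "pinner S (x - n) ?b = c * (2 * E)"
      unfolding cd by (simp_all add: pinner_simps pp mm pm mp)
    then have "d = pinner S x ?a / (2 * E)" "c = pinner S x ?b / (2 * E)"
      using n0 E by (simp_all add: pinner_simps)
    moreover have "n = x - c *\<^sub>R ?a - d *\<^sub>R ?b" using cd by (simp add: algebra_simps)
    ultimately show "n = ?n" by simp
  qed
qed

section \<open>Curvature of a conformally flat Lorentz metric\<close>

lemma has_derivative_Pair_dirder:
  assumes "f differentiable (at p)" "g differentiable (at p)"
  shows "((\<lambda>q. (f q, g q)) has_derivative (\<lambda>e. (dirder f e p, dirder g e p))) (at p)"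
  by (rule has_derivative_Pair[OF assms[THEN differentiable_has_dirder]])

text \<open>This is the standard change of the Levi-Civita connection under a conformal factor; the
  pair \<open>(d_u lam p, - d_v lam p)\<close> is the gradient of \<open>lam\<close> for the flat
  metric du^2 - dv^2.\<close>

lemma christoffel_conformal:
  assumes U: "open U" "p \<in> U" and lam: "lam differentiable (at p)"
    and g: "\<And>q X Y. q \<in> U \<Longrightarrow> g q X Y = exp (2 * lam q) * (fst X * fst Y - snd X * snd Y)"
  shows "christoffel g X Y p = dirder lam X p *\<^sub>R Y + dirder lam Y p *\<^sub>R X
    - (fst X * fst Y - snd X * snd Y) *\<^sub>R (d_u lam p, - d_v lam p)" (is "_ = ?Z")
proof -
  let ?E = "exp (2 * lam p)"
  let ?i = "\<lambda>X Y :: paracomplex. fst X * fst Y - snd X * snd Y"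
  have d: "dirder (\<lambda>q. g q Y W) X p = 2 * ?E * dirder lam X p * ?i Y W" for X Y W
  proof -
    have "dirder (\<lambda>q. g q Y W) X p = dirder (\<lambda>q. exp (2 * lam q) * ?i Y W) X p"
      by (rule dirder_cong_open[OF U]) (simp add: g)
    then show ?thesis using lam by simp
  qed
  have W: "dirder lam W p = ?i (d_u lam p, - d_v lam p) W" for W
    using dirder_coords[OF lam, of W] by simp
  have char: "(\<forall>W. g p Z W = (dirder (\<lambda>q. g q Y W) X p + dirder (\<lambda>q. g q X W) Y p
      - dirder (\<lambda>q. g q X Y) W p) / 2) \<longleftrightarrow> Z = ?Z" for Z
  proof -
    have "(dirder (\<lambda>q. g q Y W) X p + dirder (\<lambda>q. g q X W) Y p - dirder (\<lambda>q. g q X Y) W p) / 2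
        = ?E * ?i ?Z W" for W
      unfolding d by (subst W[of W]) (simp add: field_simps)
    moreover have "(\<forall>W. ?E * ?i Z W = ?E * ?i ?Z W) \<longleftrightarrow> Z = ?Z"
    proof
      have cancel: "Z = Z'" if *: "\<forall>W. ?E * ?i Z W = ?E * ?i Z' W" for Z'
        using *[rule_format, of "(1, 0)"] *[rule_format, of "(0, 1)"] by (simp add: prod_eq_iff)
      assume "\<forall>W. ?E * ?i Z W = ?E * ?i ?Z W"
      then show "Z = ?Z" by (rule cancel)
    qed auto
    ultimately show ?thesis by (simp add: g U)
  qed
  show ?thesis unfolding christoffel_def char by simp
qed

lemma gauss_curvature_conformal:
  assumes U: "open U" "p \<in> U" and lam: "smooth_on U lam"
    and g: "\<And>q X Y. q \<in> U \<Longrightarrow> g q X Y = exp (2 * lam q) * (fst X * fst Y - snd X * snd Y)"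
  shows "gauss_curvature g p = - exp (- 2 * lam p) * (d_u (d_u lam) p - d_v (d_v lam) p)"
proof -
  let ?X = "(1, 0) :: paracomplex" and ?Y = "(0, 1) :: paracomplex"
  note diff = smooth_on_differentiable[OF lam]
  note chr = christoffel_conformal[OF U(1) _ diff g]
  have ddiff: "dirder lam e differentiable (at p)" for e
    using smooth_on_differentiable[OF smooth_on_dirder[OF lam] U(2)] .
  have YY: "dirder (levi_civita g ?Y (\<lambda>_. ?Y)) ?X p = (dirder (d_u lam) ?X p, dirder (d_v lam) ?X p)"
    "levi_civita g ?Y (\<lambda>_. ?Y) p = (d_u lam p, d_v lam p)"
  proof -
    have eq: "levi_civita g ?Y (\<lambda>_. ?Y) q = (d_u lam q, d_v lam q)" if "q \<in> U" for q
      unfolding levi_civita_def by (simp add: chr[OF that that])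
    show "levi_civita g ?Y (\<lambda>_. ?Y) p = (d_u lam p, d_v lam p)" by (rule eq[OF U(2)])
    show "dirder (levi_civita g ?Y (\<lambda>_. ?Y)) ?X p = (dirder (d_u lam) ?X p, dirder (d_v lam) ?X p)"
      using dirder_cong_open[OF U eq] dirder_eqI[OF has_derivative_Pair_dirder[OF ddiff ddiff]] by simp
  qed
  have XY: "dirder (levi_civita g ?X (\<lambda>_. ?Y)) ?Y p = (dirder (d_v lam) ?Y p, dirder (d_u lam) ?Y p)"
    "levi_civita g ?X (\<lambda>_. ?Y) p = (d_v lam p, d_u lam p)"
  proof -
    have eq: "levi_civita g ?X (\<lambda>_. ?Y) q = (d_v lam q, d_u lam q)" if "q \<in> U" for q
      unfolding levi_civita_def by (simp add: chr[OF that that])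
    show "levi_civita g ?X (\<lambda>_. ?Y) p = (d_v lam p, d_u lam p)" by (rule eq[OF U(2)])
    show "dirder (levi_civita g ?X (\<lambda>_. ?Y)) ?Y p = (dirder (d_v lam) ?Y p, dirder (d_u lam) ?Y p)"
      using dirder_cong_open[OF U eq] dirder_eqI[OF has_derivative_Pair_dirder[OF ddiff ddiff]] by simp
  qed
  have coords: "dirder lam W p = fst W * d_u lam p + snd W * d_v lam p" for W
    using dirder_coords[OF diff[OF U(2)], of W] by simp
  \<comment> \<open>Only the first component is paired with \<open>?X\<close>. The quadratic terms
    of both iterated derivatives are the sum of the squares of lam_u and lam_v there, and they
    cancel.\<close>
  have "fst (riemann g ?X ?Y ?Y p) = d_u (d_u lam) p - d_v (d_v lam) p"
    unfolding riemann_def levi_civita_def[of g ?X "levi_civita g ?Y (\<lambda>_. ?Y)"]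
      levi_civita_def[of g ?Y "levi_civita g ?X (\<lambda>_. ?Y)"] YY XY chr[OF U(2) U(2)]
    by (simp add: chr[OF U(2) U(2)] coords[of "(d_u lam p, d_v lam p)"] coords[of "(d_v lam p, d_u lam p)"])
  moreover have "exp (- 2 * lam p) = inverse (exp (2 * lam p))" by (simp add: exp_minus)
  moreover have "E * (K * 1 - b * 0) / (E * (1 * 1 - 0 * 0) * (E * (0 * 0 - 1 * 1)) - 0) = - inverse E * K"
    if "E \<noteq> 0" for E K b :: real
    using that by (simp add: divide_simps)
  from this[of "exp (2 * lam p)"] have "exp (2 * lam p) * K / - (exp (2 * lam p) * exp (2 * lam p)) = - inverse (exp (2 * lam p)) * K" for K
    by simp
  ultimately show ?thesis
    unfolding gauss_curvature_def Let_def g[OF U(2)] by simp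
qed

section \<open>Surfaces with zero mean curvature vector in null coordinates\<close>

lemma conformal_metric_on_null:
  fixes f :: "paracomplex \<Rightarrow> real^'n::finite"
  assumes "smooth_on U f" "smooth_on U lam"
    and "\<And>p. p \<in> U \<Longrightarrow> pinner S (d_p f p) (d_p f p) = 0"
    and "\<And>p. p \<in> U \<Longrightarrow> pinner S (d_m f p) (d_m f p) = 0"
    and "\<And>p. p \<in> U \<Longrightarrow> pinner S (d_p f p) (d_m f p) = 2 * exp (2 * lam p)"
  shows "conformal_metric_on S U f lam"
  unfolding conformal_metric_on_def
proof (intro conjI ballI allI)
  fix p X Y assume p: "p \<in> U"
  have "pinner S (d_m f p) (d_p f p) = 2 * exp (2 * lam p)"
    using assms(5)[OF p] pinner_commute by metis
  then show "induced_metric S f p X Y = exp (2 * lam p) * (fst X * fst Y - snd X * snd Y)"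
    unfolding induced_metric_def dirder_null[OF smooth_on_differentiable[OF assms(1) p], of X]
      dirder_null[OF smooth_on_differentiable[OF assms(1) p], of Y]
    by (simp add: pinner_simps assms(3-5)[OF p]) (simp add: field_simps)
qed (rule assms)

locale conformal_surface =
  fixes S :: "'n::finite set" and L0 :: real and U :: "paracomplex set"
    and f :: "paracomplex \<Rightarrow> real^'n" and lam :: "paracomplex \<Rightarrow> real"
  assumes open_U: "open U" and smooth_f: "smooth_on U f" and f_in: "f ` U \<subseteq> space_form S L0"
    and conf: "conformal_metric_on S U f lam"
begin

abbreviation E :: "paracomplex \<Rightarrow> real" where "E p \<equiv> exp (2 * lam p)"

lemma smooth_lam: "smooth_on U lam"
  using conf by (simp add: conformal_metric_on_def)

lemma diffs [simp]:
  assumes "p \<in> U"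
  shows "f differentiable (at p)" "dirder f a differentiable (at p)"
    "dirder (dirder f a) b differentiable (at p)"
    "lam differentiable (at p)" "dirder lam a differentiable (at p)"
  using assms smooth_f smooth_lam by (auto intro!: smooth_on_differentiable smooth_on_dirder)

lemma metric: "p \<in> U \<Longrightarrow> pinner S (dirder f X p) (dirder f Y p) = E p * (fst X * fst Y - snd X * snd Y)"
  using conf unfolding conformal_metric_on_def induced_metric_def by blast

lemma sym_f: "p \<in> U \<Longrightarrow> d_p (d_m f) p = d_m (d_p f) p"
  by (rule symmetric_dirder[OF open_U _ smooth_f])

lemma sym_lam: "p \<in> U \<Longrightarrow> d_p (d_m lam) p = d_m (d_p lam) p"
  by (rule symmetric_dirder[OF open_U _ smooth_lam])

text \<open>The wave operator of du^2 - dv^2 factors into the two null derivatives.\<close>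

lemma wave_lam: "p \<in> U \<Longrightarrow> d_u (d_u lam) p - d_v (d_v lam) p = d_m (d_p lam) p"
proof -
  assume p: "p \<in> U"
  have *: "d_p lam q = d_u lam q + d_v lam q" if "q \<in> U" for q
    using dirder_coords[of lam q "(1, 1)"] that by simp
  have "d_m (d_p lam) p = d_m (\<lambda>q. d_u lam q + d_v lam q) p"
    by (rule dirder_cong_open[OF open_U p *])
  also have "\<dots> = d_u (d_u lam) p - d_v (d_v lam) p + (d_u (d_v lam) p - d_v (d_u lam) p)"
    using p dirder_coords[of "d_u lam" p "(1, -1)"] dirder_coords[of "d_v lam" p "(1, -1)"] by simp
  finally show ?thesis using symmetric_dirder[OF open_U p smooth_lam, of "(1, 0)" "(0, 1)"] by simp
qed

lemma null:
  assumes "p \<in> U"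
  shows "pinner S (d_p f p) (d_p f p) = 0" "pinner S (d_m f p) (d_m f p) = 0"
    "pinner S (d_p f p) (d_m f p) = 2 * E p" "pinner S (d_m f p) (d_p f p) = 2 * E p"
  using assms by (simp_all add: metric)

lemma normal_part: "p \<in> U \<Longrightarrow> normal_part S f p x =
    x - (pinner S x (d_m f p) / (2 * E p)) *\<^sub>R d_p f p - (pinner S x (d_p f p) / (2 * E p)) *\<^sub>R d_m f p"
  by (rule normal_part_null) (simp_all add: null)

lemma deriv_metric:
  assumes p: "p \<in> U"
  shows "pinner S (dirder f X p) (dirder (dirder f Y) e p) + pinner S (dirder (dirder f X) e p) (dirder f Y p)
    = 2 * E p * dirder lam e p * (fst X * fst Y - snd X * snd Y)"
proof -
  have "dirder (\<lambda>q. pinner S (dirder f X q) (dirder f Y q)) e p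
      = dirder (\<lambda>q. E q * (fst X * fst Y - snd X * snd Y)) e p"
    by (rule dirder_cong_open[OF open_U p]) (simp add: metric)
  then show ?thesis using p by simp
qed

text \<open>All six relations arise by differentiating the three products of null derivatives. In
  particular the mixed derivative is orthogonal to the surface, which is special to conformal
  coordinates.\<close>

lemma second_null:
  assumes p: "p \<in> U"
  shows "pinner S (d_p (d_p f) p) (d_p f p) = 0" "pinner S (d_p (d_p f) p) (d_m f p) = 4 * E p * d_p lam p"
    "pinner S (d_m (d_m f) p) (d_m f p) = 0" "pinner S (d_m (d_m f) p) (d_p f p) = 4 * E p * d_m lam p"
    "pinner S (d_m (d_p f) p) (d_p f p) = 0" "pinner S (d_m (d_p f) p) (d_m f p) = 0"
proof -
  note c = pinner_commute[of S "dirder f _ p"]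
  show 1: "pinner S (d_p (d_p f) p) (d_p f p) = 0" "pinner S (d_m (d_m f) p) (d_m f p) = 0"
    "pinner S (d_m (d_p f) p) (d_p f p) = 0" "pinner S (d_m (d_p f) p) (d_m f p) = 0"
    using deriv_metric[OF p, of "(1, 1)" "(1, 1)" "(1, 1)"] deriv_metric[OF p, of "(1, -1)" "(1, -1)" "(1, -1)"]
      deriv_metric[OF p, of "(1, 1)" "(1, 1)" "(1, -1)"] deriv_metric[OF p, of "(1, -1)" "(1, -1)" "(1, 1)"]
    by (simp_all add: c sym_f p)
  show "pinner S (d_p (d_p f) p) (d_m f p) = 4 * E p * d_p lam p"
    "pinner S (d_m (d_m f) p) (d_p f p) = 4 * E p * d_m lam p"
    using deriv_metric[OF p, of "(1, 1)" "(1, -1)" "(1, 1)"] deriv_metric[OF p, of "(1, 1)" "(1, -1)" "(1, -1)"] 1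
    by (simp_all add: c sym_f p)
qed

text \<open>The factor \<open>L0\<close> makes the following identities hold for the flat space form as well.\<close>

lemma position:
  assumes p: "p \<in> U"
  shows "L0 * pinner S (f p) (f p) = (if L0 = 0 then 0 else 1)"
    "L0 * pinner S (dirder f X p) (f p) = 0"
    "L0 * pinner S (dirder (dirder f X) Y p) (f p) = - (L0 * pinner S (dirder f X p) (dirder f Y p))"
proof -
  have ff: "L0 * pinner S (f q) (f q) = (if L0 = 0 then 0 else 1)" if "q \<in> U" for q
    using f_in that by (auto simp: space_form_def split: if_splits)
  show "L0 * pinner S (f p) (f p) = (if L0 = 0 then 0 else 1)" by (rule ff[OF p])
  have fX: "L0 * pinner S (dirder f X q) (f q) = 0" if "q \<in> U" for q X
  proof -
    have "dirder (\<lambda>q. L0 * pinner S (f q) (f q)) X q = dirder (\<lambda>_. if L0 = 0 then 0 else 1) X q"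
      by (rule dirder_cong_open[OF open_U that ff])
    then show ?thesis using that pinner_commute[of S "f q" "dirder f X q"] by simp
  qed
  show "L0 * pinner S (dirder f X p) (f p) = 0" by (rule fX[OF p])
  have "dirder (\<lambda>q. L0 * pinner S (dirder f X q) (f q)) Y p = dirder (\<lambda>_. 0) Y p"
    by (rule dirder_cong_open[OF open_U p fX])
  then show "L0 * pinner S (dirder (dirder f X) Y p) (f p) = - (L0 * pinner S (dirder f X p) (dirder f Y p))"
    using p by (simp add: algebra_simps)
qed

text \<open>The trace with respect to exp (2 lam) (du^2 - dv^2) is the difference of the two
  diagonal entries. Removing the position component from each second derivative contributes
  \<open>L0 * E p\<close> times the position vector with opposite signs, so the difference contains
  it twice.\<close>

lemma mean_curvature:
  assumes p: "p \<in> U"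
  shows "mean_curvature_vector S L0 f p = (1 / (2 * E p)) *\<^sub>R (d_m (d_p f) p + (2 * L0 * E p) *\<^sub>R f p)"
proof -
  let ?c = "\<lambda>X. cov S L0 f X (dirder f X) p"
  have np_diff: "normal_part S f p x - normal_part S f p y = normal_part S f p (x - y)" for x y
    by (simp add: normal_part[OF p] pinner_simps diff_divide_distrib algebra_simps)
  have wave: "d_u (d_u f) p - d_v (d_v f) p = d_m (d_p f) p"
  proof -
    have *: "d_p f q = d_u f q + d_v f q" if "q \<in> U" for q
      using dirder_coords[of f q "(1, 1)"] that by simp
    have "d_m (d_p f) p = d_m (\<lambda>q. d_u f q + d_v f q) p"
      by (rule dirder_cong_open[OF open_U p *])
    also have "\<dots> = d_u (d_u f) p - d_v (d_v f) p + (d_u (d_v f) p - d_v (d_u f) p)"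
      using p dirder_coords[of "d_u f" p "(1, -1)"] dirder_coords[of "d_v f" p "(1, -1)"] by simp
    finally show ?thesis using symmetric_dirder[OF open_U p smooth_f, of "(1, 0)" "(0, 1)"] by simp
  qed
  have pos: "L0 * pinner S (d_u (d_u f) p) (f p) = - (L0 * E p)" "L0 * pinner S (d_v (d_v f) p) (f p) = L0 * E p"
    using position(3)[OF p, of "(1, 0)" "(1, 0)"] position(3)[OF p, of "(0, 1)" "(0, 1)"] by (simp_all add: metric p)
  have cc: "?c (1, 0) - ?c (0, 1) = d_m (d_p f) p + (2 * L0 * E p) *\<^sub>R f p"
    unfolding cov_def pos wave[symmetric] using scaleR_add_left[of "L0 * E p" "L0 * E p" "f p"]
    by (simp add: mult.assoc del: scaleR_right_distrib)
  have pos0: "L0 = 0 \<or> pinner S (f p) (dirder f X p) = 0" for X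
    using position(2)[OF p, of X] pinner_commute[of S "f p"] by simp
  \<comment> \<open>The mixed derivative and, if \<open>L0\<close> is nonzero, the position vector
    are already orthogonal to the surface, so the projection changes nothing.\<close>
  have nn: "normal_part S f p (d_m (d_p f) p + (2 * L0 * E p) *\<^sub>R f p) = d_m (d_p f) p + (2 * L0 * E p) *\<^sub>R f p"
    using pos0[of "(1, 1)"] pos0[of "(1, -1)"] by (auto simp: normal_part[OF p] pinner_simps second_null[OF p])
  let ?b = "\<lambda>X. second_fundamental_form S L0 f p X X"
  have bb: "?b (1, 0) - ?b (0, 1) = d_m (d_p f) p + (2 * L0 * E p) *\<^sub>R f p"
    unfolding second_fundamental_form_def np_diff cc nn ..
  have "mean_curvature_vector S L0 f p = (1 / (2 * - (E p * E p))) *\<^sub>R ((- E p) *\<^sub>R ?b (1, 0) + E p *\<^sub>R ?b (0, 1))"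
    unfolding mean_curvature_vector_def Let_def induced_metric_def by (simp add: metric p)
  also have "(- E p) *\<^sub>R ?b (1, 0) + E p *\<^sub>R ?b (0, 1) = (- E p) *\<^sub>R (?b (1, 0) - ?b (0, 1))"
    by (simp add: scaleR_diff_right)
  also have "(1 / (2 * - (E p * E p))) *\<^sub>R \<dots> = (1 / (2 * E p)) *\<^sub>R (?b (1, 0) - ?b (0, 1))"
    by simp
  finally show ?thesis unfolding bb .
qed

text \<open>The immersion condition comes for free from nondegeneracy of the induced metric; what
  remains is a wave equation for the position vector.\<close>

lemma zmc_iff: "zmc_immersion_on S L0 U f lam \<longleftrightarrow> (\<forall>p\<in>U. d_m (d_p f) p = - ((2 * L0 * E p) *\<^sub>R f p))"
proof -
  have "inj (frechet_derivative f (at p))" if p: "p \<in> U" for p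
  proof -
    have lin: "linear (\<lambda>X. dirder f X p)" using p by (simp add: linear_frechet_derivative)
    have "X = 0" if "dirder f X p = 0" for X
      using metric[OF p, of X "(1, 0)"] metric[OF p, of X "(0, 1)"] that
      by (simp add: pinner_simps prod_eq_iff)
    then show ?thesis using linear_injective_0[OF lin] by simp
  qed
  then show ?thesis
    using smooth_f f_in conf by (auto simp: zmc_immersion_on_def mean_curvature add_eq_0_iff)
qed

end

text \<open>Half the components of the second fundamental form in the null directions.\<close>

definition sff_p :: "(paracomplex \<Rightarrow> real^'n::finite) \<Rightarrow> (paracomplex \<Rightarrow> real) \<Rightarrow> paracomplex \<Rightarrow> real^'n"
  where "sff_p f lam p = (1/2) *\<^sub>R d_p (d_p f) p - d_p lam p *\<^sub>R d_p f p"

definition sff_m :: "(paracomplex \<Rightarrow> real^'n::finite) \<Rightarrow> (paracomplex \<Rightarrow> real) \<Rightarrow> paracomplex \<Rightarrow> real^'n"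
  where "sff_m f lam p = (1/2) *\<^sub>R d_m (d_m f) p - d_m lam p *\<^sub>R d_m f p"

locale zmc_surface = conformal_surface +
  assumes wave_f: "p \<in> U \<Longrightarrow> d_m (d_p f) p = - ((2 * L0 * E p) *\<^sub>R f p)"
begin

abbreviation Ei :: "paracomplex \<Rightarrow> real" where "Ei p \<equiv> exp (- 2 * lam p)"

abbreviation A :: "paracomplex \<Rightarrow> real^'a" where "A \<equiv> sff_p f lam"

abbreviation B :: "paracomplex \<Rightarrow> real^'a" where "B \<equiv> sff_m f lam"

lemma E_Ei [simp]: "E p * Ei p = 1" "Ei p * E p = 1" "E p * (Ei p * x) = x" "Ei p * (E p * x) = x"
  by (simp_all add: mult.assoc[symmetric] flip: exp_add)

lemma wave_f': "p \<in> U \<Longrightarrow> d_p (d_m f) p = - ((2 * L0 * E p) *\<^sub>R f p)"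
  by (simp add: sym_f wave_f)

lemma f_pp: "d_p (d_p f) p = (2 * d_p lam p) *\<^sub>R d_p f p + 2 *\<^sub>R A p"
  by (simp add: sff_p_def algebra_simps)

lemma f_mm: "d_m (d_m f) p = (2 * d_m lam p) *\<^sub>R d_m f p + 2 *\<^sub>R B p"
  by (simp add: sff_m_def algebra_simps)

lemma smooth_A: "smooth_on U A" and smooth_B: "smooth_on U B"
  unfolding sff_p_def[abs_def] sff_m_def[abs_def]
  by (intro smooth_on_intros open_U smooth_f smooth_lam)+

lemma diffs_AB [simp]:
  "p \<in> U \<Longrightarrow> A differentiable (at p)" "p \<in> U \<Longrightarrow> B differentiable (at p)"
  using smooth_A smooth_B smooth_on_differentiable by blast+

lemma normal_AB:
  assumes p: "p \<in> U"
  shows "pinner S (A p) (d_p f p) = 0" "pinner S (A p) (d_m f p) = 0" "L0 * pinner S (A p) (f p) = 0"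
    "pinner S (B p) (d_p f p) = 0" "pinner S (B p) (d_m f p) = 0" "L0 * pinner S (B p) (f p) = 0"
proof -
  show "pinner S (A p) (d_p f p) = 0" "pinner S (A p) (d_m f p) = 0"
    "pinner S (B p) (d_p f p) = 0" "pinner S (B p) (d_m f p) = 0"
    by (simp_all add: sff_p_def sff_m_def pinner_simps second_null null p)
  have "L0 = 0 \<or> pinner S (dirder f X p) (f p) = 0" for X using position(2)[OF p, of X] by simp
  from this[of "(1, 1)"] this[of "(1, -1)"] show "L0 * pinner S (A p) (f p) = 0" "L0 * pinner S (B p) (f p) = 0"
    using position(3)[OF p, of "(1, 1)" "(1, 1)"] position(3)[OF p, of "(1, -1)" "(1, -1)"]
    by (auto simp: sff_p_def sff_m_def pinner_simps null p)
qed

lemma normal_space_iff: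
  assumes p: "p \<in> U"
  shows "n \<in> normal_space S L0 f p \<longleftrightarrow>
    L0 * pinner S n (f p) = 0 \<and> pinner S n (d_p f p) = 0 \<and> pinner S n (d_m f p) = 0"
proof -
  have "d_p f p = d_u f p + d_v f p" "d_m f p = d_u f p - d_v f p"
    using dirder_coords[of f p "(1, 1)"] dirder_coords[of f p "(1, -1)"] p by simp_all
  then show ?thesis
    by (auto simp: normal_space_def tangent_sf_def pinner_simps)
qed

text \<open>These are the Codazzi equations. Commuting third derivatives and inserting the wave
  equation for f cancels every position term and leaves no normal component: \<open>A\<close> is
  parallel in the normal bundle along \<open>d_m\<close>, and \<open>B\<close> along
  \<open>d_p\<close>.\<close>

lemma deriv_null_A: "p \<in> U \<Longrightarrow> d_m A p = - (L0 * E p + d_m (d_p lam) p) *\<^sub>R d_p f p"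
  and deriv_null_B: "p \<in> U \<Longrightarrow> d_p B p = - (L0 * E p + d_m (d_p lam) p) *\<^sub>R d_m f p"
proof -
  assume p: "p \<in> U"
  have wp: "d_m (d_p (d_p f)) p = d_p (\<lambda>q. - ((2 * L0 * E q) *\<^sub>R f q)) p"
    using symmetric_dirder[OF open_U p smooth_on_dirder[OF smooth_f], of "(1, 1)" "(1, 1)" "(1, -1)"]
      dirder_cong_open[OF open_U p wave_f] by simp
  have wm: "d_p (d_m (d_m f)) p = d_m (\<lambda>q. - ((2 * L0 * E q) *\<^sub>R f q)) p"
    using symmetric_dirder[OF open_U p smooth_on_dirder[OF smooth_f], of "(1, -1)" "(1, -1)" "(1, 1)"]
      dirder_cong_open[OF open_U p wave_f'] by simp
  show "d_m A p = - (L0 * E p + d_m (d_p lam) p) *\<^sub>R d_p f p"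
    unfolding sff_p_def[abs_def] using p by (simp add: wp wave_f algebra_simps)
  show "d_p B p = - (L0 * E p + d_m (d_p lam) p) *\<^sub>R d_m f p"
    unfolding sff_m_def[abs_def] using p by (simp add: wm wave_f' sym_lam algebra_simps)
qed

text \<open>Differentiating the orthogonality of \<open>A\<close> and \<open>d_m f\<close> in
  direction \<open>d_m\<close> brings in 2 \<open>B\<close> from the second derivative of f and the
  Codazzi coefficient from \<open>A\<close>.\<close>

lemma gauss_equation:
  assumes p: "p \<in> U"
  shows "d_m (d_p lam) p = - L0 * E p + Ei p * pinner S (A p) (B p)"
proof -
  have "d_m (\<lambda>q. pinner S (A q) (d_m f q)) p = d_m (\<lambda>_. 0) p"
    by (rule dirder_cong_open[OF open_U p normal_AB(2)])
  then have "pinner S (A p) (d_m (d_m f) p) + pinner S (d_m A p) (d_m f p) = 0"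
    using p by simp
  then have "E p * (L0 * E p + d_m (d_p lam) p) = pinner S (A p) (B p)"
    unfolding f_mm deriv_null_A[OF p] by (simp add: pinner_simps normal_AB null p) (simp add: algebra_simps)
  then have "Ei p * (E p * (L0 * E p + d_m (d_p lam) p)) = Ei p * pinner S (A p) (B p)" by (rule arg_cong)
  then show ?thesis unfolding E_Ei by linarith
qed

lemma d_m_A: "p \<in> U \<Longrightarrow> d_m A p = - (Ei p * pinner S (A p) (B p)) *\<^sub>R d_p f p"
  by (subst deriv_null_A) (simp_all add: gauss_equation)

lemma d_p_B: "p \<in> U \<Longrightarrow> d_p B p = - (Ei p * pinner S (A p) (B p)) *\<^sub>R d_m f p"
  by (subst deriv_null_B) (simp_all add: gauss_equation)

lemma gauss_curvature: "p \<in> U \<Longrightarrow>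
    gauss_curvature (induced_metric S f) p = L0 - (Ei p)\<^sup>2 * pinner S (A p) (B p)"
proof -
  assume p: "p \<in> U"
  have "gauss_curvature (induced_metric S f) p = - Ei p * d_m (d_p lam) p"
    using gauss_curvature_conformal[OF open_U p smooth_lam, of "induced_metric S f"] p
    by (simp add: induced_metric_def metric wave_lam)
  also have "\<dots> = L0 * (E p * Ei p) - Ei p * Ei p * pinner S (A p) (B p)"
    unfolding gauss_equation[OF p] by (simp only: algebra_simps)
  finally show ?thesis by (simp only: E_Ei power2_eq_square mult_1_right)
qed

text \<open>For a normal field the ambient derivative has no position component, and its tangential
  components are minus the products of the field with second derivatives of f. Mixed second
  derivatives are proportional to f and drop out, so only \<open>A\<close> and \<open>B\<close>
  occur. The field may live on a smaller open set, as the definition of normal flatness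
  demands.\<close>

lemma normal_connection:
  assumes V: "open V" "V \<subseteq> U" and xi: "smooth_on V xi"
    and normal: "\<forall>q\<in>V. xi q \<in> normal_space S L0 f q" and p: "p \<in> V"
  shows "normal_connection S L0 f X xi p = dirder xi X p
    + ((fst X + snd X) / 2 * (Ei p * pinner S (xi p) (A p))) *\<^sub>R d_m f p
    + ((fst X - snd X) / 2 * (Ei p * pinner S (xi p) (B p))) *\<^sub>R d_p f p"
proof -
  have pU: "p \<in> U" using p V by blast
  have dxi: "xi differentiable (at p)" by (rule smooth_on_differentiable[OF xi p])
  have n: "L0 * pinner S (xi q) (f q) = 0" "pinner S (xi q) (d_p f q) = 0" "pinner S (xi q) (d_m f q) = 0"
    if "q \<in> V" for q
    using bspec[OF normal that] normal_space_iff[of q "xi q"] V that by auto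
  have "dirder (\<lambda>q. L0 * pinner S (xi q) (f q)) X p = dirder (\<lambda>_. 0) X p"
    "dirder (\<lambda>q. pinner S (xi q) (d_p f q)) X p = dirder (\<lambda>_. 0) X p"
    "dirder (\<lambda>q. pinner S (xi q) (d_m f q)) X p = dirder (\<lambda>_. 0) X p"
    by (rule dirder_cong_open[OF V(1) p n(1)] dirder_cong_open[OF V(1) p n(2)] dirder_cong_open[OF V(1) p n(3)], assumption)+
  then have d: "L0 * pinner S (xi p) (dirder f X p) + L0 * pinner S (dirder xi X p) (f p) = 0"
    "pinner S (dirder xi X p) (d_p f p) = - pinner S (xi p) (dirder (d_p f) X p)"
    "pinner S (dirder xi X p) (d_m f p) = - pinner S (xi p) (dirder (d_m f) X p)"
    using pU dxi by (simp_all add: distrib_left eq_neg_iff_add_eq_0 add.commute)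
  have L: "L0 * pinner S (xi p) (dirder f X p) = 0"
    using n[OF p] dirder_null[of f p X] pU by (simp add: pinner_simps)
  have c: "cov S L0 f X xi p = dirder xi X p"
    using d(1) L by (simp add: cov_def)
  have L0f: "L0 * (E p * pinner S (xi p) (f p)) = 0" using n[OF p] by auto
  have w: "pinner S (xi p) (d_m (d_p f) p) = 0" "pinner S (xi p) (d_p (d_m f) p) = 0"
    using L0f unfolding wave_f[OF pU] wave_f'[OF pU] by (simp_all add: pinner_simps)
  have "pinner S (xi p) (dirder (d_p f) X p) = (fst X + snd X) * pinner S (xi p) (A p)"
    unfolding dirder_null[OF diffs(2)[OF pU], of "(1, 1)" X] by (simp add: pinner_simps w f_pp n[OF p])
  moreover have "pinner S (xi p) (dirder (d_m f) X p) = (fst X - snd X) * pinner S (xi p) (B p)"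
    unfolding dirder_null[OF diffs(2)[OF pU], of "(1, -1)" X] by (simp add: pinner_simps w f_mm n[OF p])
  moreover have "- (a * b) / (2 * E p) = - (a / 2 * (Ei p * b))" for a b
  proof -
    have "- (a * b) / (2 * e) = - (a / 2 * (ei * b))" if "e * ei = 1" for e ei :: real
      using that by (cases "e = 0") (auto simp: field_simps)
    from this[OF E_Ei(1)] show ?thesis .
  qed
  ultimately show ?thesis
    unfolding normal_connection_def c normal_part[OF pU] d(2,3) by (simp only: scaleR_minus_left) simp
qed

lemma normal_connection_normal:
  assumes V: "open V" "V \<subseteq> U" and xi: "smooth_on V xi"
    and normal: "\<forall>q\<in>V. xi q \<in> normal_space S L0 f q" and p: "p \<in> V"
  shows "normal_connection S L0 f X xi p \<in> normal_space S L0 f p"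
proof -
  have pU: "p \<in> U" using p V by blast
  have n: "L0 * pinner S (xi q) (f q) = 0"
    if "q \<in> V" for q
    using bspec[OF normal that] normal_space_iff[of q "xi q"] V that by auto
  have dxi: "xi differentiable (at p)" by (rule smooth_on_differentiable[OF xi p])
  have pos: "L0 = 0 \<or> pinner S (dirder f Y p) (f p) = 0" for Y
    using position(2)[OF pU, of Y] by simp
  have "dirder (\<lambda>q. L0 * pinner S (xi q) (f q)) X p = dirder (\<lambda>_. 0) X p"
    by (rule dirder_cong_open[OF V(1) p n])
  then have "L0 * pinner S (xi p) (dirder f X p) + L0 * pinner S (dirder xi X p) (f p) = 0"
    using pU dxi by (simp add: distrib_left)
  moreover have "L0 * pinner S (xi p) (dirder f X p) = 0"
    using bspec[OF normal p] normal_space_iff[OF pU, of "xi p"] dirder_null[of f p X] pU by (simp add: pinner_simps)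
  ultimately have c: "cov S L0 f X xi p = dirder xi X p" and t: "L0 * pinner S (dirder xi X p) (f p) = 0"
    by (simp_all add: cov_def)
  show ?thesis
    unfolding normal_space_iff[OF pU] normal_connection_def c normal_part[OF pU]
    using t pos[of "(1, 1)"] pos[of "(1, -1)"] by (auto simp: pinner_simps null pU)
qed

text \<open>The Ricci equation. With constant X and Y the expression is bilinear and alternating in
  them, so it suffices to compute it for the two null directions.\<close>

lemma normal_curvature:
  assumes V: "open V" "V \<subseteq> U" and xi: "smooth_on V xi"
    and normal: "\<forall>q\<in>V. xi q \<in> normal_space S L0 f q" and p: "p \<in> V"
  shows "normal_curvature S L0 f X Y xi p = (Ei p * (snd X * fst Y - fst X * snd Y)) *\<^sub>R
    (pinner S (xi p) (B p) *\<^sub>R A p - pinner S (xi p) (A p) *\<^sub>R B p)"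
proof -
  have pU: "p \<in> U" using p V by blast
  let ?N = "\<lambda>X. normal_connection S L0 f X"
  \<comment> \<open>\<open>eta\<close> and \<open>zeta\<close> are the normal derivatives of
    \<open>xi\<close> along the two null directions; every other normal derivative is a combination
    of them.\<close>
  define eta where "eta q = d_p xi q + (Ei q * pinner S (xi q) (A q)) *\<^sub>R d_m f q" for q
  define zeta where "zeta q = d_m xi q + (Ei q * pinner S (xi q) (B q)) *\<^sub>R d_p f q" for q
  note sV = smooth_on_subset[OF V(2)]
  have smooth: "smooth_on V eta" "smooth_on V zeta"
    unfolding eta_def[abs_def] zeta_def[abs_def]
    by (intro smooth_on_intros smooth_on_pinner V xi sV[OF smooth_f] sV[OF smooth_A] sV[OF smooth_B] sV[OF smooth_lam])+
  have dxi: "xi differentiable (at q)" if "q \<in> V" for q by (rule smooth_on_differentiable[OF xi that])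
  have N: "?N Z xi q = ((fst Z + snd Z) / 2) *\<^sub>R eta q + ((fst Z - snd Z) / 2) *\<^sub>R zeta q" if "q \<in> V" for Z q
    unfolding normal_connection[OF V xi normal that] dirder_null[OF dxi[OF that], of Z] eta_def zeta_def
    by (simp add: algebra_simps)
  have eta_zeta: "eta q = ?N (1, 1) xi q" "zeta q = ?N (1, -1) xi q" if "q \<in> V" for q
    using N[OF that] by simp_all
  have nrm: "\<forall>q\<in>V. eta q \<in> normal_space S L0 f q" "\<forall>q\<in>V. zeta q \<in> normal_space S L0 f q"
    using normal_connection_normal[OF V xi normal] eta_zeta by simp_all
  have lin: "?N Z (\<lambda>q. a *\<^sub>R eta q + b *\<^sub>R zeta q) p = a *\<^sub>R ?N Z eta p + b *\<^sub>R ?N Z zeta p" for Z a b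
  proof -
    have "?N Z (\<lambda>q. a *\<^sub>R eta q + b *\<^sub>R zeta q) p = dirder (\<lambda>q. a *\<^sub>R eta q + b *\<^sub>R zeta q) Z p
      + ((fst Z + snd Z) / 2 * (Ei p * pinner S (a *\<^sub>R eta p + b *\<^sub>R zeta p) (A p))) *\<^sub>R d_m f p
      + ((fst Z - snd Z) / 2 * (Ei p * pinner S (a *\<^sub>R eta p + b *\<^sub>R zeta p) (B p))) *\<^sub>R d_p f p"
    proof (rule normal_connection[OF V _ _ p])
      show "smooth_on V (\<lambda>q. a *\<^sub>R eta q + b *\<^sub>R zeta q)"
        by (intro smooth_on_intros V smooth)
      show "\<forall>q\<in>V. a *\<^sub>R eta q + b *\<^sub>R zeta q \<in> normal_space S L0 f q"
      proof
        fix q assume q: "q \<in> V"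
        then have "q \<in> U" using V by blast
        then show "a *\<^sub>R eta q + b *\<^sub>R zeta q \<in> normal_space S L0 f q"
          using bspec[OF nrm(1) q] bspec[OF nrm(2) q] by (auto simp: normal_space_iff pinner_simps)
      qed
    qed
    then show ?thesis
      unfolding normal_connection[OF V smooth(1) nrm(1) p] normal_connection[OF V smooth(2) nrm(2) p]
      using smooth[THEN smooth_on_differentiable[OF _ p]] by (simp add: pinner_simps algebra_simps)
  qed
  have cong: "?N Z (?N W xi) p = ?N Z (\<lambda>q. ((fst W + snd W) / 2) *\<^sub>R eta q + ((fst W - snd W) / 2) *\<^sub>R zeta q) p" for Z W
  proof -
    have "dirder (?N W xi) Z p = dirder (\<lambda>q. ((fst W + snd W) / 2) *\<^sub>R eta q + ((fst W - snd W) / 2) *\<^sub>R zeta q) Z p"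
      by (rule dirder_cong_open[OF V(1) p N])
    then show ?thesis unfolding normal_connection_def[of S L0 f Z] cov_def by (rule arg_cong)
  qed
  \<comment> \<open>The mixed derivatives of \<open>xi\<close> agree and the tangential terms match
    crosswise. The surviving terms stem from differentiating \<open>d_p f\<close> in
    \<open>zeta\<close> and \<open>d_m f\<close> in \<open>eta\<close>, which yields
    \<open>A\<close> and \<open>B\<close>.\<close>
  have D: "?N (1, 1) zeta p - ?N (1, -1) eta p = (2 * Ei p) *\<^sub>R
      (pinner S (xi p) (B p) *\<^sub>R A p - pinner S (xi p) (A p) *\<^sub>R B p)"
  proof -
    have n: "pinner S (xi p) (d_p f p) = 0" "pinner S (xi p) (d_m f p) = 0"
      using bspec[OF normal p] normal_space_iff[OF pU] by auto
    have ddxi: "dirder xi e differentiable (at p)" for e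
      by (rule smooth_on_differentiable[OF smooth_on_dirder[OF xi] p])
    have zA: "pinner S (zeta p) (A p) = pinner S (d_m xi p) (A p)"
      "pinner S (eta p) (B p) = pinner S (d_p xi p) (B p)"
      by (simp_all add: zeta_def eta_def pinner_simps normal_AB pU
          pinner_commute[of S "d_p f p"] pinner_commute[of S "d_m f p"])
    have "?N (1, 1) zeta p = d_p zeta p + (Ei p * pinner S (d_m xi p) (A p)) *\<^sub>R d_m f p"
      unfolding normal_connection[OF V smooth(2) nrm(2) p] zA by simp
    moreover have "?N (1, -1) eta p = d_m eta p + (Ei p * pinner S (d_p xi p) (B p)) *\<^sub>R d_p f p"
      unfolding normal_connection[OF V smooth(1) nrm(1) p] zA by simp
    moreover have "d_p zeta p = d_p (d_m xi) p + (Ei p * pinner S (d_p xi p) (B p)) *\<^sub>R d_p f p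
        + (2 * Ei p * pinner S (xi p) (B p)) *\<^sub>R A p"
      unfolding zeta_def[abs_def] using pU ddxi dxi[OF p]
      by (simp add: f_pp d_p_B pinner_simps n algebra_simps)
    moreover have "d_m eta p = d_m (d_p xi) p + (Ei p * pinner S (d_m xi p) (A p)) *\<^sub>R d_m f p
        + (2 * Ei p * pinner S (xi p) (A p)) *\<^sub>R B p"
      unfolding eta_def[abs_def] using pU ddxi dxi[OF p]
      by (simp add: f_mm d_m_A pinner_simps n algebra_simps)
    moreover have "d_p (d_m xi) p = d_m (d_p xi) p"
      by (rule symmetric_dirder[OF V(1) p xi])
    ultimately show ?thesis by (simp add: algebra_simps)
  qed
  have NW: "?N W chi p = ((fst W + snd W) / 2) *\<^sub>R ?N (1, 1) chi p + ((fst W - snd W) / 2) *\<^sub>R ?N (1, -1) chi p"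
    if "smooth_on V chi" "\<forall>q\<in>V. chi q \<in> normal_space S L0 f q" for W chi
    unfolding normal_connection[OF V that p] dirder_null[OF smooth_on_differentiable[OF that(1) p], of W]
    by (simp add: algebra_simps)
  have "normal_curvature S L0 f X Y xi p =
      ((snd X * fst Y - fst X * snd Y) / 2) *\<^sub>R (?N (1, 1) zeta p - ?N (1, -1) eta p)"
    unfolding normal_curvature_def cong lin NW[OF smooth(1) nrm(1), of X] NW[OF smooth(1) nrm(1), of Y]
      NW[OF smooth(2) nrm(2), of X] NW[OF smooth(2) nrm(2), of Y]
    by (simp add: vec_eq_iff) (simp add: field_simps)
  then show ?thesis unfolding D by simp
qed

end

section \<open>Pseudo-orthogonal frames\<close>

lemma linear_inj_iff_surj:
  fixes T :: "'a::euclidean_space \<Rightarrow> 'b::euclidean_space"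
  assumes "linear T" "DIM('a) = DIM('b)"
  shows "inj T \<longleftrightarrow> surj T"
  using linear_surjective_imp_injective[OF assms(1)] linear_injective_imp_surjective[OF assms(1)] assms(2)
  by (auto simp: dim_UNIV)

text \<open>The members are position, two null tangents, and two orthogonal normals. The squares of
  \<open>A\<close> and \<open>C\<close> have opposite signs because the normal plane of a time-like
  surface in a neutral space has signature (1, 1). For \<open>L0 = 0\<close> the conditions on
  \<open>x\<close> become vacuous.\<close>

definition frame_gram ::
  "'n::finite set \<Rightarrow> real \<Rightarrow> real \<Rightarrow> real \<Rightarrow> real^'n \<Rightarrow> real^'n \<Rightarrow> real^'n \<Rightarrow> real^'n \<Rightarrow> real^'n \<Rightarrow> bool"
  where "frame_gram S L0 E d x P M A C \<longleftrightarrow>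
    L0 * pinner S x x = (if L0 = 0 then 0 else 1) \<and>
    L0 * pinner S P x = 0 \<and> L0 * pinner S M x = 0 \<and> L0 * pinner S A x = 0 \<and> L0 * pinner S C x = 0 \<and>
    pinner S P P = 0 \<and> pinner S M M = 0 \<and> pinner S P M = 2 * E \<and>
    pinner S A P = 0 \<and> pinner S A M = 0 \<and> pinner S C P = 0 \<and> pinner S C M = 0 \<and>
    pinner S A A = d \<and> pinner S C C = - d \<and> pinner S A C = 0"

text \<open>This is the expansion of y in the frame by its dual frame, if the Gram relations hold:
  \<open>P\<close> and \<open>M\<close> are dual to each other up to 2 E, while \<open>A\<close> and
  \<open>C\<close> are dual to themselves up to d and - d.\<close>

definition frame_sum ::
  "'n::finite set \<Rightarrow> real \<Rightarrow> real \<Rightarrow> real \<Rightarrow> real^'n \<Rightarrow> real^'n \<Rightarrow> real^'n \<Rightarrow> real^'n \<Rightarrow> real^'n \<Rightarrow> real^'n \<Rightarrow> real^'n"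
  where "frame_sum S L0 E d x P M A C y =
    (L0 * pinner S x y) *\<^sub>R x + (pinner S P y / (2 * E)) *\<^sub>R M + (pinner S M y / (2 * E)) *\<^sub>R P
    + (pinner S A y / d) *\<^sub>R A - (pinner S C y / d) *\<^sub>R C"

text \<open>Both statements say that the Gram matrix of the frame is the prescribed one: a matrix that
  is a left inverse is also a right inverse.\<close>

lemma frame_gram_iff:
  fixes S :: "'n::finite set"
  assumes dim: "CARD('n) = (if L0 = 0 then 4 else 5)" and E: "E \<noteq> 0" and d: "d \<noteq> 0"
  shows "frame_gram S L0 E d x P M A C \<longleftrightarrow> (\<forall>y. frame_sum S L0 E d x P M A C y = y)"
proof (cases "L0 = 0")
  case True
  \<comment> \<open>T lists the products with the frame. The dimension hypothesis makes injectivity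
    and surjectivity of T equivalent, which is the step from left inverse to right inverse.\<close>
  define T where "T y = (pinner S P y, pinner S M y, pinner S A y, pinner S C y)" for y
  have T: "linear T"
    unfolding T_def by (rule linearI) (simp_all add: pinner_simps)
  have dimT: "DIM(real^'n) = DIM(real \<times> real \<times> real \<times> real)" using dim True by simp
  show ?thesis
  proof
    assume G: "frame_gram S L0 E d x P M A C"
    note g = G[unfolded frame_gram_def] pinner_commute[of S M P] pinner_commute[of S P A] pinner_commute[of S M A]
      pinner_commute[of S P C] pinner_commute[of S M C] pinner_commute[of S C A]
    have "y \<in> range T" for y
    proof -
      obtain p m a c where y: "y = (p, m, a, c)" by (cases y)
      have "T ((p / (2 * E)) *\<^sub>R M + (m / (2 * E)) *\<^sub>R P + (a / d) *\<^sub>R A - (c / d) *\<^sub>R C) = y"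
        using g E d by (simp add: T_def y pinner_simps)
      then show ?thesis by (metis rangeI)
    qed
    then have "inj T" using linear_inj_iff_surj[OF T dimT] by blast
    moreover have "T (frame_sum S L0 E d x P M A C y) = T y" for y
      using g E d True by (simp add: T_def frame_sum_def pinner_simps)
    ultimately show "\<forall>y. frame_sum S L0 E d x P M A C y = y" by (simp add: inj_eq)
  next
    assume F: "\<forall>y. frame_sum S L0 E d x P M A C y = y"
    have "inj T"
    proof (rule injI)
      fix y z assume "T y = T z"
      then have "frame_sum S L0 E d x P M A C y = frame_sum S L0 E d x P M A C z"
        using True by (simp add: T_def frame_sum_def)
      then show "y = z" using F by metis
    qed
    then have surj: "surj T" using linear_inj_iff_surj[OF T dimT] by blast
    \<comment> \<open>A preimage of a unit vector is a dual frame vector. The expansion identifies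
      it with a multiple of a frame vector, so its known products are entries of the Gram
      matrix.\<close>
    obtain y1 where "T y1 = (1, 0, 0, 0)" using surj by (metis surjD)
    then have y1: "y1 = (1 / (2 * E)) *\<^sub>R M" "pinner S P y1 = 1" "pinner S M y1 = 0" "pinner S A y1 = 0" "pinner S C y1 = 0"
      using F[rule_format, of y1] True by (simp_all add: T_def frame_sum_def)
    obtain y2 where "T y2 = (0, 1, 0, 0)" using surj by (metis surjD)
    then have y2: "y2 = (1 / (2 * E)) *\<^sub>R P" "pinner S P y2 = 0" "pinner S M y2 = 1" "pinner S A y2 = 0" "pinner S C y2 = 0"
      using F[rule_format, of y2] True by (simp_all add: T_def frame_sum_def)
    obtain y3 where "T y3 = (0, 0, 1, 0)" using surj by (metis surjD)
    then have y3: "y3 = (1 / d) *\<^sub>R A" "pinner S A y3 = 1" "pinner S C y3 = 0"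
      using F[rule_format, of y3] True by (simp_all add: T_def frame_sum_def)
    obtain y4 where "T y4 = (0, 0, 0, 1)" using surj by (metis surjD)
    then have y4: "y4 = - ((1 / d) *\<^sub>R C)" "pinner S C y4 = 1"
      using F[rule_format, of y4] True by (simp_all add: T_def frame_sum_def)
    show "frame_gram S L0 E d x P M A C"
      using y1 y2 y3 y4 E d True pinner_commute[of S A C]
      by (auto simp: frame_gram_def pinner_simps field_simps)
  qed
next
  case False
  define T where "T y = (pinner S x y, pinner S P y, pinner S M y, pinner S A y, pinner S C y)" for y
  have T: "linear T"
    unfolding T_def by (rule linearI) (simp_all add: pinner_simps)
  have dimT: "DIM(real^'n) = DIM(real \<times> real \<times> real \<times> real \<times> real)" using dim False by simp
  show ?thesis
  proof
    assume G: "frame_gram S L0 E d x P M A C"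
    note g = G[unfolded frame_gram_def] pinner_commute[of S M P] pinner_commute[of S P A] pinner_commute[of S M A]
      pinner_commute[of S P C] pinner_commute[of S M C] pinner_commute[of S C A]
      pinner_commute[of S x P] pinner_commute[of S x M] pinner_commute[of S x A] pinner_commute[of S x C]
    have "y \<in> range T" for y
    proof -
      obtain q p m a c where y: "y = (q, p, m, a, c)" by (cases y)
      have "T ((L0 * q) *\<^sub>R x + (p / (2 * E)) *\<^sub>R M + (m / (2 * E)) *\<^sub>R P + (a / d) *\<^sub>R A - (c / d) *\<^sub>R C) = y"
        using g E d False by (simp add: T_def y pinner_simps)
      then show ?thesis by (metis rangeI)
    qed
    then have "inj T" using linear_inj_iff_surj[OF T dimT] by blast
    moreover have "T (frame_sum S L0 E d x P M A C y) = T y" for y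
      using g E d False by (simp add: T_def frame_sum_def pinner_simps)
    ultimately show "\<forall>y. frame_sum S L0 E d x P M A C y = y" by (simp add: inj_eq)
  next
    assume F: "\<forall>y. frame_sum S L0 E d x P M A C y = y"
    have "inj T"
    proof (rule injI)
      fix y z assume "T y = T z"
      then have "frame_sum S L0 E d x P M A C y = frame_sum S L0 E d x P M A C z"
        by (simp add: T_def frame_sum_def)
      then show "y = z" using F by metis
    qed
    then have surj: "surj T" using linear_inj_iff_surj[OF T dimT] by blast
    obtain y0 where "T y0 = (1, 0, 0, 0, 0)" using surj by (metis surjD)
    then have y0: "y0 = L0 *\<^sub>R x" "pinner S x y0 = 1" "pinner S P y0 = 0" "pinner S M y0 = 0" "pinner S A y0 = 0" "pinner S C y0 = 0"
      using F[rule_format, of y0] by (simp_all add: T_def frame_sum_def)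
    obtain y1 where "T y1 = (0, 1, 0, 0, 0)" using surj by (metis surjD)
    then have y1: "y1 = (1 / (2 * E)) *\<^sub>R M" "pinner S P y1 = 1" "pinner S M y1 = 0" "pinner S A y1 = 0" "pinner S C y1 = 0"
      using F[rule_format, of y1] by (simp_all add: T_def frame_sum_def)
    obtain y2 where "T y2 = (0, 0, 1, 0, 0)" using surj by (metis surjD)
    then have y2: "y2 = (1 / (2 * E)) *\<^sub>R P" "pinner S P y2 = 0" "pinner S M y2 = 1" "pinner S A y2 = 0" "pinner S C y2 = 0"
      using F[rule_format, of y2] by (simp_all add: T_def frame_sum_def)
    obtain y3 where "T y3 = (0, 0, 0, 1, 0)" using surj by (metis surjD)
    then have y3: "y3 = (1 / d) *\<^sub>R A" "pinner S A y3 = 1" "pinner S C y3 = 0"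
      using F[rule_format, of y3] by (simp_all add: T_def frame_sum_def)
    obtain y4 where "T y4 = (0, 0, 0, 0, 1)" using surj by (metis surjD)
    then have y4: "y4 = - ((1 / d) *\<^sub>R C)" "pinner S C y4 = 1"
      using F[rule_format, of y4] by (simp_all add: T_def frame_sum_def)
    show "frame_gram S L0 E d x P M A C"
      using y0 y1 y2 y3 y4 E d False pinner_commute[of S A C]
      by (auto simp: frame_gram_def pinner_simps field_simps)
  qed
qed

section \<open>Orthogonal systems and Sylvester's law of inertia\<close>

lemma pinner_sum_orthogonal:
  assumes "finite W" "pairwise (\<lambda>v w. pinner S v w = 0) W" "w \<in> W"
  shows "pinner S (\<Sum>v\<in>W. c v *\<^sub>R v) w = c w * pinner S w w"
proof -
  have "pinner S (\<Sum>v\<in>W. c v *\<^sub>R v) w = (\<Sum>v\<in>W. c v * pinner S v w)"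
    by (simp add: pinner.sum_left pinner_simps)
  also have "\<dots> = (\<Sum>v\<in>W. if v = w then c w * pinner S w w else 0)"
    using assms by (intro sum.cong) (auto simp: pairwise_def)
  finally show ?thesis using assms by simp
qed

lemma independent_orthogonal:
  assumes "finite W" "pairwise (\<lambda>v w. pinner S v w = 0) W" "\<And>w. w \<in> W \<Longrightarrow> pinner S w w \<noteq> 0"
  shows "independent W"
proof -
  have "c w = 0" if "(\<Sum>v\<in>W. c v *\<^sub>R v) = 0" "w \<in> W" for c w
    using pinner_sum_orthogonal[OF assms(1,2) that(2), of c] that assms(3)[of w]
    by (simp add: pinner_simps)
  then show ?thesis using assms(1) by (auto simp: independent_explicit)
qed

text \<open>Half of Sylvester's law. A vector whose coordinates outside \<open>S\<close> vanish has
  nonpositive square, while the form is positive definite on the span of \<open>W\<close>. So the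
  projection to the coordinates outside \<open>S\<close> is injective on that span.\<close>

lemma card_positive_le:
  fixes S :: "'n::finite set"
  assumes W: "finite W" "pairwise (\<lambda>v w. pinner S v w = 0) W" "\<And>w. w \<in> W \<Longrightarrow> pinner S w w > 0"
  shows "card W \<le> card (- S)"
proof -
  have ind: "independent W"
    by (rule independent_orthogonal[OF W(1,2)]) (use W(3) in force)
  define Pr where "Pr x = (\<chi> i. if i \<in> S then 0 else x $ i)" for x :: "real^'n"
  have lin: "linear Pr" unfolding Pr_def by (rule linearI) (auto simp: vec_eq_iff)
  have inj: "inj_on Pr (span W)"
  proof (subst linear_inj_on_iff_eq_0[OF lin subspace_span], intro ballI impI)
    fix x assume x: "x \<in> span W" "Pr x = 0"
    obtain c where c: "x = (\<Sum>v\<in>W. c v *\<^sub>R v)"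
      using x(1) span_finite[OF W(1)] by auto
    have "x $ i = 0" if "i \<notin> S" for i
      using arg_cong[OF x(2), of "\<lambda>y. y $ i"] that by (simp add: Pr_def)
    then have "pinner S x x = - (\<Sum>i\<in>UNIV. (x $ i)\<^sup>2)"
      unfolding pinner_def sum_negf[symmetric] by (intro sum.cong) (auto simp: power2_eq_square)
    then have "pinner S x x \<le> 0" by (simp add: sum_nonneg)
    moreover have "pinner S x x = (\<Sum>w\<in>W. c w * (c w * pinner S w w))"
    proof -
      have "pinner S x x = pinner S x (\<Sum>w\<in>W. c w *\<^sub>R w)" using c by simp
      also have "\<dots> = (\<Sum>w\<in>W. c w * pinner S x w)"
        by (simp add: pinner.sum_right pinner_simps)
      finally show ?thesis unfolding c using pinner_sum_orthogonal[OF W(1,2), of _ c] by simp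
    qed
    ultimately have "(\<Sum>w\<in>W. c w * (c w * pinner S w w)) \<le> 0" by simp
    moreover have nn: "0 \<le> c w * (c w * pinner S w w)" if "w \<in> W" for w
      using W(3)[OF that] by (simp flip: mult.assoc)
    ultimately have "\<forall>w\<in>W. c w * (c w * pinner S w w) = 0"
      using sum_nonneg_eq_0_iff[OF W(1), of "\<lambda>w. c w * (c w * pinner S w w)"]
      by (metis (no_types, lifting) antisym sum_nonneg)
    then have "\<forall>w\<in>W. c w = 0" using W(3) by force
    then show "x = 0" unfolding c by simp
  qed
  have "independent (Pr ` W)"
    by (rule linear_independent_injective_image[OF lin ind inj])
  moreover have "Pr ` W \<subseteq> span ((\<lambda>i. axis i 1) ` (- S))"
  proof
    fix y assume "y \<in> Pr ` W"
    then obtain w where y: "y = Pr w" by blast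
    have "y = (\<Sum>i\<in>- S. (w $ i) *\<^sub>R axis i 1)"
      by (auto simp: y Pr_def vec_eq_iff axis_def if_distrib sum.delta cong: if_cong)
    then show "y \<in> span ((\<lambda>i. axis i 1) ` (- S))"
      by (simp only:) (intro span_sum span_scale span_base imageI)
  qed
  ultimately have "card (Pr ` W) \<le> card ((\<lambda>i. axis i (1::real)) ` (- S))"
    using independent_span_bound[of "(\<lambda>i. axis i (1::real)) ` (- S)" "Pr ` W"] by simp
  also have "\<dots> \<le> card (- S)" by (rule card_image_le) simp
  finally show ?thesis
    using card_image[OF inj_on_subset[OF inj span_superset]] by simp
qed

lemma pinner_Compl: "pinner (- S) x y = - pinner S x y"
  unfolding pinner_def sum_negf[symmetric] by (rule sum.cong) auto

lemma card_negative_le: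
  fixes S :: "'n::finite set"
  assumes "finite W" "pairwise (\<lambda>v w. pinner S v w = 0) W" "\<And>w. w \<in> W \<Longrightarrow> pinner S w w < 0"
  shows "card W \<le> card S"
  using card_positive_le[of W "- S"] assms by (simp add: pinner_Compl)

text \<open>A vector orthogonal to \<open>W\<close> exists for dimensional reasons. If it were null,
  it would lie outside the span of \<open>W\<close> and complete it to a basis, hence be orthogonal
  to everything, against nondegeneracy.\<close>

lemma orthogonal_vector_exists:
  fixes W :: "(real^'n::finite) set"
  assumes W: "finite W" "pairwise (\<lambda>v w. pinner S v w = 0) W" "\<And>w. w \<in> W \<Longrightarrow> pinner S w w \<noteq> 0"
    and card: "Suc (card W) = CARD('n)"
  obtains x where "pinner S x x \<noteq> 0" "\<And>w. w \<in> W \<Longrightarrow> pinner S x w = 0"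
proof -
  have ind: "independent W" by (rule independent_orthogonal[OF W])
  then have "dim W = card W" by (rule dim_eq_card_independent)
  then have "dim W < DIM(real^'n)" using card by simp
  then obtain y where y: "y \<noteq> 0" "\<And>w. w \<in> span W \<Longrightarrow> orthogonal y w"
    using orthogonal_to_subspace_exists by blast
  define x where "x = (\<chi> i. (if i \<in> S then - 1 else 1) * y $ i)"
  have xy: "pinner S x w = y \<bullet> w" for w
    unfolding x_def pinner_eq_inner inner_vec_def by (rule sum.cong) auto
  have x0: "pinner S x w = 0" if "w \<in> W" for w
    using y(2)[OF span_base[OF that]] by (simp add: xy orthogonal_def)
  have xn: "x \<noteq> 0" using xy[of y] y(1) by (auto simp: pinner_simps)
  have "pinner S x x \<noteq> 0"
  proof
    assume xx: "pinner S x x = 0"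
    have nin: "x \<notin> span W"
    proof
      assume "x \<in> span W"
      then obtain c where c: "x = (\<Sum>v\<in>W. c v *\<^sub>R v)" using span_finite[OF W(1)] by auto
      have "c w = 0" if "w \<in> W" for w
        using pinner_sum_orthogonal[OF W(1,2) that, of c] x0[OF that] W(3)[OF that] c by simp
      then show False using xn c by simp
    qed
    then have "independent (insert x W)" using ind by (simp add: independent_insert)
    moreover have "card (insert x W) = CARD('n)"
      using card W(1) nin span_base[of x W] by (subst card_insert_disjoint) auto
    ultimately have sp: "span (insert x W) = UNIV"
      using card_ge_dim_independent[of "insert x W" UNIV] by (auto simp: dim_UNIV)
    have "pinner S x z = 0" if "z \<in> span (insert x W)" for z
      using that
    proof (induction rule: span_induct)
      case base
      show ?case
        by (auto simp: subspace_def pinner_simps)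
    next
      case (step z)
      then show ?case using x0 xx by auto
    qed
    then show False using xn pinner_nondegenerate[of S x] sp by auto
  qed
  then show ?thesis using x0 that by blast
qed

section \<open>Surfaces whose first normal space is a parallel line\<close>

text \<open>In the situation of the theorem the second fundamental form takes its values in the line spanned
  by \<open>A\<close>, whose square is the constant \<open>d\<close>, and \<open>A\<close> is parallel in the normal bundle. The equations
  below are the Gauss and Weingarten formulas in null directions.\<close>

definition adapted_on ::
  "real \<Rightarrow> real \<Rightarrow> real \<Rightarrow> paracomplex set \<Rightarrow> (paracomplex \<Rightarrow> real) \<Rightarrow>
   (paracomplex \<Rightarrow> real^'n::finite) \<Rightarrow> (paracomplex \<Rightarrow> real^'n) \<Rightarrow> bool"
  where "adapted_on L0 d eps U lam f A \<longleftrightarrow>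
    smooth_on U lam \<and> smooth_on U f \<and> smooth_on U A \<and>
    (\<forall>p\<in>U. d_p (d_p f) p = (2 * d_p lam p) *\<^sub>R d_p f p + 2 *\<^sub>R A p \<and>
      d_m (d_p f) p = - (2 * L0 * exp (2 * lam p)) *\<^sub>R f p \<and>
      d_m (d_m f) p = (2 * d_m lam p) *\<^sub>R d_m f p + (2 * eps / d) *\<^sub>R A p \<and>
      d_p A p = - (d * exp (- 2 * lam p)) *\<^sub>R d_m f p \<and>
      d_m A p = - (eps * exp (- 2 * lam p)) *\<^sub>R d_p f p)"

lemma adapted_on_smooth:
  assumes "adapted_on L0 d eps U lam f A"
  shows "smooth_on U lam" "smooth_on U f" "smooth_on U A"
  using assms by (simp_all add: adapted_on_def)

lemma adapted_on_eqs:
  assumes f: "adapted_on L0 d eps U lam f A" and U: "open U" "p \<in> U"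
  shows "d_p (d_p f) p = (2 * d_p lam p) *\<^sub>R d_p f p + 2 *\<^sub>R A p"
    "d_m (d_p f) p = - (2 * L0 * exp (2 * lam p)) *\<^sub>R f p"
    "d_p (d_m f) p = - (2 * L0 * exp (2 * lam p)) *\<^sub>R f p"
    "d_m (d_m f) p = (2 * d_m lam p) *\<^sub>R d_m f p + (2 * eps / d) *\<^sub>R A p"
    "d_p A p = - (d * exp (- 2 * lam p)) *\<^sub>R d_m f p"
    "d_m A p = - (eps * exp (- 2 * lam p)) *\<^sub>R d_p f p"
proof -
  show *: "d_p (d_p f) p = (2 * d_p lam p) *\<^sub>R d_p f p + 2 *\<^sub>R A p"
    "d_m (d_p f) p = - (2 * L0 * exp (2 * lam p)) *\<^sub>R f p"
    "d_m (d_m f) p = (2 * d_m lam p) *\<^sub>R d_m f p + (2 * eps / d) *\<^sub>R A p"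
    "d_p A p = - (d * exp (- 2 * lam p)) *\<^sub>R d_m f p"
    "d_m A p = - (eps * exp (- 2 * lam p)) *\<^sub>R d_p f p"
    using f[unfolded adapted_on_def] U(2) by blast+
  show "d_p (d_m f) p = - (2 * L0 * exp (2 * lam p)) *\<^sub>R f p"
    unfolding *(2)[symmetric] by (rule symmetric_dirder[OF U adapted_on_smooth(2)[OF f]])
qed

lemma adapted_on_differentiable:
  assumes f: "adapted_on L0 d eps U lam f A" and p: "p \<in> U"
  shows "lam differentiable (at p)" "dirder lam e differentiable (at p)" "f differentiable (at p)"
    "dirder f e differentiable (at p)" "A differentiable (at p)"
  using adapted_on_smooth[OF f] p by (auto intro!: smooth_on_differentiable smooth_on_dirder)

text \<open>Apart from the term of the fifth frame vector, this is the linear map that carries the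
  moving frame of one solution to that of another. The missing term belongs to the constant normal
  vector and is added where it is needed.\<close>

definition frame_map ::
  "'n::finite set \<Rightarrow> real \<Rightarrow> real \<Rightarrow> (paracomplex \<Rightarrow> real) \<Rightarrow>
   (paracomplex \<Rightarrow> real^'n) \<Rightarrow> (paracomplex \<Rightarrow> real^'n) \<Rightarrow>
   (paracomplex \<Rightarrow> real^'n) \<Rightarrow> (paracomplex \<Rightarrow> real^'n) \<Rightarrow> paracomplex \<Rightarrow> real^'n \<Rightarrow> real^'n"
  where "frame_map S L0 d lam f A f' A' p x =
    (L0 * pinner S (f p) x) *\<^sub>R f' p
    + (1 / 2 * exp (- 2 * lam p)) *\<^sub>R (pinner S (d_p f p) x *\<^sub>R d_m f' p + pinner S (d_m f p) x *\<^sub>R d_p f' p)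
    + (1 / d * pinner S (A p) x) *\<^sub>R A' p"

lemma constant_of_null_derivatives:
  fixes g :: "paracomplex \<Rightarrow> 'b::real_normed_vector"
  assumes U: "open U" "connected U" and g: "smooth_on U g"
    and 0: "\<And>p. p \<in> U \<Longrightarrow> d_p g p = 0" "\<And>p. p \<in> U \<Longrightarrow> d_m g p = 0"
    and pq: "p \<in> U" "q \<in> U"
  shows "g p = g q"
proof (rule has_derivative_zero_unique_connected[OF U _ pq])
  fix x assume x: "x \<in> U"
  have "(\<lambda>e. dirder g e x) = (\<lambda>_. 0)"
    using dirder_null[OF smooth_on_differentiable[OF g x]] 0[OF x] by (intro ext) simp
  then show "(g has_derivative (\<lambda>_. 0)) (at x)"
    using smooth_on_has_derivative[OF g x] by simp
qed

lemma exp_cancel: "exp (2 * x) * exp (- 2 * x) = (1::real)"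
  by (simp flip: exp_add)

text \<open>The derivatives of the coefficient \<open>exp (- 2 * lam p)\<close> cancel the terms
  with derivatives of \<open>lam\<close>; the position terms cancel against the mixed derivatives;
  the terms with \<open>A\<close> from the second derivatives cancel against the Weingarten
  equations. This is the fact that the connection preserves the metric, expressed in a
  frame.\<close>

lemma frame_map_constant:
  fixes f f' A A' :: "paracomplex \<Rightarrow> real^'n::finite"
  assumes U: "open U" "connected U" and d: "d \<noteq> 0"
    and f: "adapted_on L0 d eps U lam f A" and f': "adapted_on L0 d eps U lam f' A'"
    and pq: "p \<in> U" "q \<in> U"
  shows "frame_map S L0 d lam f A f' A' p x = frame_map S L0 d lam f A f' A' q x"
proof (rule constant_of_null_derivatives[OF U _ _ _ pq])
  show smooth: "smooth_on U (\<lambda>p. frame_map S L0 d lam f A f' A' p x)"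
    unfolding frame_map_def
    by (intro smooth_on_intros smooth_on_pinner U adapted_on_smooth[OF f] adapted_on_smooth[OF f'])
  fix p assume p: "p \<in> U"
  note eqs = adapted_on_eqs[OF f U(1) p] adapted_on_eqs[OF f' U(1) p]
  note df = adapted_on_differentiable[OF f p] adapted_on_differentiable[OF f' p]
  define e ei where "e = exp (2 * lam p)" and "ei = exp (- (2 * lam p))"
  have ei: "ei = 1 / e" "e \<noteq> 0"
    using exp_cancel[of "lam p"] by (auto simp: e_def ei_def field_simps)
  show "d_p (\<lambda>p. frame_map S L0 d lam f A f' A' p x) p = 0"
    unfolding frame_map_def
    apply (simp add: df eqs pinner_simps)
    apply (simp add: ei(1) flip: e_def ei_def)
    apply (simp add: vec_eq_iff)
    apply (simp add: field_simps ei(2) d)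
    done
  show "d_m (\<lambda>p. frame_map S L0 d lam f A f' A' p x) p = 0"
    unfolding frame_map_def
    apply (simp add: df eqs pinner_simps)
    apply (simp add: ei(1) flip: e_def ei_def)
    apply (simp add: vec_eq_iff)
    apply (simp add: field_simps ei(2) d)
    done
qed

lemma frame_sum_eq_frame_map:
  "frame_sum S L0 (exp (2 * lam p)) d (f p) (d_p f p) (d_m f p) (A p) C x
    = frame_map S L0 d lam f A f A p x - (pinner S C x / d) *\<^sub>R C"
proof -
  have "1 / (2 * exp (2 * lam p)) = exp (- 2 * lam p) / 2"
    using exp_cancel[of "lam p"] by (simp add: field_simps)
  then have *: "a / (2 * exp (2 * lam p)) = exp (- 2 * lam p) / 2 * a" for a
    by (metis divide_inverse mult.commute mult_1)
  show ?thesis unfolding frame_sum_def frame_map_def * by (simp add: scaleR_right_distrib)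
qed

text \<open>Applied to one solution twice, the constant tensor together with the fixed
  \<open>C\<close> is the frame expansion, so an expansion that is the identity at one point is the
  identity everywhere.\<close>

lemma frame_gram_propagates:
  fixes S :: "'n::finite set"
  assumes dim: "CARD('n) = (if L0 = 0 then 4 else 5)" and U: "open U" "connected U" and d: "d \<noteq> 0"
    and f: "adapted_on L0 d eps U lam f A" and p0: "p0 \<in> U"
    and gram: "frame_gram S L0 (exp (2 * lam p0)) d (f p0) (d_p f p0) (d_m f p0) (A p0) C"
    and p: "p \<in> U"
  shows "frame_gram S L0 (exp (2 * lam p)) d (f p) (d_p f p) (d_m f p) (A p) C"
proof -
  have "frame_sum S L0 (exp (2 * lam p)) d (f p) (d_p f p) (d_m f p) (A p) C x
    = frame_sum S L0 (exp (2 * lam p0)) d (f p0) (d_p f p0) (d_m f p0) (A p0) C x" for x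
    unfolding frame_sum_eq_frame_map using frame_map_constant[OF U d f f p p0] by simp
  then show ?thesis using gram by (simp add: frame_gram_iff[OF dim _ d])
qed

section \<open>The associated functions\<close>

lemma dirder_pm_coords:
  fixes g :: "paracomplex \<Rightarrow> 'b::real_normed_vector"
  assumes "g differentiable (at p)"
  shows "d_p g p = d_u g p + d_v g p" "d_m g p = d_u g p - d_v g p"
    "d_u g p = (1/2) *\<^sub>R (d_p g p + d_m g p)" "d_v g p = (1/2) *\<^sub>R (d_p g p - d_m g p)"
proof -
  show "d_p g p = d_u g p + d_v g p" "d_m g p = d_u g p - d_v g p"
    using dirder_coords[OF assms, of "(1, 1)"] dirder_coords[OF assms, of "(1, -1)"] by simp_all
  show "d_u g p = (1/2) *\<^sub>R (d_p g p + d_m g p)" "d_v g p = (1/2) *\<^sub>R (d_p g p - d_m g p)"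
    using dirder_null[OF assms, of "(1, 0)"] dirder_null[OF assms, of "(0, 1)"]
    by (simp_all add: scaleR_right_diff_distrib scaleR_right_distrib)
qed

lemma second_dirder_coords:
  fixes f :: "paracomplex \<Rightarrow> 'b::euclidean_space"
  assumes U: "open U" "p \<in> U" and f: "smooth_on U f"
  shows "d_u (d_u f) p = (1/4) *\<^sub>R (d_p (d_p f) p + 2 *\<^sub>R d_m (d_p f) p + d_m (d_m f) p)"
    "d_u (d_v f) p = (1/4) *\<^sub>R (d_p (d_p f) p - d_m (d_m f) p)"
    "d_v (d_u f) p = (1/4) *\<^sub>R (d_p (d_p f) p - d_m (d_m f) p)"
    "d_v (d_v f) p = (1/4) *\<^sub>R (d_p (d_p f) p - 2 *\<^sub>R d_m (d_p f) p + d_m (d_m f) p)"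
proof -
  have df: "f differentiable (at q)" "dirder f e differentiable (at q)" if "q \<in> U" for q e
    using f that by (auto intro!: smooth_on_differentiable smooth_on_dirder)
  have u: "dirder (d_u f) e p = (1/2) *\<^sub>R (dirder (d_p f) e p + dirder (d_m f) e p)" for e
    by (subst dirder_cong_open[OF U dirder_pm_coords(3)[OF df(1)]], assumption) (use df U in simp)
  have v: "dirder (d_v f) e p = (1/2) *\<^sub>R (dirder (d_p f) e p - dirder (d_m f) e p)" for e
    by (subst dirder_cong_open[OF U dirder_pm_coords(4)[OF df(1)]], assumption) (use df U in simp)
  have s: "d_p (d_m f) p = d_m (d_p f) p" by (rule symmetric_dirder[OF U f])
  have 2: "2 *\<^sub>R x = x + x" for x :: 'b by (simp add: scaleR_2)
  show "d_u (d_u f) p = (1/4) *\<^sub>R (d_p (d_p f) p + 2 *\<^sub>R d_m (d_p f) p + d_m (d_m f) p)"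
    "d_u (d_v f) p = (1/4) *\<^sub>R (d_p (d_p f) p - d_m (d_m f) p)"
    "d_v (d_u f) p = (1/4) *\<^sub>R (d_p (d_p f) p - d_m (d_m f) p)"
    "d_v (d_v f) p = (1/4) *\<^sub>R (d_p (d_p f) p - 2 *\<^sub>R d_m (d_p f) p + d_m (d_m f) p)"
    unfolding dirder_pm_coords(3,4)[OF df(2)[OF U(2)]] u v s 2
    by (simp_all add: algebra_simps)
qed

text \<open>With \<open>a = ep * exp Pp\<close>, \<open>b = em * exp Pm\<close> and \<open>d = ep * em * exp (- c)\<close> the equations
  for the associated functions become polynomial.\<close>

definition star_rep ::
  "paracomplex set \<Rightarrow> real \<Rightarrow> real \<Rightarrow> (paracomplex \<Rightarrow> real) \<Rightarrow>
   (paracomplex \<Rightarrow> real) \<Rightarrow> (paracomplex \<Rightarrow> real) \<Rightarrow> (paracomplex \<Rightarrow> real) \<Rightarrow>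
   (paracomplex \<Rightarrow> real) \<Rightarrow> (paracomplex \<Rightarrow> real) \<Rightarrow> (paracomplex \<Rightarrow> real) \<Rightarrow>
   (paracomplex \<Rightarrow> real) \<Rightarrow> (paracomplex \<Rightarrow> real) \<Rightarrow> bool"
  where "star_rep U d k lam a1 a2 b1 b2 m1 m2 a b \<longleftrightarrow>
    smooth_on U a \<and> smooth_on U b \<and>
    (\<forall>p\<in>U. a p * b p = d * exp (- 2 * lam p) \<and>
      a1 p = (1 + k) / 4 * (a p + b p) \<and> a2 p = (1 - k) / 4 * (a p + b p) \<and>
      b1 p = (1 + k) / 4 * (a p - b p) \<and> b2 p = (1 - k) / 4 * (a p - b p) \<and>
      d_u a p = - (d_u lam p + m1 p) * a p \<and> d_u b p = - (d_u lam p - m1 p) * b p \<and>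
      d_v a p = - (d_v lam p + m2 p) * a p \<and> d_v b p = - (d_v lam p - m2 p) * b p)"

lemma star_rep_if_double_star:
  assumes U: "open U" and lam: "smooth_on U lam" and eps: "eps \<in> {1, -1}"
    and ds: "double_star_on U eps lam a1 a2 b1 b2 m1 m2"
  obtains d a b where "d \<noteq> 0" "star_rep U d (eps / d) lam a1 a2 b1 b2 m1 m2 a b"
proof -
  obtain Pp Pm Qp Qm :: "paracomplex \<Rightarrow> real" and c ep em :: real where
    H: "ep \<in> {1, -1} \<and> em \<in> {1, -1} \<and>
      smooth_on U Pp \<and> smooth_on U Pm \<and> smooth_on U Qp \<and> smooth_on U Qm \<and>
      (\<forall>p\<in>U. - 2 * lam p = Pp p + Qp p \<and> - 2 * lam p = Pm p + Qm p \<and>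
           Qm p = Pp p + c \<and> Qp p = Pm p + c \<and>
           m1 p = 1 / (2 * sqrt 2) * (d_s (\<lambda>q. Qp q - Qm q) p - d_t (\<lambda>q. Pp q - Pm q) p) \<and>
           m2 p = 1 / (2 * sqrt 2) * (d_s (\<lambda>q. Qp q - Qm q) p + d_t (\<lambda>q. Pp q - Pm q) p) \<and>
           a1 p = 1 / 2 * (ep / 2 * (exp (Pp p) + eps * exp (Qp p)) + em / 2 * (exp (Pm p) + eps * exp (Qm p))) \<and>
           a2 p = 1 / 2 * (ep / 2 * (exp (Pp p) - eps * exp (Qp p)) + em / 2 * (exp (Pm p) - eps * exp (Qm p))) \<and>
           b1 p = 1 / 2 * (ep / 2 * (exp (Pp p) - eps * exp (Qp p)) - em / 2 * (exp (Pm p) - eps * exp (Qm p))) \<and>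
           b2 p = 1 / 2 * (ep / 2 * (exp (Pp p) + eps * exp (Qp p)) - em / 2 * (exp (Pm p) + eps * exp (Qm p))))"
    using ds unfolding double_star_on_def Let_def by (elim exE) (rule that)
  then have e: "ep \<in> {1, -1}" "em \<in> {1, -1}"
    and sm: "smooth_on U Pp" "smooth_on U Pm" "smooth_on U Qp" "smooth_on U Qm" by simp_all
  note eqs = H[THEN conjunct2, THEN conjunct2, THEN conjunct2, THEN conjunct2, THEN conjunct2, THEN conjunct2, THEN bspec]
  \<comment> \<open>From \<open>Qp = Pm + c\<close> follows Pp + Pm = - 2 lam - c, so this is the
    constant by which the product of \<open>a\<close> and \<open>b\<close> differs from exp (- 2
    lam).\<close>
  define d where "d = ep * em * exp (- c)"
  define a where "a p = ep * exp (Pp p)" for p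
  define b where "b p = em * exp (Pm p)" for p
  have e0: "ep * ep = 1" "em * em = 1" using e by auto
  have d: "d \<noteq> 0" using e by (auto simp: d_def)
  have k: "eps / d = eps * ep * em * exp c"
    using e by (auto simp: d_def exp_minus divide_inverse)
  have "star_rep U d (eps / d) lam a1 a2 b1 b2 m1 m2 a b"
    unfolding star_rep_def
  proof (intro conjI ballI)
    show "smooth_on U a" "smooth_on U b" unfolding a_def[abs_def] b_def[abs_def]
      by (intro smooth_on_intros U sm)+
    fix p assume p: "p \<in> U"
    have df: "Pp differentiable (at p)" "Pm differentiable (at p)" "lam differentiable (at p)"
      using sm lam p by (auto intro: smooth_on_differentiable)
    have "Pp p + Pm p = - 2 * lam p + (- c)" using eqs[OF p] by linarith
    then have "exp (Pp p) * exp (Pm p) = exp (- 2 * lam p) * exp (- c)"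
      by (simp only: exp_add[symmetric])
    then show "a p * b p = d * exp (- 2 * lam p)"
      by (simp add: a_def b_def d_def)
    \<comment> \<open>Eliminating the Q functions exchanges the suffixes: up to the factor 1 / d,
      the Q exponential with one suffix is the P exponential with the other.\<close>
    have Q: "ep * exp (Qp p) = ep * em * exp c * b p" "em * exp (Qm p) = ep * em * exp c * a p"
      using eqs[OF p] e0 by (auto simp: a_def b_def exp_add)
    have h: "ep / 2 * (x + eps * y) = (ep * x + eps * (ep * y)) / 2" "ep / 2 * (x - eps * y) = (ep * x - eps * (ep * y)) / 2"
      "em / 2 * (x + eps * y) = (em * x + eps * (em * y)) / 2" "em / 2 * (x - eps * y) = (em * x - eps * (em * y)) / 2" for x y
      by (simp_all add: field_simps)
    show "a1 p = (1 + eps / d) / 4 * (a p + b p)" "a2 p = (1 - eps / d) / 4 * (a p + b p)"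
      "b1 p = (1 + eps / d) / 4 * (a p - b p)" "b2 p = (1 - eps / d) / 4 * (a p - b p)"
      using eqs[OF p] unfolding h Q a_def[symmetric] b_def[symmetric] k
      by (simp_all add: field_simps)
    have lamc: "dirder (\<lambda>q. - 2 * lam q) X p = dirder (\<lambda>q. Pp q + Pm q + c) X p" for X
      by (rule dirder_cong_open[OF U p]) (use eqs in force)
    then have lamX: "- 2 * dirder lam X p = dirder Pp X p + dirder Pm X p" for X
      using df by simp
    \<comment> \<open>Both derivatives in the formulas for \<open>m1\<close> and \<open>m2\<close>
      thus concern the same function Pm - Pp up to sign, and the s and t derivatives recombine to u
      and v derivatives.\<close>
    have Qd: "d_s (\<lambda>q. Qp q - Qm q) p = d_s (\<lambda>q. Pm q - Pp q) p"
      by (rule dirder_cong_open[OF U p]) (use eqs in force)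
    have ds: "d_s (\<lambda>q. Qp q - Qm q) p = (1 / sqrt 2) * ((d_u Pm p - d_u Pp p) + (d_v Pm p - d_v Pp p))"
      unfolding Qd using df dirder_coords[OF df(1), of "(1 / sqrt 2, 1 / sqrt 2)"]
        dirder_coords[OF df(2), of "(1 / sqrt 2, 1 / sqrt 2)"]
      by (simp add: field_simps)
    have dt: "d_t (\<lambda>q. Pp q - Pm q) p = (1 / sqrt 2) * ((d_u Pp p - d_u Pm p) - (d_v Pp p - d_v Pm p))"
      using df dirder_coords[OF df(1), of "(1 / sqrt 2, - (1 / sqrt 2))"]
        dirder_coords[OF df(2), of "(1 / sqrt 2, - (1 / sqrt 2))"]
      by (simp add: field_simps)
    have sq: "1 / (2 * sqrt 2) * (1 / sqrt 2 * x - 1 / sqrt 2 * y) = (x - y) / 4"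
      "1 / (2 * sqrt 2) * (1 / sqrt 2 * x + 1 / sqrt 2 * y) = (x + y) / 4" for x y :: real
      by (simp_all add: field_simps)
    have m: "m1 p = (d_u Pm p - d_u Pp p) / 2" "m2 p = (d_v Pm p - d_v Pp p) / 2"
    proof -
      have "m1 p = 1 / (2 * sqrt 2) * (d_s (\<lambda>q. Qp q - Qm q) p - d_t (\<lambda>q. Pp q - Pm q) p)"
        "m2 p = 1 / (2 * sqrt 2) * (d_s (\<lambda>q. Qp q - Qm q) p + d_t (\<lambda>q. Pp q - Pm q) p)"
        using eqs[OF p] by blast+
      then show "m1 p = (d_u Pm p - d_u Pp p) / 2" "m2 p = (d_v Pm p - d_v Pp p) / 2"
        unfolding ds dt sq by simp_all
    qed
    have P: "dirder Pp (1, 0) p = - (d_u lam p + m1 p)" "dirder Pm (1, 0) p = - (d_u lam p - m1 p)"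
      "dirder Pp (0, 1) p = - (d_v lam p + m2 p)" "dirder Pm (0, 1) p = - (d_v lam p - m2 p)"
      unfolding m using lamX[of "(1, 0)"] lamX[of "(0, 1)"] by (simp_all add: field_simps)
    show "d_u a p = - (d_u lam p + m1 p) * a p" "d_u b p = - (d_u lam p - m1 p) * b p"
      "d_v a p = - (d_v lam p + m2 p) * a p" "d_v b p = - (d_v lam p - m2 p) * b p"
      unfolding a_def[abs_def] b_def[abs_def] using df by (simp_all add: P)
  qed
  then show ?thesis using d that by blast
qed

lemma associated_functions_if_adapted:
  fixes S :: "'n::finite set"
  assumes U: "open U" and d: "d \<noteq> 0" and f: "adapted_on L0 d eps U lam f A"
    and gram: "\<And>p. p \<in> U \<Longrightarrow> frame_gram S L0 (exp (2 * lam p)) d (f p) (d_p f p) (d_m f p) (A p) C"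
    and rep: "star_rep U d (eps / d) lam a1 a2 b1 b2 m1 m2 a b"
  shows "associated_functions_on S L0 U f lam a1 a2 b1 b2 m1 m2"
proof -
  have ab0: "a p \<noteq> 0" "b p \<noteq> 0" if "p \<in> U" for p
    using rep d that unfolding star_rep_def by (metis exp_not_eq_zero mult_eq_0_iff)+
  \<comment> \<open>The vectors A + C and A - C are null with product 2 d = 2 a b exp (2 lam).
    Divided by \<open>a\<close> and \<open>b\<close> they become null normals with product 2 exp (2
    lam), and these are to be N1 + N2 and N1 - N2.\<close>
  define N1 where "N1 p = (1/2) *\<^sub>R (inverse (a p) *\<^sub>R (A p + C) + inverse (b p) *\<^sub>R (A p - C))" for p
  define N2 where "N2 p = (1/2) *\<^sub>R (inverse (a p) *\<^sub>R (A p + C) - inverse (b p) *\<^sub>R (A p - C))" for p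
  have sab: "smooth_on U a" "smooth_on U b" using rep by (simp_all add: star_rep_def)
  have smooth: "smooth_on U N1" "smooth_on U N2"
    unfolding N1_def[abs_def] N2_def[abs_def]
    by (intro smooth_on_intros U adapted_on_smooth[OF f] smooth_on_inverse_comp sab ab0, assumption+)+
  show ?thesis
    unfolding associated_functions_on_def normal_frame_on_def
  proof (rule exI[of _ N1], rule exI[of _ N2], intro conjI smooth ballI)
    fix p assume p: "p \<in> U"
    note eqs = adapted_on_eqs[OF f U p] and df = adapted_on_differentiable[OF f p]
    note r = rep[unfolded star_rep_def, THEN conjunct2, THEN conjunct2, THEN bspec, OF p]
    note g = gram[OF p, unfolded frame_gram_def]
    define e where "e = exp (2 * lam p)"
    have ei: "exp (- 2 * lam p) = 1 / e" "e \<noteq> 0"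
      using exp_cancel[of "lam p"] by (auto simp: e_def field_simps)
    have dab: "d = a p * b p * e" using r ei by (simp add: field_simps)
    note nz = ab0[OF p] ei(2)
    have c: "pinner S (d_p f p) (A p) = 0" "pinner S (d_m f p) (A p) = 0" "pinner S (d_p f p) C = 0"
      "pinner S (d_m f p) C = 0" "pinner S C (A p) = 0"
      using g pinner_commute[of S "A p" "d_p f p"] pinner_commute[of S "A p" "d_m f p"]
        pinner_commute[of S C "d_p f p"] pinner_commute[of S C "d_m f p"] pinner_commute[of S C "A p"] by simp_all
    have pr: "L0 * pinner S (w *\<^sub>R f p + z *\<^sub>R d_p f p + z' *\<^sub>R d_m f p + y *\<^sub>R A p + y' *\<^sub>R C) (f p)
        = (if L0 = 0 then 0 else w)" for w z z' y y'
      using g by (auto simp: pinner_simps distrib_left)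
    show n: "N1 p \<in> normal_space S L0 f p" "N2 p \<in> normal_space S L0 f p"
      using g unfolding normal_space_def dirder_pm_coords(3,4)[OF df(3)] N1_def N2_def
      by (auto simp: tangent_sf_def pinner_simps)
    have AC: "pinner S (A p) (A p) = a p * b p * e" "pinner S C C = - (a p * b p * e)"
      using g dab by simp_all
    show "pinner S (N1 p) (N1 p) = exp (2 * lam p)" "pinner S (N2 p) (N2 p) = - exp (2 * lam p)"
      "pinner S (N1 p) (N2 p) = 0"
      unfolding e_def[symmetric] N1_def N2_def using g nz
      by (simp_all add: pinner_simps c AC) (simp_all add: field_simps)
    have ia: "(\<lambda>q. inverse (a q)) differentiable (at p)" "(\<lambda>q. inverse (b q)) differentiable (at p)"
      using smooth_on_differentiable[OF smooth_on_inverse_comp[OF U sab(1) ab0(1)] p]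
        smooth_on_differentiable[OF smooth_on_inverse_comp[OF U sab(2) ab0(2)] p] by auto
    have dinv: "dirder (\<lambda>q. inverse (h q)) X p = - dirder h X p / (h p * h p)"
      if "smooth_on U h" "h p \<noteq> 0" for h :: "paracomplex \<Rightarrow> real" and X
    proof -
      have "((\<lambda>q. inverse (h q)) has_derivative (\<lambda>X. - (inverse (h p) * dirder h X p * inverse (h p)))) (at p)"
        by (rule Deriv.has_derivative_inverse[OF that(2) smooth_on_has_derivative[OF that(1) p]])
      from dirder_eqI[OF this] show ?thesis using that(2) by (simp add: field_simps)
    qed
    have dN1: "dirder N1 X p = (1/2) *\<^sub>R (inverse (a p) *\<^sub>R dirder A X p + (- dirder a X p / (a p * a p)) *\<^sub>R (A p + C)
        + inverse (b p) *\<^sub>R dirder A X p + (- dirder b X p / (b p * b p)) *\<^sub>R (A p - C))" for X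
      unfolding N1_def[abs_def] using df ia by (simp add: dinv[OF sab(1) ab0(1)[OF p]] dinv[OF sab(2) ab0(2)[OF p]])
    have dN2: "dirder N2 X p = (1/2) *\<^sub>R (inverse (a p) *\<^sub>R dirder A X p + (- dirder a X p / (a p * a p)) *\<^sub>R (A p + C)
        - inverse (b p) *\<^sub>R dirder A X p - (- dirder b X p / (b p * b p)) *\<^sub>R (A p - C))" for X
      unfolding N2_def[abs_def] using df ia by (simp add: dinv[OF sab(1) ab0(1)[OF p]] dinv[OF sab(2) ab0(2)[OF p]])
    \<comment> \<open>Every derivative below is expanded in the frame; the covariant derivative is
      then obtained by deleting the position term.\<close>
    have cov0: "cov S L0 f X W p = z *\<^sub>R d_p f p + z' *\<^sub>R d_m f p + y *\<^sub>R A p + y' *\<^sub>R C"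
      if "dirder W X p = (L0 * w) *\<^sub>R f p + z *\<^sub>R d_p f p + z' *\<^sub>R d_m f p + y *\<^sub>R A p + y' *\<^sub>R C" for W X w z z' y y'
      unfolding cov_def that pr by auto
    let ?k = "eps / d" and ?lp = "d_p lam p" and ?lm = "d_m lam p"
    \<comment> \<open>The position coefficient comes from the mixed null derivative - 2 L0 e f,
      which enters the second derivative in u with weight 1/2, the one in v with weight - 1/2, and
      the mixed ones not at all.\<close>
    have c11: "cov S L0 f (1, 0) (d_u f) p = (?lp / 2) *\<^sub>R d_p f p + (?lm / 2) *\<^sub>R d_m f p + ((1 + ?k) / 2) *\<^sub>R A p + 0 *\<^sub>R C"
      by (rule cov0[where w = "- e"], unfold second_dirder_coords[OF U p adapted_on_smooth(2)[OF f]] eqs e_def[symmetric])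
        (simp add: vec_eq_iff, simp add: field_simps)
    have c12: "cov S L0 f (1, 0) (d_v f) p = (?lp / 2) *\<^sub>R d_p f p + (- ?lm / 2) *\<^sub>R d_m f p + ((1 - ?k) / 2) *\<^sub>R A p + 0 *\<^sub>R C"
      by (rule cov0[where w = 0], unfold second_dirder_coords[OF U p adapted_on_smooth(2)[OF f]] eqs e_def[symmetric])
        (simp add: vec_eq_iff, simp add: field_simps)
    have c21: "cov S L0 f (0, 1) (d_u f) p = (?lp / 2) *\<^sub>R d_p f p + (- ?lm / 2) *\<^sub>R d_m f p + ((1 - ?k) / 2) *\<^sub>R A p + 0 *\<^sub>R C"
      by (rule cov0[where w = 0], unfold second_dirder_coords[OF U p adapted_on_smooth(2)[OF f]] eqs e_def[symmetric])
        (simp add: vec_eq_iff, simp add: field_simps)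
    have c22: "cov S L0 f (0, 1) (d_v f) p = (?lp / 2) *\<^sub>R d_p f p + (?lm / 2) *\<^sub>R d_m f p + ((1 + ?k) / 2) *\<^sub>R A p + 0 *\<^sub>R C"
      by (rule cov0[where w = e], unfold second_dirder_coords[OF U p adapted_on_smooth(2)[OF f]] eqs e_def[symmetric])
        (simp add: vec_eq_iff, simp add: field_simps)
    have dA: "d_u A p = (- (eps / e) / 2) *\<^sub>R d_p f p + (- (a p * b p) / 2) *\<^sub>R d_m f p"
      "d_v A p = (eps / e / 2) *\<^sub>R d_p f p + (- (a p * b p) / 2) *\<^sub>R d_m f p"
      unfolding dirder_pm_coords(3,4)[OF df(5)] eqs ei using nz
      by (simp_all add: dab vec_eq_iff)
    have rd: "d_u a p = - (d_u lam p + m1 p) * a p" "d_u b p = - (d_u lam p - m1 p) * b p"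
      "d_v a p = - (d_v lam p + m2 p) * a p" "d_v b p = - (d_v lam p - m2 p) * b p" using r by blast+
    define s1 s2 where "s1 = (inverse (a p) + inverse (b p)) / 2" and "s2 = (inverse (a p) - inverse (b p)) / 2"
    have cN1: "cov S L0 f (1, 0) N1 p = (s1 * (- (eps / e) / 2)) *\<^sub>R d_p f p + (s1 * (- (a p * b p) / 2)) *\<^sub>R d_m f p
        + ((d_u lam p + m1 p) * inverse (a p) / 2 + (d_u lam p - m1 p) * inverse (b p) / 2) *\<^sub>R A p
        + ((d_u lam p + m1 p) * inverse (a p) / 2 - (d_u lam p - m1 p) * inverse (b p) / 2) *\<^sub>R C"
      by (rule cov0[where w = 0]) (use nz in \<open>simp add: dN1 dA rd s1_def vec_eq_iff, simp add: field_simps\<close>)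
    have cN2: "cov S L0 f (1, 0) N2 p = (s2 * (- (eps / e) / 2)) *\<^sub>R d_p f p + (s2 * (- (a p * b p) / 2)) *\<^sub>R d_m f p
        + ((d_u lam p + m1 p) * inverse (a p) / 2 - (d_u lam p - m1 p) * inverse (b p) / 2) *\<^sub>R A p
        + ((d_u lam p + m1 p) * inverse (a p) / 2 + (d_u lam p - m1 p) * inverse (b p) / 2) *\<^sub>R C"
      by (rule cov0[where w = 0]) (use nz in \<open>simp add: dN2 dA rd s2_def vec_eq_iff, simp add: field_simps\<close>)
    have cM1: "cov S L0 f (0, 1) N1 p = (s1 * (eps / e / 2)) *\<^sub>R d_p f p + (s1 * (- (a p * b p) / 2)) *\<^sub>R d_m f p
        + ((d_v lam p + m2 p) * inverse (a p) / 2 + (d_v lam p - m2 p) * inverse (b p) / 2) *\<^sub>R A p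
        + ((d_v lam p + m2 p) * inverse (a p) / 2 - (d_v lam p - m2 p) * inverse (b p) / 2) *\<^sub>R C"
      by (rule cov0[where w = 0]) (use nz in \<open>simp add: dN1 dA rd s1_def vec_eq_iff, simp add: field_simps\<close>)
    have cM2: "cov S L0 f (0, 1) N2 p = (s2 * (eps / e / 2)) *\<^sub>R d_p f p + (s2 * (- (a p * b p) / 2)) *\<^sub>R d_m f p
        + ((d_v lam p + m2 p) * inverse (a p) / 2 - (d_v lam p - m2 p) * inverse (b p) / 2) *\<^sub>R A p
        + ((d_v lam p + m2 p) * inverse (a p) / 2 + (d_v lam p - m2 p) * inverse (b p) / 2) *\<^sub>R C"
      by (rule cov0[where w = 0]) (use nz in \<open>simp add: dN2 dA rd s2_def vec_eq_iff, simp add: field_simps\<close>)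
    have ke: "eps / e = eps / d * (a p * b p)" using nz dab by (simp add: field_simps)
    define k where "k = eps / d"
    have r': "a1 p = (1 + k) / 4 * (a p + b p)" "a2 p = (1 - k) / 4 * (a p + b p)"
      "b1 p = (1 + k) / 4 * (a p - b p)" "b2 p = (1 - k) / 4 * (a p - b p)" using r by (simp_all add: k_def)
    show "let T1 = d_u f; T2 = d_v f; D1 = cov S L0 f (1, 0); D2 = cov S L0 f (0, 1);
           lu = d_u lam p; lv = d_v lam p in
         D1 T1 p = lu *\<^sub>R T1 p + lv *\<^sub>R T2 p + a1 p *\<^sub>R N1 p + b1 p *\<^sub>R N2 p \<and>
         D1 T2 p = lv *\<^sub>R T1 p + lu *\<^sub>R T2 p + a2 p *\<^sub>R N1 p + b2 p *\<^sub>R N2 p \<and>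
         D2 T1 p = lv *\<^sub>R T1 p + lu *\<^sub>R T2 p + a2 p *\<^sub>R N1 p + b2 p *\<^sub>R N2 p \<and>
         D2 T2 p = lu *\<^sub>R T1 p + lv *\<^sub>R T2 p + a1 p *\<^sub>R N1 p + b1 p *\<^sub>R N2 p \<and>
         D1 N1 p = - a1 p *\<^sub>R T1 p + a2 p *\<^sub>R T2 p + lu *\<^sub>R N1 p + m1 p *\<^sub>R N2 p \<and>
         D1 N2 p = b1 p *\<^sub>R T1 p - b2 p *\<^sub>R T2 p + m1 p *\<^sub>R N1 p + lu *\<^sub>R N2 p \<and>
         D2 N1 p = - a2 p *\<^sub>R T1 p + a1 p *\<^sub>R T2 p + lv *\<^sub>R N1 p + m2 p *\<^sub>R N2 p \<and>
         D2 N2 p = b2 p *\<^sub>R T1 p - b1 p *\<^sub>R T2 p + m2 p *\<^sub>R N1 p + lv *\<^sub>R N2 p"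
      unfolding Let_def c11 c12 c21 c22 cN1 cN2 cM1 cM2 ke k_def[symmetric] r' N1_def N2_def s1_def s2_def
        dirder_pm_coords(1,2)[OF df(1)] dirder_pm_coords(1,2)[OF df(3)]
      by (intro conjI; (simp add: vec_eq_iff; simp add: nz divide_simps; simp add: algebra_simps))
  qed
qed

section \<open>Translation between the geometric conditions and the adapted equations\<close>

text \<open>For one direction it suffices to test flatness on the normal field \<open>A\<close>: the
  Ricci equation says that the multiples of \<open>A\<close> by <A, B> and of \<open>B\<close> by
  <A, A> agree. If <A, A> were zero, \<open>A\<close> and with it <A, B> would vanish. Conversely,
  if \<open>B\<close> is a multiple of \<open>A\<close>, the two Ricci terms cancel for every normal
  field.\<close>

lemma (in zmc_surface) K_neq_and_normal_flat_iff:
  "K_neq_and_normal_flat_on S L0 U f \<longleftrightarrow>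
    (\<forall>p\<in>U. pinner S (A p) (B p) \<noteq> 0 \<and> (\<exists>k. B p = k *\<^sub>R A p))"
proof
  assume K: "K_neq_and_normal_flat_on S L0 U f"
  show "\<forall>p\<in>U. pinner S (A p) (B p) \<noteq> 0 \<and> (\<exists>k. B p = k *\<^sub>R A p)"
  proof
    fix p assume p: "p \<in> U"
    have AB: "pinner S (A p) (B p) \<noteq> 0"
      using K p gauss_curvature[OF p] by (auto simp: K_neq_and_normal_flat_on_def)
    have nA: "\<forall>q\<in>U. A q \<in> normal_space S L0 f q"
      using normal_AB by (simp add: normal_space_iff)
    have "normal_curvature S L0 f (0, 1) (1, 0) A p = 0"
      using K p open_U smooth_A nA unfolding K_neq_and_normal_flat_on_def normal_flat_on_def by blast
    then have eq: "pinner S (A p) (B p) *\<^sub>R A p = pinner S (A p) (A p) *\<^sub>R B p"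
      using normal_curvature[OF open_U order_refl smooth_A nA p, of "(0, 1)" "(1, 0)"] by simp
    have AA: "pinner S (A p) (A p) \<noteq> 0"
      using eq AB by (auto simp: pinner_simps)
    have "pinner S (A p) (A p) *\<^sub>R B p = pinner S (A p) (A p) *\<^sub>R ((pinner S (A p) (B p) / pinner S (A p) (A p)) *\<^sub>R A p)"
      using AA by (simp add: eq)
    then have "B p = (pinner S (A p) (B p) / pinner S (A p) (A p)) *\<^sub>R A p"
      using AA by (simp only: scaleR_cancel_left) simp
    then show "pinner S (A p) (B p) \<noteq> 0 \<and> (\<exists>k. B p = k *\<^sub>R A p)" using AB by blast
  qed
next
  assume AB: "\<forall>p\<in>U. pinner S (A p) (B p) \<noteq> 0 \<and> (\<exists>k. B p = k *\<^sub>R A p)"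
  show "K_neq_and_normal_flat_on S L0 U f"
    unfolding K_neq_and_normal_flat_on_def normal_flat_on_def
  proof (intro conjI ballI allI impI)
    fix p assume "p \<in> U"
    then show "gauss_curvature (induced_metric S f) p \<noteq> L0"
      using AB by (simp add: gauss_curvature)
  next
    fix V xi X Y p
    assume V: "open V \<and> V \<subseteq> U \<and> smooth_on V xi \<and> (\<forall>p\<in>V. xi p \<in> normal_space S L0 f p)" and p: "p \<in> V"
    then obtain k where k: "B p = k *\<^sub>R A p" using AB by blast
    show "normal_curvature S L0 f X Y xi p = 0"
      using normal_curvature[of V xi p X Y] V p by (simp add: k pinner_simps)
  qed
qed

lemma zmc_surfaceI:
  assumes "open U" "zmc_immersion_on S L0 U f lam"
  shows "zmc_surface S L0 U f lam"
proof -
  interpret conformal_surface S L0 U f lam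
    using assms by unfold_locales (simp_all add: zmc_immersion_on_def)
  show ?thesis
    by unfold_locales (use assms(2) zmc_iff in blast)
qed

text \<open>The two null components of the second fundamental form are \<open>A\<close> and its
  multiple by eps / d. Their product is \<open>eps\<close>, hence the condition that
  \<open>eps\<close> is nonzero.\<close>

lemma zmc_if_adapted:
  fixes S :: "'n::finite set"
  assumes U: "open U" and d: "d \<noteq> 0" and f: "adapted_on L0 d eps U lam f A"
    and gram: "\<And>p. p \<in> U \<Longrightarrow> frame_gram S L0 (exp (2 * lam p)) d (f p) (d_p f p) (d_m f p) (A p) (C p)"
  shows "zmc_immersion_on S L0 U f lam" "eps \<noteq> 0 \<Longrightarrow> K_neq_and_normal_flat_on S L0 U f"
proof -
  note g = gram[unfolded frame_gram_def]
  have "f ` U \<subseteq> space_form S L0"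
    using g by (force simp: space_form_def field_simps split: if_splits)
  then interpret conformal_surface S L0 U f lam
    using U adapted_on_smooth[OF f] g by unfold_locales (auto intro!: conformal_metric_on_null)
  show zmc: "zmc_immersion_on S L0 U f lam"
    unfolding zmc_iff using adapted_on_eqs(2)[OF f U] by simp
  interpret zmc_surface S L0 U f lam by (rule zmc_surfaceI[OF U zmc])
  have AB: "sff_p f lam p = A p" "sff_m f lam p = (eps / d) *\<^sub>R A p" if "p \<in> U" for p
    using adapted_on_eqs[OF f U that] by (simp_all add: sff_p_def sff_m_def algebra_simps)
  assume "eps \<noteq> 0"
  then show "K_neq_and_normal_flat_on S L0 U f"
    unfolding K_neq_and_normal_flat_iff using g d by (auto simp: AB pinner_simps)
qed

text \<open>The inverse of the passage from the adapted equations to the normal frame. The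
  logarithmic derivatives of \<open>a\<close> and \<open>b\<close> compensate the normal connection
  of the null normals N1 + N2 and N1 - N2, so that \<open>A\<close> and \<open>C\<close> become
  parallel. As the second fundamental form has no component along \<open>C\<close>, its ambient
  derivative vanishes too.\<close>

lemma adapted_if_associated:
  fixes S :: "'n::finite set"
  assumes U: "open U" and zmc: "zmc_immersion_on S L0 U f lam" and d: "d \<noteq> 0"
    and assoc: "associated_functions_on S L0 U f lam a1 a2 b1 b2 m1 m2"
    and rep: "star_rep U d (eps / d) lam a1 a2 b1 b2 m1 m2 a b"
  obtains A C where "adapted_on L0 d eps U lam f A" "smooth_on U C"
    "\<And>p. p \<in> U \<Longrightarrow> d_p C p = 0" "\<And>p. p \<in> U \<Longrightarrow> d_m C p = 0"
    "\<And>p. p \<in> U \<Longrightarrow> frame_gram S L0 (exp (2 * lam p)) d (f p) (d_p f p) (d_m f p) (A p) (C p)"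
proof -
  interpret zmc_surface S L0 U f lam by (rule zmc_surfaceI[OF U zmc])
  obtain N1 N2 where frame: "normal_frame_on S L0 U f lam N1 N2" and
    eqs: "\<forall>p\<in>U. let T1 = d_u f; T2 = d_v f; D1 = cov S L0 f (1, 0); D2 = cov S L0 f (0, 1);
           lu = d_u lam p; lv = d_v lam p in
         D1 T1 p = lu *\<^sub>R T1 p + lv *\<^sub>R T2 p + a1 p *\<^sub>R N1 p + b1 p *\<^sub>R N2 p \<and>
         D1 T2 p = lv *\<^sub>R T1 p + lu *\<^sub>R T2 p + a2 p *\<^sub>R N1 p + b2 p *\<^sub>R N2 p \<and>
         D2 T1 p = lv *\<^sub>R T1 p + lu *\<^sub>R T2 p + a2 p *\<^sub>R N1 p + b2 p *\<^sub>R N2 p \<and>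
         D2 T2 p = lu *\<^sub>R T1 p + lv *\<^sub>R T2 p + a1 p *\<^sub>R N1 p + b1 p *\<^sub>R N2 p \<and>
         D1 N1 p = - a1 p *\<^sub>R T1 p + a2 p *\<^sub>R T2 p + lu *\<^sub>R N1 p + m1 p *\<^sub>R N2 p \<and>
         D1 N2 p = b1 p *\<^sub>R T1 p - b2 p *\<^sub>R T2 p + m1 p *\<^sub>R N1 p + lu *\<^sub>R N2 p \<and>
         D2 N1 p = - a2 p *\<^sub>R T1 p + a1 p *\<^sub>R T2 p + lv *\<^sub>R N1 p + m2 p *\<^sub>R N2 p \<and>
         D2 N2 p = b2 p *\<^sub>R T1 p - b1 p *\<^sub>R T2 p + m2 p *\<^sub>R N1 p + lv *\<^sub>R N2 p"
    using assoc unfolding associated_functions_on_def by blast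
  have sm: "smooth_on U N1" "smooth_on U N2" "smooth_on U a" "smooth_on U b"
    using frame rep by (simp_all add: normal_frame_on_def star_rep_def)
  \<comment> \<open>Chosen so that A + C = a (N1 + N2) and A - C = b (N1 - N2).\<close>
  define A where "A p = (1/2) *\<^sub>R ((a p + b p) *\<^sub>R N1 p + (a p - b p) *\<^sub>R N2 p)" for p
  define C where "C p = (1/2) *\<^sub>R ((a p - b p) *\<^sub>R N1 p + (a p + b p) *\<^sub>R N2 p)" for p
  have smA: "smooth_on U A" and smC: "smooth_on U C"
    unfolding A_def[abs_def] C_def[abs_def] by (intro smooth_on_intros U sm)+
  have all: "d_p C p = 0" "d_m C p = 0"
    "frame_gram S L0 (exp (2 * lam p)) d (f p) (d_p f p) (d_m f p) (A p) (C p)"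
    "d_p (d_p f) p = (2 * d_p lam p) *\<^sub>R d_p f p + 2 *\<^sub>R A p"
    "d_m (d_m f) p = (2 * d_m lam p) *\<^sub>R d_m f p + (2 * (eps / d)) *\<^sub>R A p"
    "d_p A p = - (d * exp (- 2 * lam p)) *\<^sub>R d_m f p" "d_m A p = - (eps * exp (- 2 * lam p)) *\<^sub>R d_p f p"
    if p: "p \<in> U" for p
  proof -
    note e = bspec[OF eqs p, unfolded Let_def]
    note r = rep[unfolded star_rep_def, THEN conjunct2, THEN conjunct2, THEN bspec, OF p]
    have N: "L0 * pinner S (N q) (f q) = 0" "pinner S (N q) (d_p f q) = 0" "pinner S (N q) (d_m f q) = 0"
      if "N \<in> {N1, N2}" "q \<in> U" for N q
      using frame that normal_space_iff[of q] by (auto simp: normal_frame_on_def)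
    have df: "N1 differentiable (at p)" "N2 differentiable (at p)" "a differentiable (at p)" "b differentiable (at p)"
      using sm p by (auto intro: smooth_on_differentiable)
    \<comment> \<open>A normal field is orthogonal to the position vector, when \<open>L0\<close> is
      nonzero, and to its derivatives. So the ambient derivative of the field has no position
      component to remove.\<close>
    have cN: "cov S L0 f X N p = dirder N X p" if "N \<in> {N1, N2}" for X N
    proof -
      have "dirder (\<lambda>q. L0 * pinner S (N q) (f q)) X p = dirder (\<lambda>_. 0) X p"
        by (rule dirder_cong_open[OF U p]) (use N that in auto)
      moreover have "N differentiable (at p)" using that df by auto
      moreover have "pinner S (N p) (dirder f X p) = 0"
        using dirder_null[of f p X] N[OF that p] p by (simp add: pinner_simps)
      ultimately show ?thesis using p by (auto simp: cov_def)
    qed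
    note dN = e[unfolded cN[of N1, simplified] cN[of N2, simplified]]
    have dA: "dirder A X p = (1/2) *\<^sub>R ((a p + b p) *\<^sub>R dirder N1 X p + (dirder a X p + dirder b X p) *\<^sub>R N1 p
        + ((a p - b p) *\<^sub>R dirder N2 X p + (dirder a X p - dirder b X p) *\<^sub>R N2 p))" for X
      unfolding A_def[abs_def] using df by simp
    have dC: "dirder C X p = (1/2) *\<^sub>R ((a p - b p) *\<^sub>R dirder N1 X p + (dirder a X p - dirder b X p) *\<^sub>R N1 p
        + ((a p + b p) *\<^sub>R dirder N2 X p + (dirder a X p + dirder b X p) *\<^sub>R N2 p))" for X
      unfolding C_def[abs_def] using df by simp
    define k where "k = eps / d"
    have r': "a1 p = (1 + k) / 4 * (a p + b p)" "a2 p = (1 - k) / 4 * (a p + b p)"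
      "b1 p = (1 + k) / 4 * (a p - b p)" "b2 p = (1 - k) / 4 * (a p - b p)" using r by (simp_all add: k_def)
    have rd: "d_u a p = - (d_u lam p + m1 p) * a p" "d_u b p = - (d_u lam p - m1 p) * b p"
      "d_v a p = - (d_v lam p + m2 p) * a p" "d_v b p = - (d_v lam p - m2 p) * b p" using r by blast+
    have dN': "d_u N1 p = - a1 p *\<^sub>R d_u f p + a2 p *\<^sub>R d_v f p + d_u lam p *\<^sub>R N1 p + m1 p *\<^sub>R N2 p"
      "d_u N2 p = b1 p *\<^sub>R d_u f p - b2 p *\<^sub>R d_v f p + m1 p *\<^sub>R N1 p + d_u lam p *\<^sub>R N2 p"
      "d_v N1 p = - a2 p *\<^sub>R d_u f p + a1 p *\<^sub>R d_v f p + d_v lam p *\<^sub>R N1 p + m2 p *\<^sub>R N2 p"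
      "d_v N2 p = b2 p *\<^sub>R d_u f p - b1 p *\<^sub>R d_v f p + m2 p *\<^sub>R N1 p + d_v lam p *\<^sub>R N2 p"
      using dN by blast+
    have uv: "d_u A p = - (a p * b p / 2) *\<^sub>R ((1 + k) *\<^sub>R d_u f p - (1 - k) *\<^sub>R d_v f p)"
      "d_v A p = - (a p * b p / 2) *\<^sub>R ((1 - k) *\<^sub>R d_u f p - (1 + k) *\<^sub>R d_v f p)"
      "d_u C p = 0" "d_v C p = 0"
      unfolding dA dC dN' rd r' by (simp_all add: vec_eq_iff) (simp_all add: field_simps)
    have diffAC: "A differentiable (at p)" "C differentiable (at p)"
      using smA smC p by (auto intro: smooth_on_differentiable)
    have ab: "a p * b p = d * exp (- 2 * lam p)" using r by blast
    have kd: "k * d = eps" using d by (simp add: k_def)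
    have ke: "a p * b p * k = eps * exp (- 2 * lam p)" using ab kd by (simp add: mult.commute mult.left_commute)
    show "d_p C p = 0" "d_m C p = 0"
      unfolding dirder_pm_coords(1,2)[OF diffAC(2)] uv by simp_all
    have "d_p A p = - (a p * b p) *\<^sub>R d_m f p" "d_m A p = - (a p * b p * k) *\<^sub>R d_p f p"
      unfolding dirder_pm_coords(1,2)[OF diffAC(1)] dirder_pm_coords(1,2)[OF diffs(1)[OF p]] uv
      by (simp_all add: vec_eq_iff) (simp_all add: field_simps)
    then show "d_p A p = - (d * exp (- 2 * lam p)) *\<^sub>R d_m f p" "d_m A p = - (eps * exp (- 2 * lam p)) *\<^sub>R d_p f p"
      unfolding ke unfolding ab by simp_all
    have pos: "L0 * pinner S (d_p (d_p f) p) (f p) = 0" "L0 * pinner S (d_m (d_m f) p) (f p) = 0"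
      using position(3)[OF p, of "(1, 1)" "(1, 1)"] position(3)[OF p, of "(1, -1)" "(1, -1)"] by (simp_all add: null p)
    \<comment> \<open>Sum and difference of the Gauss formulas isolate the two pure null second
      derivatives, whose position components vanish because the directions are null.\<close>
    have cc: "cov S L0 f (1, 0) (d_u f) p + cov S L0 f (0, 1) (d_v f) p
        + (cov S L0 f (1, 0) (d_v f) p + cov S L0 f (0, 1) (d_u f) p)
        = d_p (d_p f) p - (L0 * pinner S (d_p (d_p f) p) (f p)) *\<^sub>R f p"
      "cov S L0 f (1, 0) (d_u f) p + cov S L0 f (0, 1) (d_v f) p
        - (cov S L0 f (1, 0) (d_v f) p + cov S L0 f (0, 1) (d_u f) p)
        = d_m (d_m f) p - (L0 * pinner S (d_m (d_m f) p) (f p)) *\<^sub>R f p"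
      unfolding cov_def second_dirder_coords[OF U p smooth_f]
      by (simp_all add: vec_eq_iff pinner_simps) (simp_all add: field_simps)
    show "d_p (d_p f) p = (2 * d_p lam p) *\<^sub>R d_p f p + 2 *\<^sub>R A p"
      "d_m (d_m f) p = (2 * d_m lam p) *\<^sub>R d_m f p + (2 * (eps / d)) *\<^sub>R A p"
      unfolding k_def[symmetric]
    proof -
      have D: "cov S L0 f (1, 0) (d_u f) p = d_u lam p *\<^sub>R d_u f p + d_v lam p *\<^sub>R d_v f p + a1 p *\<^sub>R N1 p + b1 p *\<^sub>R N2 p"
        "cov S L0 f (1, 0) (d_v f) p = d_v lam p *\<^sub>R d_u f p + d_u lam p *\<^sub>R d_v f p + a2 p *\<^sub>R N1 p + b2 p *\<^sub>R N2 p"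
        "cov S L0 f (0, 1) (d_u f) p = d_v lam p *\<^sub>R d_u f p + d_u lam p *\<^sub>R d_v f p + a2 p *\<^sub>R N1 p + b2 p *\<^sub>R N2 p"
        "cov S L0 f (0, 1) (d_v f) p = d_u lam p *\<^sub>R d_u f p + d_v lam p *\<^sub>R d_v f p + a1 p *\<^sub>R N1 p + b1 p *\<^sub>R N2 p"
        using e by blast+
      show "d_p (d_p f) p = (2 * d_p lam p) *\<^sub>R d_p f p + 2 *\<^sub>R A p"
      proof -
        have "d_p (d_p f) p = cov S L0 f (1, 0) (d_u f) p + cov S L0 f (0, 1) (d_v f) p
            + (cov S L0 f (1, 0) (d_v f) p + cov S L0 f (0, 1) (d_u f) p)"
          unfolding cc(1) pos by simp
        also have "\<dots> = (2 * d_p lam p) *\<^sub>R d_p f p + 2 *\<^sub>R A p"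
          unfolding D r' A_def dirder_pm_coords(1,2)[OF diffs(1)[OF p]] dirder_pm_coords(1,2)[OF diffs(4)[OF p]]
          by (simp add: vec_eq_iff) (simp add: field_simps)
        finally show ?thesis .
      qed
      show "d_m (d_m f) p = (2 * d_m lam p) *\<^sub>R d_m f p + (2 * k) *\<^sub>R A p"
      proof -
        have "d_m (d_m f) p = cov S L0 f (1, 0) (d_u f) p + cov S L0 f (0, 1) (d_v f) p
            - (cov S L0 f (1, 0) (d_v f) p + cov S L0 f (0, 1) (d_u f) p)"
          unfolding cc(2) pos by simp
        also have "\<dots> = (2 * d_m lam p) *\<^sub>R d_m f p + (2 * k) *\<^sub>R A p"
          unfolding D r' A_def dirder_pm_coords(1,2)[OF diffs(1)[OF p]] dirder_pm_coords(1,2)[OF diffs(4)[OF p]]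
          by (simp add: vec_eq_iff) (simp add: field_simps)
        finally show ?thesis .
      qed
    qed
    show "frame_gram S L0 (exp (2 * lam p)) d (f p) (d_p f p) (d_m f p) (A p) (C p)"
    proof -
      have n: "pinner S (N1 p) (N1 p) = E p" "pinner S (N2 p) (N2 p) = - E p" "pinner S (N1 p) (N2 p) = 0"
        "pinner S (N2 p) (N1 p) = 0"
        using frame p pinner_commute[of S "N1 p" "N2 p"] by (auto simp: normal_frame_on_def)
      have n2: "L0 = 0 \<or> pinner S (N1 p) (f p) = 0" "L0 = 0 \<or> pinner S (N2 p) (f p) = 0"
        using N(1)[of N1 p] N(1)[of N2 p] p by simp_all
      have abE: "a p * b p * E p = d" unfolding ab using exp_cancel[of "lam p"] by (simp add: mult.commute mult.left_commute)
      show ?thesis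
        unfolding frame_gram_def
      proof (intro conjI)
        show "L0 * pinner S (A p) (f p) = 0" "L0 * pinner S (C p) (f p) = 0"
          using n2 by (auto simp: A_def C_def pinner_simps)
        show "pinner S (A p) (A p) = d" "pinner S (C p) (C p) = - d" "pinner S (A p) (C p) = 0"
          unfolding A_def C_def abE[symmetric] by (simp_all add: pinner_simps n) (simp_all add: field_simps)
      qed (simp_all add: position p null A_def C_def pinner_simps N)
    qed
  qed
  show ?thesis
  proof (rule that[OF _ smC])
    show "adapted_on L0 d eps U lam f A"
      unfolding adapted_on_def using all(4-7) smooth_lam smooth_f smA wave_f by simp
  qed (use all(1-3) in blast)+
qed

section \<open>Ambient isometries and uniqueness\<close>

lemma isometry_sf_affine:
  fixes L :: "real^'n::finite \<Rightarrow> real^'n"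
  assumes L: "linear L" and iso: "\<And>x y. pinner S (L x) (L y) = pinner S x y" and c: "L0 = 0 \<or> c = 0"
  shows "isometry_sf S L0 (\<lambda>x. c + L x)"
proof -
  let ?N = "space_form S L0" and ?\<Phi> = "\<lambda>x. c + L x"
  have "inj L"
    unfolding linear_injective_0[OF L]
  proof (intro allI impI)
    fix x assume "L x = 0"
    then have "pinner S x y = 0" for y using iso[of x y] by (simp add: pinner_simps)
    then show "x = 0" by (rule pinner_nondegenerate)
  qed
  then obtain K where K: "linear K" "\<And>x. K (L x) = x" "\<And>x. L (K x) = x"
    using linear_injective_isomorphism[OF L] by metis
  let ?\<Psi> = "\<lambda>y. K (y - c)"
  have isoK: "pinner S (K x) (K y) = pinner S x y" for x y
    using iso[of "K x" "K y"] by (simp add: K)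
  have maps: "?\<Phi> x \<in> ?N" "?\<Psi> x \<in> ?N" if "x \<in> ?N" for x
    using that c by (auto simp: space_form_def iso isoK split: if_splits)
  have bij: "bij_betw ?\<Phi> ?N ?N"
    by (rule bij_betw_byWitness[where f' = ?\<Psi>]) (use maps K in auto)
  have inv: "inv_into ?N ?\<Phi> y = ?\<Psi> y" if "y \<in> ?N" for y
    using bij_betw_imp_inj_on[OF bij] maps(2)[OF that] by (rule inv_into_f_eq) (simp add: K)
  have bl: "bounded_linear L" "bounded_linear K"
    using L K(1) by (simp_all add: linear_conv_bounded_linear)
  have sm: "smooth_on UNIV ?\<Phi>" "smooth_on UNIV ?\<Psi>"
    by (intro smooth_on_add smooth_on_const open_UNIV smooth_on_bounded_linear[OF bl(1)])
      (intro smooth_on_linear_comp[OF bl(2)] smooth_on_diff smooth_on_const open_UNIV smooth_on_id)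
  have d: "dirder ?\<Phi> X x = L X" for X x
    by (rule dirder_eqI) (use L in \<open>auto simp: linear_conv_bounded_linear intro!: derivative_eq_intros
        bounded_linear_imp_has_derivative\<close>)
  show ?thesis
    unfolding isometry_sf_def smooth_extension_near_def
  proof (intro conjI ballI bij)
    fix x
    show "\<exists>G. (\<exists>W. open W \<and> x \<in> W \<and> smooth_on W G \<and> (\<forall>y\<in>W \<inter> ?N. G y = ?\<Phi> y)) \<and>
        (\<forall>X\<in>tangent_sf S L0 x. \<forall>Y\<in>tangent_sf S L0 x. pinner S (dirder G X x) (dirder G Y x) = pinner S X Y)"
      by (rule exI[of _ ?\<Phi>]) (use sm(1) in \<open>auto simp: d iso\<close>)
    show "\<exists>G W. open W \<and> x \<in> W \<and> smooth_on W G \<and> (\<forall>y\<in>W \<inter> ?N. G y = inv_into ?N ?\<Phi> y)"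
      by (rule exI[of _ ?\<Psi>], rule exI[of _ UNIV]) (use sm(2) inv in auto)
  qed
qed

text \<open>Expanding y in the first frame expresses <y, z> through products with that frame.
  \<open>L y\<close> has the same coefficients in the second frame, and the two Gram matrices
  coincide.\<close>

lemma frame_transfer:
  fixes S :: "'n::finite set"
  assumes dim: "CARD('n) = (if L0 = 0 then 4 else 5)" and E: "E \<noteq> 0" and d: "d \<noteq> 0"
    and g: "frame_gram S L0 E d x P M A C" and g': "frame_gram S L0 E d x' P' M' A' C'"
  defines "L \<equiv> \<lambda>y. (L0 * pinner S x y) *\<^sub>R x' + (pinner S P y / (2 * E)) *\<^sub>R M' + (pinner S M y / (2 * E)) *\<^sub>R P'
    + (pinner S A y / d) *\<^sub>R A' - (pinner S C y / d) *\<^sub>R C'"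
  shows "linear L" "pinner S (L y) (L z) = pinner S y z"
proof -
  show "linear L" unfolding L_def
    by (rule linearI) (simp_all add: pinner_simps vec_eq_iff add_divide_distrib, simp_all add: algebra_simps add_divide_distrib)
  have c: "pinner S M' P' = 2 * E" "pinner S P' A' = 0" "pinner S M' A' = 0" "pinner S P' C' = 0" "pinner S M' C' = 0"
    "pinner S C' A' = 0" "L0 * pinner S x' P' = 0" "L0 * pinner S x' M' = 0" "L0 * pinner S x' A' = 0" "L0 * pinner S x' C' = 0"
    using g' pinner_commute[of S M' P'] pinner_commute[of S P' A'] pinner_commute[of S M' A']
      pinner_commute[of S P' C'] pinner_commute[of S M' C'] pinner_commute[of S C' A'] pinner_commute[of S x' P']
      pinner_commute[of S x' M'] pinner_commute[of S x' A'] pinner_commute[of S x' C'] by (simp_all add: frame_gram_def)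
  have "frame_sum S L0 E d x P M A C y = y"
    using g frame_gram_iff[OF dim E d] by blast
  then have "pinner S y z = pinner S (frame_sum S L0 E d x P M A C y) z" by simp
  also have "\<dots> = L0 * pinner S x y * pinner S x z + (pinner S P y * pinner S M z + pinner S M y * pinner S P z) / (2 * E)
      + pinner S A y * pinner S A z / d - pinner S C y * pinner S C z / d"
    by (simp add: frame_sum_def pinner_simps add_divide_distrib)
  also have "\<dots> = pinner S (L y) (L z)"
  proof -
    have g1: "pinner S P' P' = 0" "pinner S M' M' = 0" "pinner S P' M' = 2 * E" "pinner S A' P' = 0"
      "pinner S A' M' = 0" "pinner S C' P' = 0" "pinner S C' M' = 0" "pinner S A' A' = d" "pinner S C' C' = - d"
      "pinner S A' C' = 0"
      using g' unfolding frame_gram_def by blast+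
    have g0: "L0 \<noteq> 0 \<Longrightarrow> pinner S x' x' = 1 / L0" "L0 \<noteq> 0 \<Longrightarrow> pinner S P' x' = 0" "L0 \<noteq> 0 \<Longrightarrow> pinner S M' x' = 0"
      "L0 \<noteq> 0 \<Longrightarrow> pinner S A' x' = 0" "L0 \<noteq> 0 \<Longrightarrow> pinner S C' x' = 0"
      using g' unfolding frame_gram_def by (auto simp: field_simps)
    have c0: "L0 \<noteq> 0 \<Longrightarrow> pinner S x' P' = 0" "L0 \<noteq> 0 \<Longrightarrow> pinner S x' M' = 0"
      "L0 \<noteq> 0 \<Longrightarrow> pinner S x' A' = 0" "L0 \<noteq> 0 \<Longrightarrow> pinner S x' C' = 0"
      using c(7-10) by simp_all
    show ?thesis
    proof (cases "L0 = 0")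
      case True
      show ?thesis unfolding L_def using E d
        by (simp add: True pinner_simps g1 c(1-6)) (simp add: field_simps)
    next
      case False
      show ?thesis unfolding L_def using E d False
        by (simp add: pinner_simps g1 g0[OF False] c(1-6) c0[OF False]) (simp add: field_simps)
    qed
  qed
  finally show "pinner S (L y) (L z) = pinner S y z" by simp
qed

text \<open>The map carrying one moving frame to the other is the same linear isometry at all
  points. If \<open>L0\<close> is nonzero, the position vector belongs to the frame and is carried
  along. If \<open>L0 = 0\<close>, only the derivatives are, and integration leaves a
  translation.\<close>

lemma unique_up_to_isometry:
  fixes S :: "'n::finite set"
  assumes dim: "CARD('n) = (if L0 = 0 then 4 else 5)" and U: "open U" "connected U" and d: "d \<noteq> 0"
    and f: "adapted_on L0 d eps U lam f A" and f': "adapted_on L0 d eps U lam f' A'"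
    and C: "smooth_on U C" "\<And>p. p \<in> U \<Longrightarrow> d_p C p = 0" "\<And>p. p \<in> U \<Longrightarrow> d_m C p = 0"
      "\<And>p. p \<in> U \<Longrightarrow> frame_gram S L0 (exp (2 * lam p)) d (f p) (d_p f p) (d_m f p) (A p) (C p)"
    and C': "smooth_on U C'" "\<And>p. p \<in> U \<Longrightarrow> d_p C' p = 0" "\<And>p. p \<in> U \<Longrightarrow> d_m C' p = 0"
      "\<And>p. p \<in> U \<Longrightarrow> frame_gram S L0 (exp (2 * lam p)) d (f' p) (d_p f' p) (d_m f' p) (A' p) (C' p)"
  shows "\<exists>\<Phi>. isometry_sf S L0 \<Phi> \<and> (\<forall>p\<in>U. f' p = \<Phi> (f p))"
proof (cases "U = {}")
  case True
  then show ?thesis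
    using isometry_sf_affine[of "\<lambda>x. x" S L0 0] by (auto simp: linear_ident)
next
  case False
  then obtain p0 where p0: "p0 \<in> U" by blast
  \<comment> \<open>The term of the constant normals completes the frame map to the full transfer
    between the frames without destroying its constancy.\<close>
  define L where "L p y = frame_map S L0 d lam f A f' A' p y - (pinner S (C p) y / d) *\<^sub>R C' p" for p y
  have L_const: "L p = L p0" if "p \<in> U" for p
    unfolding L_def using frame_map_constant[OF U d f f' that p0]
      constant_of_null_derivatives[OF U C(1-3) that p0] constant_of_null_derivatives[OF U C'(1-3) that p0]
    by (simp add: fun_eq_iff)
  have L_eq: "L p0 = (\<lambda>y. (L0 * pinner S (f p0) y) *\<^sub>R f' p0 + (pinner S (d_p f p0) y / (2 * exp (2 * lam p0))) *\<^sub>R d_m f' p0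
      + (pinner S (d_m f p0) y / (2 * exp (2 * lam p0))) *\<^sub>R d_p f' p0
      + (pinner S (A p0) y / d) *\<^sub>R A' p0 - (pinner S (C p0) y / d) *\<^sub>R C' p0)"
  proof -
    have "z / (2 * exp (2 * lam p0)) = 1 / 2 * exp (- 2 * lam p0) * z" for z
      using exp_cancel[of "lam p0"] by (simp add: field_simps exp_minus)
    then show ?thesis unfolding L_def frame_map_def by (simp only: scaleR_right_distrib scaleR_scaleR fun_eq_iff) simp
  qed
  have lin: "linear (L p0)" and iso: "pinner S (L p0 y) (L p0 z) = pinner S y z" for y z
    unfolding L_eq by (rule frame_transfer[OF dim _ d C(4)[OF p0] C'(4)[OF p0]], simp)+
  show ?thesis
  proof (cases "L0 = 0")
    case False
    have "f' p = 0 + L p0 (f p)" if p: "p \<in> U" for p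
      unfolding L_const[OF p, symmetric] L_def frame_map_def
      using C(4)[OF p] False by (simp add: frame_gram_def)
    then show ?thesis using isometry_sf_affine[OF lin iso, of L0 0] by blast
  next
    case True
    \<comment> \<open>The difference of f' and L f has zero derivative, so its value at
      \<open>p0\<close> is the translation.\<close>
    define c where "c = f' p0 - L p0 (f p0)"
    have bl: "bounded_linear (L p0)" using lin by (simp add: linear_conv_bounded_linear)
    have Lf: "L p0 (d_p f p) = d_p f' p" "L p0 (d_m f p) = d_m f' p" if p: "p \<in> U" for p
    proof -
      note g = C(4)[OF p, unfolded frame_gram_def]
      have "pinner S (d_m f p) (d_p f p) = 2 * exp (2 * lam p)" using g pinner_commute by metis
      then show "L p0 (d_p f p) = d_p f' p" "L p0 (d_m f p) = d_m f' p"
        unfolding L_const[OF p, symmetric] L_def frame_map_def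
        using g True by (simp_all flip: exp_add)
    qed
    have "f' p - L p0 (f p) = f' p0 - L p0 (f p0)" if p: "p \<in> U" for p
    proof (rule constant_of_null_derivatives[OF U _ _ _ p p0])
      show "smooth_on U (\<lambda>p. f' p - L p0 (f p))"
        by (intro smooth_on_diff U smooth_on_linear_comp[OF bl] adapted_on_smooth[OF f] adapted_on_smooth[OF f'])
      fix q assume q: "q \<in> U"
      have "dirder (\<lambda>p. f' p - L p0 (f p)) X q = dirder f' X q - L p0 (dirder f X q)" for X
        by (rule dirder_eqI) (intro has_derivative_diff bounded_linear.has_derivative[OF bl]
            differentiable_has_dirder adapted_on_differentiable[OF f q] adapted_on_differentiable[OF f' q])
      then show "d_p (\<lambda>p. f' p - L p0 (f p)) q = 0" "d_m (\<lambda>p. f' p - L p0 (f p)) q = 0"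
        by (simp_all add: Lf[OF q])
    qed
    then have "f' p = c + L p0 (f p)" if "p \<in> U" for p
      using that by (simp add: c_def algebra_simps)
    then show ?thesis using isometry_sf_affine[OF lin iso, of L0 c] True by blast
  qed
qed

section \<open>Existence\<close>

lemma pinner_axis: "pinner S (axis i 1) (axis j 1) = (if i = j then if i \<in> S then - 1 else 1 else 0)"
proof -
  have "pinner S (axis i 1) (axis j 1)
      = (\<Sum>k\<in>UNIV. if k = i then if i = j then if i \<in> S then - 1 else 1 else 0 else 0)"
    unfolding pinner_def by (rule sum.cong) (auto simp: axis_def)
  then show ?thesis by simp
qed

text \<open>The frame is built from coordinate axes. Two positive and two negative axes span the
  tangent and normal planes; outside the flat case one axis is left, and its sign is that of
  \<open>L0\<close>, so that it can carry the position vector.\<close>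

lemma frame_gram_exists:
  fixes S :: "'n::finite set"
  assumes dim: "CARD('n) = (if L0 = 0 then 4 else 5)" and index: "card S = (if L0 < 0 then 3 else 2)"
    and E: "E > 0" and d: "d \<noteq> 0"
  obtains x P M A C where "frame_gram S L0 E d x P M A C"
proof -
  note frame_exists = that
  have cS: "card (- S) = (if L0 > 0 then 3 else 2)"
    using dim index by (auto simp: Compl_eq_Diff_UNIV card_Diff_subset split: if_splits)
  define ax where "ax i = axis i (1::real)" for i :: 'n
  note ip = pinner_axis[of S, folded ax_def]
  have main: thesis if ij: "i1 \<notin> S" "i2 \<notin> S" "j1 \<in> S" "j2 \<in> S" "i1 \<noteq> i2" "j1 \<noteq> j2"
    and x: "L0 * pinner S x x = (if L0 = 0 then 0 else 1)"
      "\<And>i. i \<in> {i1, i2, j1, j2} \<Longrightarrow> L0 * pinner S (ax i) x = 0" for i1 i2 j1 j2 x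
  proof -
    \<comment> \<open>One axis of each sign gives the null vectors U + V and U - V, with product 2
      E. Of the other two, the sign of \<open>d\<close> decides which becomes \<open>A\<close> and
      which \<open>C\<close>.\<close>
    define U V where "U = sqrt E *\<^sub>R ax i1" and "V = sqrt E *\<^sub>R ax j1"
    define A where "A = (if d > 0 then sqrt d *\<^sub>R ax i2 else sqrt (- d) *\<^sub>R ax j2)"
    define C where "C = (if d > 0 then sqrt d *\<^sub>R ax j2 else sqrt (- d) *\<^sub>R ax i2)"
    have ne: "i1 \<noteq> j1" "i1 \<noteq> j2" "i2 \<noteq> j1" "i2 \<noteq> j2" using ij by auto
    have xs: "L0 = 0 \<or> pinner S (ax i1) x = 0" "L0 = 0 \<or> pinner S (ax i2) x = 0"
      "L0 = 0 \<or> pinner S (ax j1) x = 0" "L0 = 0 \<or> pinner S (ax j2) x = 0"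
      using x(2)[of i1] x(2)[of i2] x(2)[of j1] x(2)[of j2] by simp_all
    have "frame_gram S L0 E d x (U + V) (U - V) A C"
      using ij ne E d x(1) xs unfolding frame_gram_def U_def V_def A_def C_def
      by (auto simp: pinner_simps ip)
    then show thesis by (rule frame_exists)
  qed
  show thesis
  proof (cases "L0 = 0")
    case True
    obtain i1 i2 where "- S = {i1, i2}" "i1 \<noteq> i2" using cS True by (auto simp: card_2_iff)
    moreover obtain j1 j2 where "S = {j1, j2}" "j1 \<noteq> j2" using index True by (auto simp: card_2_iff)
    ultimately show ?thesis using True by (intro main[of i1 i2 j1 j2 0]) auto
  next
    case False
    show ?thesis
    proof (cases "L0 > 0")
      case True
      obtain i1 i2 i3 where i: "- S = {i1, i2, i3}" "i1 \<noteq> i2" "i1 \<noteq> i3" "i2 \<noteq> i3"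
        using cS True by (auto simp: card_3_iff)
      obtain j1 j2 where j: "S = {j1, j2}" "j1 \<noteq> j2" using index True by (auto simp: card_2_iff)
      have mem: "i1 \<notin> S" "i2 \<notin> S" "i3 \<notin> S" "j1 \<in> S" "j2 \<in> S" using i(1) j(1) by auto
      then have ne: "j1 \<noteq> i3" "j2 \<noteq> i3" by auto
      show ?thesis
        using True mem i(2-) j(2-) ne by (intro main[of i1 i2 j1 j2 "(1 / sqrt L0) *\<^sub>R ax i3"])
          (auto simp: pinner_simps ip)
    next
      case False': False
      with False have neg: "L0 < 0" by simp
      obtain i1 i2 where i: "- S = {i1, i2}" "i1 \<noteq> i2" using cS neg by (auto simp: card_2_iff)
      obtain j1 j2 j3 where j: "S = {j1, j2, j3}" "j1 \<noteq> j2" "j1 \<noteq> j3" "j2 \<noteq> j3"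
        using index neg by (auto simp: card_3_iff)
      have mem: "i1 \<notin> S" "i2 \<notin> S" "j1 \<in> S" "j2 \<in> S" "j3 \<in> S" using i(1) j(1) by auto
      then have ne: "i1 \<noteq> j3" "i2 \<noteq> j3" by auto
      show ?thesis
        using neg mem i(2-) j(2-) ne by (intro main[of i1 i2 j1 j2 "(1 / sqrt (- L0)) *\<^sub>R ax j3"])
          (auto simp: pinner_simps ip)
    qed
  qed
qed

text \<open>Null coordinates scaled so that the unit axes go to (1, 1) and (1, - 1): partial
  derivatives in them are exactly \<open>d_p\<close> and \<open>d_m\<close>.\<close>

definition from_null :: "real \<times> real \<Rightarrow> paracomplex"
  where "from_null q = (fst q + snd q, fst q - snd q)"

definition to_null :: "paracomplex \<Rightarrow> real \<times> real"
  where "to_null p = ((fst p + snd p) / 2, (fst p - snd p) / 2)"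

lemma null_inverse [simp]: "from_null (to_null p) = p" "to_null (from_null q) = q"
  by (simp_all add: from_null_def to_null_def prod_eq_iff field_simps)

lemma from_null_image: "from_null ` X = to_null -` X"
proof (intro equalityI subsetI)
  fix p assume "p \<in> to_null -` X"
  then have "from_null (to_null p) \<in> from_null ` X" by blast
  then show "p \<in> from_null ` X" by simp
qed auto

lemma bounded_linear_null: "bounded_linear from_null" "bounded_linear to_null"
proof -
  have "linear from_null" "linear to_null"
    by (auto intro!: linearI simp: from_null_def to_null_def prod_eq_iff field_simps)
  then show "bounded_linear from_null" "bounded_linear to_null"
    by (simp_all add: linear_conv_bounded_linear)
qed

lemma null_axes [simp]: "from_null (1, 0) = (1, 1)" "from_null (0, 1) = (1, - 1)"
  "to_null (1, 1) = (1, 0)" "to_null (1, - 1) = (0, 1)"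
  by (simp_all add: from_null_def to_null_def)

lemma has_derivative_linear_comp:
  assumes R: "bounded_linear R" and g: "g differentiable (at (R p))"
  shows "((\<lambda>q. g (R q)) has_derivative (\<lambda>e. dirder g (R e) (R p))) (at p)"
  using has_derivative_compose[OF bounded_linear_imp_has_derivative[OF R] differentiable_has_dirder[OF g]] .

lemma open_vimage_linear:
  fixes R :: "'a::euclidean_space \<Rightarrow> 'b::real_normed_vector"
  shows "bounded_linear R \<Longrightarrow> open U \<Longrightarrow> open (R -` U)"
  by (rule open_vimage) (auto intro: linear_continuous_on)

lemma smooth_on_vimage_linear:
  fixes R :: "'a::euclidean_space \<Rightarrow> 'b::euclidean_space"
  assumes "bounded_linear R" "open U" "smooth_on U g"
  shows "smooth_on (R -` U) (\<lambda>q. g (R q))"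
  by (rule smooth_on_compose[OF open_vimage_linear[OF assms(1,2)] smooth_on_bounded_linear[OF assms(1)] assms(3)])
    (auto intro: open_vimage_linear assms)

text \<open>The position, its two null derivatives and \<open>A\<close> together satisfy a linear
  first-order system. In the position and \<open>A\<close> components its integrability condition is
  an identity, in the other two it is the wave equation for \<open>lam\<close>. The box does not
  depend on the initial values, so these may later be adjusted to the value of \<open>lam\<close> at
  its corner.\<close>

lemma adapted_solution:
  fixes lam :: "paracomplex \<Rightarrow> real"
  assumes \<Omega>: "open \<Omega>" "p0 \<in> \<Omega>" and lam: "smooth_on \<Omega> lam" and d: "d \<noteq> 0"
    and wave: "\<And>p. p \<in> \<Omega> \<Longrightarrow> d_m (d_p lam) p = - L0 * exp (2 * lam p) + eps * exp (- 2 * lam p)"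
  obtains a b where "p0 \<in> from_null ` box a b" "from_null ` cbox a b \<subseteq> \<Omega>"
    "\<And>x P M A :: real^'n::finite. \<exists>f P' M' A'. adapted_on L0 d eps (from_null ` box a b) lam f A' \<and>
      continuous_on (from_null ` cbox a b) f \<and> continuous_on (from_null ` cbox a b) P' \<and>
      continuous_on (from_null ` cbox a b) M' \<and> continuous_on (from_null ` cbox a b) A' \<and>
      f (from_null a) = x \<and> P' (from_null a) = P \<and> M' (from_null a) = M \<and> A' (from_null a) = A \<and>
      (\<forall>p\<in>from_null ` box a b. d_p f p = P' p \<and> d_m f p = M' p)"
proof -
  note bl = bounded_linear_null
  \<comment> \<open>The coefficients are written as smooth scalar functions times constant bounded
    operators, so their derivatives act on the scalars alone.\<close>
  define op :: "((real^'n) \<times> (real^'n) \<times> (real^'n) \<times> (real^'n) \<Rightarrow> (real^'n) \<times> (real^'n) \<times> (real^'n) \<times> (real^'n)) \<Rightarrow> _"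
    where "op = Blinfun"
  have op: "blinfun_apply (op k) y = k y" if "linear k" for k y
    unfolding op_def using that by (simp add: bounded_linear_Blinfun_apply linear_conv_bounded_linear)
  define k0 k1 k2 k3 h0 h1 h2 h3 ::
    "(real^'n) \<times> (real^'n) \<times> (real^'n) \<times> (real^'n) \<Rightarrow> (real^'n) \<times> (real^'n) \<times> (real^'n) \<times> (real^'n)"
    where "k0 = (\<lambda>(F, P, M, A). (P, 2 *\<^sub>R A, 0, 0))" and "k1 = (\<lambda>(F, P, M, A). (0, P, 0, 0))"
      and "k2 = (\<lambda>(F, P, M, A). (0, 0, F, 0))" and "k3 = (\<lambda>(F, P, M, A). (0, 0, 0, M))"
      and "h0 = (\<lambda>(F, P, M, A). (M, 0, (2 * eps / d) *\<^sub>R A, 0))" and "h1 = (\<lambda>(F, P, M, A). (0, 0, M, 0))"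
      and "h2 = (\<lambda>(F, P, M, A). (0, F, 0, 0))" and "h3 = (\<lambda>(F, P, M, A). (0, 0, 0, P))"
  note kh = k0_def k1_def k2_def k3_def h0_def h1_def h2_def h3_def
  have lin: "linear k0" "linear k1" "linear k2" "linear k3" "linear h0" "linear h1" "linear h2" "linear h3"
    unfolding kh by (auto intro!: linearI simp: scaleR_add_right)
  have opk: "blinfun_apply (op k0) (F, P, M, A) = (P, 2 *\<^sub>R A, 0, 0)" "blinfun_apply (op k1) (F, P, M, A) = (0, P, 0, 0)"
    "blinfun_apply (op k2) (F, P, M, A) = (0, 0, F, 0)" "blinfun_apply (op k3) (F, P, M, A) = (0, 0, 0, M)"
    "blinfun_apply (op h0) (F, P, M, A) = (M, 0, (2 * eps / d) *\<^sub>R A, 0)" "blinfun_apply (op h1) (F, P, M, A) = (0, 0, M, 0)"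
    "blinfun_apply (op h2) (F, P, M, A) = (0, F, 0, 0)" "blinfun_apply (op h3) (F, P, M, A) = (0, 0, 0, P)" for F P M A
    by (simp_all only: op lin) (simp_all add: kh)
  define al be ga de et :: "real \<times> real \<Rightarrow> real"
    where "al q = 2 * d_p lam (from_null q)" and "be q = 2 * d_m lam (from_null q)"
      and "ga q = - (2 * L0 * exp (2 * lam (from_null q)))"
      and "de q = - (d * exp (- 2 * lam (from_null q)))" and "et q = - (eps * exp (- 2 * lam (from_null q)))" for q
  define U where "U q = op k0 + al q *\<^sub>R op k1 + ga q *\<^sub>R op k2 + de q *\<^sub>R op k3" for q
  define V where "V q = op h0 + be q *\<^sub>R op h1 + ga q *\<^sub>R op h2 + et q *\<^sub>R op h3" for q
  let ?\<Omega> = "from_null -` \<Omega>"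
  have op\<Omega>: "open ?\<Omega>" by (rule open_vimage_linear[OF bl(1) \<Omega>(1)])
  note sv = smooth_on_vimage_linear[OF bl(1) \<Omega>(1)]
  have sc: "smooth_on ?\<Omega> al" "smooth_on ?\<Omega> be" "smooth_on ?\<Omega> ga" "smooth_on ?\<Omega> de" "smooth_on ?\<Omega> et"
    unfolding al_def[abs_def] be_def[abs_def] ga_def[abs_def] de_def[abs_def] et_def[abs_def]
    by (intro smooth_on_mult smooth_on_minus smooth_on_const smooth_on_exp_comp op\<Omega> sv smooth_on_dirder lam)+
  have sUV: "smooth_on ?\<Omega> U" "smooth_on ?\<Omega> V"
    unfolding U_def[abs_def] V_def[abs_def]
    by (intro smooth_on_add smooth_on_scaleR smooth_on_const op\<Omega> sc)+
  have app: "blinfun_apply (U q) (F, P, M, A) = (P, al q *\<^sub>R P + 2 *\<^sub>R A, ga q *\<^sub>R F, de q *\<^sub>R M)"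
    "blinfun_apply (V q) (F, P, M, A) = (M, ga q *\<^sub>R F, be q *\<^sub>R M + (2 * eps / d) *\<^sub>R A, et q *\<^sub>R P)" for q F P M A
    unfolding U_def V_def
    by (simp_all add: blinfun.add_left blinfun.scaleR_left opk add.commute)
  have flat: "blinfun_apply (dirder U (0, 1) q) x + blinfun_apply (U q) (blinfun_apply (V q) x)
      = blinfun_apply (dirder V (1, 0) q) x + blinfun_apply (V q) (blinfun_apply (U q) x)"
    if q: "q \<in> ?\<Omega>" for q x
  proof -
    obtain F P M A where x: "x = (F, P, M, A)" by (metis prod_cases4)
    have nq: "from_null q \<in> \<Omega>" using q by simp
    have dl: "lam differentiable (at (from_null q))" "dirder lam e differentiable (at (from_null q))" for e
      using smooth_on_differentiable lam nq smooth_on_dirder by blast+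
    have dc: "al differentiable (at q)" "be differentiable (at q)" "ga differentiable (at q)" "de differentiable (at q)" "et differentiable (at q)"
      using sc q by (auto intro: smooth_on_differentiable)
    note hl = has_derivative_linear_comp[OF bl(1)]
    have l: "(\<lambda>q. lam (from_null q)) differentiable (at q)" "(\<lambda>q. dirder lam e (from_null q)) differentiable (at q)" for e
      using hl[OF dl(1)] hl[OF dl(2)] unfolding differentiable_def by blast+
    have dlam: "dirder (\<lambda>q. lam (from_null q)) X q = dirder lam (from_null X) (from_null q)"
      "dirder (\<lambda>q. dirder lam e (from_null q)) X q = dirder (dirder lam e) (from_null X) (from_null q)" for X e
      using dirder_eqI[OF hl[OF dl(1)]] dirder_eqI[OF hl[OF dl(2)]] by auto
    have sym: "d_p (d_m lam) (from_null q) = d_m (d_p lam) (from_null q)"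
      by (rule symmetric_dirder[OF \<Omega>(1) nq lam])
    have da: "dirder al (0, 1) q = 2 * d_m (d_p lam) (from_null q)" "dirder be (1, 0) q = 2 * d_m (d_p lam) (from_null q)"
      "dirder ga (0, 1) q = ga q * be q" "dirder ga (1, 0) q = ga q * al q" "dirder de (0, 1) q = - de q * be q"
      "dirder et (1, 0) q = - et q * al q"
      unfolding al_def[abs_def] be_def[abs_def] ga_def[abs_def] de_def[abs_def] et_def[abs_def]
      using l by (simp_all add: dlam sym)
    have dU: "dirder U (0, 1) q = dirder al (0, 1) q *\<^sub>R op k1 + dirder ga (0, 1) q *\<^sub>R op k2 + dirder de (0, 1) q *\<^sub>R op k3"
      "dirder V (1, 0) q = dirder be (1, 0) q *\<^sub>R op h1 + dirder ga (1, 0) q *\<^sub>R op h2 + dirder et (1, 0) q *\<^sub>R op h3"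
      unfolding U_def[abs_def] V_def[abs_def] using dc by simp_all
    \<comment> \<open>The wave equation in terms of the coefficients of the system, ready for
      substitution into the two remaining components.\<close>
    have w: "2 * d_m (d_p lam) (from_null q) = ga q - 2 * et q"
      using wave[OF nq] by (simp add: ga_def et_def)
    have k: "de q * (2 * eps) / d = et q * 2" using d by (simp add: de_def et_def)
    have k': "eps * (de q * z) / d = et q * z" for z using d by (simp add: de_def et_def)
    show ?thesis
      unfolding x app dU da w
      by (simp add: blinfun.add_left blinfun.diff_left blinfun.scaleR_left opk scaleR_add_right k)
        (simp add: vec_eq_iff algebra_simps k')
  qed
  have p0': "to_null p0 \<in> ?\<Omega>" using \<Omega> by simp
  from flat_linear_system_local[OF bounded_bilinear_blinfun_apply op\<Omega> p0' sUV flat]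
  obtain a b where ab: "to_null p0 \<in> box a b" "cbox a b \<subseteq> ?\<Omega>" and
    sol: "\<And>y0. \<exists>y. continuous_on (cbox a b) y \<and> y a = y0 \<and> smooth_on (box a b) y \<and>
      (\<forall>p\<in>box a b. dirder y (1, 0) p = blinfun_apply (U p) (y p) \<and> dirder y (0, 1) p = blinfun_apply (V p) (y p))"
    by blast
  show ?thesis
  proof (rule that[of a b])
    show "p0 \<in> from_null ` box a b" using ab(1) by (metis imageI null_inverse(1))
    show "from_null ` cbox a b \<subseteq> \<Omega>" using ab(2) by auto
    fix x P M A :: "real^'n"
    obtain y where y: "continuous_on (cbox a b) y" "y a = (x, P, M, A)" "smooth_on (box a b) y"
      "\<And>q. q \<in> box a b \<Longrightarrow> dirder y (1, 0) q = blinfun_apply (U q) (y q)"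
      "\<And>q. q \<in> box a b \<Longrightarrow> dirder y (0, 1) q = blinfun_apply (V q) (y q)"
      using sol by metis
    define f where "f p = fst (y (to_null p))" for p
    define P' where "P' p = fst (snd (y (to_null p)))" for p
    define M' where "M' p = fst (snd (snd (y (to_null p))))" for p
    define A' where "A' p = snd (snd (snd (y (to_null p))))" for p
    let ?W = "from_null ` box a b"
    have W: "?W = to_null -` box a b" by (rule from_null_image)
    have opW: "open ?W" unfolding W by (rule open_vimage_linear[OF bl(2) open_box])
    have sy: "smooth_on ?W (\<lambda>p. y (to_null p))"
      unfolding W by (rule smooth_on_vimage_linear[OF bl(2) open_box y(3)])
    have smooth: "smooth_on ?W f" "smooth_on ?W P'" "smooth_on ?W M'" "smooth_on ?W A'"
    proof -
      note fst = smooth_on_linear_comp[OF bounded_linear_fst opW] and snd = smooth_on_linear_comp[OF bounded_linear_snd opW]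
      show "smooth_on ?W f" "smooth_on ?W P'" "smooth_on ?W M'" "smooth_on ?W A'"
        unfolding f_def[abs_def] P'_def[abs_def] M'_def[abs_def] A'_def[abs_def]
        by (rule fst[OF sy] fst[OF snd[OF sy]] fst[OF snd[OF snd[OF sy]]] snd[OF snd[OF snd[OF sy]]])+
    qed
    have cy: "continuous_on (from_null ` cbox a b) (\<lambda>p. y (to_null p))"
      by (rule continuous_on_compose2[OF y(1) linear_continuous_on[OF bl(2)]]) auto
    have cont: "continuous_on (from_null ` cbox a b) f" "continuous_on (from_null ` cbox a b) P'"
      "continuous_on (from_null ` cbox a b) M'" "continuous_on (from_null ` cbox a b) A'"
      unfolding f_def[abs_def] P'_def[abs_def] M'_def[abs_def] A'_def[abs_def]
      by (intro continuous_intros cy)+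
    have der: "dirder f X p = fst (dirder y (to_null X) (to_null p))"
      "dirder P' X p = fst (snd (dirder y (to_null X) (to_null p)))"
      "dirder M' X p = fst (snd (snd (dirder y (to_null X) (to_null p))))"
      "dirder A' X p = snd (snd (snd (dirder y (to_null X) (to_null p))))" if "p \<in> ?W" for X p
    proof -
      have q: "to_null p \<in> box a b" using that W by blast
      note h = has_derivative_linear_comp[OF bl(2) smooth_on_differentiable[OF y(3) q]]
      show "dirder f X p = fst (dirder y (to_null X) (to_null p))"
        unfolding f_def[abs_def] by (rule dirder_eqI) (intro has_derivative_fst h)
      show "dirder P' X p = fst (snd (dirder y (to_null X) (to_null p)))"
        unfolding P'_def[abs_def] by (rule dirder_eqI) (intro has_derivative_fst has_derivative_snd h)
      show "dirder M' X p = fst (snd (snd (dirder y (to_null X) (to_null p))))"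
        unfolding M'_def[abs_def] by (rule dirder_eqI) (intro has_derivative_fst has_derivative_snd h)
      show "dirder A' X p = snd (snd (snd (dirder y (to_null X) (to_null p))))"
        unfolding A'_def[abs_def] by (rule dirder_eqI) (intro has_derivative_snd h)
    qed
    have yq: "y (to_null p) = (f p, P' p, M' p, A' p)" for p
      by (simp add: f_def P'_def M'_def A'_def)
    have eqs: "d_p f p = P' p" "d_m f p = M' p"
      "d_p P' p = (2 * d_p lam p) *\<^sub>R P' p + 2 *\<^sub>R A' p" "d_m P' p = - (2 * L0 * exp (2 * lam p)) *\<^sub>R f p"
      "d_m M' p = (2 * d_m lam p) *\<^sub>R M' p + (2 * eps / d) *\<^sub>R A' p"
      "d_p A' p = - (d * exp (- 2 * lam p)) *\<^sub>R M' p" "d_m A' p = - (eps * exp (- 2 * lam p)) *\<^sub>R P' p"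
      if p: "p \<in> ?W" for p
    proof -
      have q: "to_null p \<in> box a b" using p W by blast
      show "d_p f p = P' p" "d_m f p = M' p"
        "d_p P' p = (2 * d_p lam p) *\<^sub>R P' p + 2 *\<^sub>R A' p" "d_m P' p = - (2 * L0 * exp (2 * lam p)) *\<^sub>R f p"
        "d_m M' p = (2 * d_m lam p) *\<^sub>R M' p + (2 * eps / d) *\<^sub>R A' p"
        "d_p A' p = - (d * exp (- 2 * lam p)) *\<^sub>R M' p" "d_m A' p = - (eps * exp (- 2 * lam p)) *\<^sub>R P' p"
        using y(4)[OF q] y(5)[OF q]
        by (simp_all add: der[OF p] yq app al_def be_def ga_def de_def et_def)
    qed
    have W\<Omega>: "?W \<subseteq> \<Omega>" using ab(2) box_subset_cbox[of a b] by auto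
    have ad: "adapted_on L0 d eps ?W lam f A'"
      unfolding adapted_on_def
    proof (intro conjI ballI smooth smooth_on_subset[OF W\<Omega> lam])
      fix p assume p: "p \<in> ?W"
      have c: "dirder (d_p f) X p = dirder P' X p" "dirder (d_m f) X p = dirder M' X p" for X
        using dirder_cong_open[OF opW p eqs(1)] dirder_cong_open[OF opW p eqs(2)] by auto
      show "d_p (d_p f) p = (2 * d_p lam p) *\<^sub>R d_p f p + 2 *\<^sub>R A' p"
        "d_m (d_p f) p = - (2 * L0 * exp (2 * lam p)) *\<^sub>R f p"
        "d_m (d_m f) p = (2 * d_m lam p) *\<^sub>R d_m f p + (2 * eps / d) *\<^sub>R A' p"
        "d_p A' p = - (d * exp (- 2 * lam p)) *\<^sub>R d_m f p"
        "d_m A' p = - (eps * exp (- 2 * lam p)) *\<^sub>R d_p f p"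
        unfolding c by (simp_all add: eqs[OF p])
    qed
    have ini: "f (from_null a) = x" "P' (from_null a) = P" "M' (from_null a) = M" "A' (from_null a) = A"
      using y(2) by (simp_all add: f_def P'_def M'_def A'_def)
    show "\<exists>f P' M' A'. adapted_on L0 d eps ?W lam f A' \<and>
      continuous_on (from_null ` cbox a b) f \<and> continuous_on (from_null ` cbox a b) P' \<and>
      continuous_on (from_null ` cbox a b) M' \<and> continuous_on (from_null ` cbox a b) A' \<and>
      f (from_null a) = x \<and> P' (from_null a) = P \<and> M' (from_null a) = M \<and> A' (from_null a) = A \<and>
      (\<forall>p\<in>?W. d_p f p = P' p \<and> d_m f p = M' p)"
      by (rule exI[of _ f], rule exI[of _ P'], rule exI[of _ M'], rule exI[of _ A'])
        (intro conjI ad cont ini ballI eqs(1,2))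
  qed
qed

text \<open>The Gram relations are imposed at the corner, where the initial values are prescribed.
  The frame expansion is constant on the open box and continuous up to the corner, so it is the
  identity throughout.\<close>

lemma adapted_surface_exists:
  fixes S :: "'n::finite set"
  assumes dim: "CARD('n) = (if L0 = 0 then 4 else 5)" and index: "card S = (if L0 < 0 then 3 else 2)"
    and \<Omega>: "open \<Omega>" "p0 \<in> \<Omega>" and lam: "smooth_on \<Omega> lam" and d: "d \<noteq> 0"
    and wave: "\<And>p. p \<in> \<Omega> \<Longrightarrow> d_m (d_p lam) p = - L0 * exp (2 * lam p) + eps * exp (- 2 * lam p)"
  obtains U f A C where "open U" "connected U" "p0 \<in> U" "U \<subseteq> \<Omega>" "adapted_on L0 d eps U lam f A"
    "\<And>p. p \<in> U \<Longrightarrow> frame_gram S L0 (exp (2 * lam p)) d (f p) (d_p f p) (d_m f p) (A p) C"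
proof -
  obtain a b where ab: "p0 \<in> from_null ` box a b" "from_null ` cbox a b \<subseteq> \<Omega>" and
    sol: "\<And>x P M A :: real^'n. \<exists>f P' M' A'. adapted_on L0 d eps (from_null ` box a b) lam f A' \<and>
      continuous_on (from_null ` cbox a b) f \<and> continuous_on (from_null ` cbox a b) P' \<and>
      continuous_on (from_null ` cbox a b) M' \<and> continuous_on (from_null ` cbox a b) A' \<and>
      f (from_null a) = x \<and> P' (from_null a) = P \<and> M' (from_null a) = M \<and> A' (from_null a) = A \<and>
      (\<forall>p\<in>from_null ` box a b. d_p f p = P' p \<and> d_m f p = M' p)"
    using adapted_solution[OF \<Omega> lam d wave, where ?'n = 'n] by blast
  let ?a = "from_null a" and ?W = "from_null ` box a b" and ?R = "from_null ` cbox a b"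
  have "box a b \<noteq> {}" using ab(1) by auto
  then have cl: "closure (box a b) = cbox a b" and aR: "a \<in> cbox a b"
    using box_ne_empty(2)[of a b] by (auto simp: closure_box mem_box less_imp_le)
  obtain x P M A C where g: "frame_gram S L0 (exp (2 * lam ?a)) d x P M A C"
    by (rule frame_gram_exists[OF dim index exp_gt_zero d])
  obtain f P' M' A' where f: "adapted_on L0 d eps ?W lam f A'" and
    cont: "continuous_on ?R f" "continuous_on ?R P'" "continuous_on ?R M'" "continuous_on ?R A'" and
    init: "f ?a = x" "P' ?a = P" "M' ?a = M" "A' ?a = A" and
    der: "\<And>p. p \<in> ?W \<Longrightarrow> d_p f p = P' p \<and> d_m f p = M' p"
    using sol[of x P M A] by blast
  have opW: "open ?W"
    unfolding from_null_image by (rule open_vimage_linear[OF bounded_linear_null(2) open_box])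
  have conW: "connected ?W"
    using connected_continuous_image[OF linear_continuous_on[OF bounded_linear_null(1)]
        convex_connected[OF convex_box(2)]] .
  show ?thesis
  proof (rule that[OF opW conW ab(1) _ f])
    show "?W \<subseteq> \<Omega>" using ab(2) box_subset_cbox[of a b] by auto
    fix p assume p: "p \<in> ?W"
    have "frame_sum S L0 (exp (2 * lam p)) d (f p) (d_p f p) (d_m f p) (A' p) C v = v" for v
    proof -
      \<comment> \<open>Written with \<open>P'\<close> and \<open>M'\<close> instead of derivatives
        of f, since only the former are known to extend continuously to the corner.\<close>
      define h where "h q = frame_sum S L0 (exp (2 * lam (from_null q))) d (f (from_null q)) (P' (from_null q))
        (M' (from_null q)) (A' (from_null q)) C v" for q
      have hconst: "h q = frame_sum S L0 (exp (2 * lam p)) d (f p) (d_p f p) (d_m f p) (A' p) C v" if "q \<in> box a b" for q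
      proof -
        have q: "from_null q \<in> ?W" using that by simp
        have "h q = frame_sum S L0 (exp (2 * lam (from_null q))) d (f (from_null q)) (d_p f (from_null q))
            (d_m f (from_null q)) (A' (from_null q)) C v"
          unfolding h_def using der[OF q] by simp
        then show ?thesis
          unfolding frame_sum_eq_frame_map using frame_map_constant[OF opW conW d f f q p] by simp
      qed
      have c: "continuous_on (cbox a b) (\<lambda>q. g (from_null q))" if "continuous_on ?R g" for g :: "_ \<Rightarrow> 'z::topological_space"
        by (rule continuous_on_compose2[OF that linear_continuous_on[OF bounded_linear_null(1)]]) auto
      have cl': "continuous_on ?R lam"
        by (rule continuous_on_subset[OF smooth_on_continuous_on[OF lam] ab(2)])
      have "continuous_on (closure (box a b)) h"
        unfolding cl h_def[abs_def] frame_sum_def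
        by (intro continuous_intros pinner.continuous_on c cont cl') (use d in auto)
      from continuous_constant_on_closure[OF this hconst] aR cl
      have "h a = frame_sum S L0 (exp (2 * lam p)) d (f p) (d_p f p) (d_m f p) (A' p) C v" by blast
      moreover have "h a = v"
        unfolding h_def init using g frame_gram_iff[OF dim _ d] by (metis exp_not_eq_zero)
      ultimately show ?thesis by simp
    qed
    then show "frame_gram S L0 (exp (2 * lam p)) d (f p) (d_p f p) (d_m f p) (A' p) C"
      by (simp add: frame_gram_iff[OF dim _ d])
  qed
qed

section \<open>Change of paracomplex coordinates\<close>

text \<open>The vectors (1, 1) and (1, - 1) are twice the idempotents (1 + j) / 2 and (1 - j) / 2,
  so paracomplex multiplication merely rescales them.\<close>

lemma paraholomorphic_null_directions:
  assumes t: "paraholomorphic_on W t" and q: "q \<in> W"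
  shows "dirder t (1, 1) q = fst (dirder t (1, 1) q) *\<^sub>R (1, 1)"
    "dirder t (1, - 1) q = fst (dirder t (1, - 1) q) *\<^sub>R (1, - 1)"
proof -
  obtain z where z: "(t has_derivative pc_mult z) (at q)"
    using t q by (auto simp: paraholomorphic_on_def)
  show "dirder t (1, 1) q = fst (dirder t (1, 1) q) *\<^sub>R (1, 1)"
    "dirder t (1, - 1) q = fst (dirder t (1, - 1) q) *\<^sub>R (1, - 1)"
    using dirder_eqI[OF z] by (simp_all add: pc_mult_def)
qed

context zmc_surface
begin

text \<open>The null directions are preserved with factors m and n, so second derivatives transform
  by m^2 and n^2 up to tangential terms, and these drop out by normality. Thus both the nonvanishing
  of <A, B> and the proportionality of \<open>A\<close> and \<open>B\<close> are independent of the
  coordinate.\<close>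

lemma change_of_coordinates:
  fixes t :: "paracomplex \<Rightarrow> paracomplex" and f' :: "paracomplex \<Rightarrow> real^'a"
  assumes W: "open W" "W \<subseteq> U" and W': "open W'" "t ` W = W'" and t: "paraholomorphic_on W t"
    and f': "smooth_on W' f'" and ft: "\<And>q. q \<in> W \<Longrightarrow> f q = f' (t q)"
    and conf': "conformal_metric_on S W' f' lam'"
  shows "zmc_immersion_on S L0 W' f' lam'"
    and "q \<in> W \<Longrightarrow> fst (d_p t q) \<noteq> 0" and "q \<in> W \<Longrightarrow> fst (d_m t q) \<noteq> 0"
    and "q \<in> W \<Longrightarrow> A q = (fst (d_p t q))\<^sup>2 *\<^sub>R sff_p f' lam' (t q)"
    and "q \<in> W \<Longrightarrow> B q = (fst (d_m t q))\<^sup>2 *\<^sub>R sff_m f' lam' (t q)"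
proof -
  have f'_in: "f' ` W' \<subseteq> space_form S L0"
    using f_in ft W W' by force
  interpret c: conformal_surface S L0 W' f' lam'
    by unfold_locales (use W' f' f'_in conf' in auto)
  have st: "smooth_on W t" using t by (simp add: paraholomorphic_on_def)
  define m n where "m q = fst (d_p t q)" and "n q = fst (d_m t q)" for q
  have smn: "smooth_on W m" "smooth_on W n"
    unfolding m_def[abs_def] n_def[abs_def]
    by (rule smooth_on_linear_comp[OF bounded_linear_fst W(1) smooth_on_dirder[OF st]])+
  have dt: "dirder t (1, 1) q = m q *\<^sub>R (1, 1)" "dirder t (1, - 1) q = n q *\<^sub>R (1, - 1)" if "q \<in> W" for q
    using paraholomorphic_null_directions[OF t that] by (simp_all add: m_def n_def)
  have chain: "dirder (\<lambda>q. g (t q)) (1, 1) q = m q *\<^sub>R d_p g (t q)" "dirder (\<lambda>q. g (t q)) (1, - 1) q = n q *\<^sub>R d_m g (t q)"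
    and chain_diff: "(\<lambda>q. g (t q)) differentiable (at q)"
    if g: "smooth_on W' g" and q: "q \<in> W" for g :: "paracomplex \<Rightarrow> real^'a" and q
  proof -
    have tq: "t q \<in> W'" using q W' by blast
    have dg: "g differentiable (at (t q))" by (rule smooth_on_differentiable[OF g tq])
    have lin: "linear (\<lambda>e. dirder g e (t q))" using dg by (simp add: linear_frechet_derivative)
    have tt: "t differentiable (at q)" by (rule smooth_on_differentiable[OF st q])
    show "dirder (\<lambda>q. g (t q)) (1, 1) q = m q *\<^sub>R d_p g (t q)" "dirder (\<lambda>q. g (t q)) (1, - 1) q = n q *\<^sub>R d_m g (t q)"
      using dirder_compose[OF tt dg, of "(1, 1)"] dirder_compose[OF tt dg, of "(1, - 1)"]
        linear_scale[OF lin, of "m q" "(1, 1)"] linear_scale[OF lin, of "n q" "(1, - 1)"] dt[OF q] by simp_all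
    show "(\<lambda>q. g (t q)) differentiable (at q)"
      using has_derivative_compose[where f = t and g = g, OF differentiable_has_dirder[OF tt] differentiable_has_dirder[OF dg]]
      unfolding differentiable_def by blast
  qed
  have f1: "d_p f q = m q *\<^sub>R d_p f' (t q)" "d_m f q = n q *\<^sub>R d_m f' (t q)" if q: "q \<in> W" for q
    using dirder_cong_open[OF W(1) q ft] chain[OF f' q] by simp_all
  note sf' = smooth_on_dirder[OF f']
  have f2: "dirder (d_p f) (1, 1) q = (m q * m q) *\<^sub>R d_p (d_p f') (t q) + d_p m q *\<^sub>R d_p f' (t q)"
    "dirder (d_p f) (1, - 1) q = (m q * n q) *\<^sub>R d_m (d_p f') (t q) + d_m m q *\<^sub>R d_p f' (t q)"
    "dirder (d_m f) (1, - 1) q = (n q * n q) *\<^sub>R d_m (d_m f') (t q) + d_m n q *\<^sub>R d_m f' (t q)" if q: "q \<in> W" for q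
  proof -
    have d: "m differentiable (at q)" "n differentiable (at q)" using smn q by (auto intro: smooth_on_differentiable)
    have "dirder (d_p f) X q = dirder (\<lambda>q. m q *\<^sub>R d_p f' (t q)) X q" "dirder (d_m f) X q = dirder (\<lambda>q. n q *\<^sub>R d_m f' (t q)) X q" for X
      by (rule dirder_cong_open[OF W(1) q f1(1)] dirder_cong_open[OF W(1) q f1(2)], assumption)+
    then show "dirder (d_p f) (1, 1) q = (m q * m q) *\<^sub>R d_p (d_p f') (t q) + d_p m q *\<^sub>R d_p f' (t q)"
      "dirder (d_p f) (1, - 1) q = (m q * n q) *\<^sub>R d_m (d_p f') (t q) + d_m m q *\<^sub>R d_p f' (t q)"
      "dirder (d_m f) (1, - 1) q = (n q * n q) *\<^sub>R d_m (d_m f') (t q) + d_m n q *\<^sub>R d_m f' (t q)"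
      using d chain_diff[OF sf' q] by (simp_all add: chain[OF sf' q])
  qed
  have all: "m q \<noteq> 0 \<and> n q \<noteq> 0 \<and> A q = (m q)\<^sup>2 *\<^sub>R sff_p f' lam' (t q) \<and> B q = (n q)\<^sup>2 *\<^sub>R sff_m f' lam' (t q) \<and>
    d_m (d_p f') (t q) = - ((2 * L0 * c.E (t q)) *\<^sub>R f' (t q))" if q: "q \<in> W" for q
  proof -
    have tq: "t q \<in> W'" and qU: "q \<in> U" using q W W' by auto
    note nl = null[OF qU, unfolded f1[OF q]]
    have EE: "E q = m q * n q * c.E (t q)"
      using nl(3) c.null(3)[OF tq] by (simp add: pinner_simps) (simp add: mult_ac)
    then have mn: "m q \<noteq> 0" "n q \<noteq> 0" by (metis exp_not_eq_zero mult_eq_0_iff)+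
    \<comment> \<open>The tangential remainders of the two transformation formulas; pairing with the
      opposite null derivative shows that they vanish.\<close>
    define x where "x = d_p m q / 2 - d_p lam q * m q + m q * m q * d_p lam' (t q)"
    define y where "y = d_m n q / 2 - d_m lam q * n q + n q * n q * d_m lam' (t q)"
    have Ax: "A q = (m q * m q) *\<^sub>R sff_p f' lam' (t q) + x *\<^sub>R d_p f' (t q)"
      unfolding sff_p_def f2[OF q] f1[OF q] x_def by (simp add: vec_eq_iff) (simp add: field_simps)
    have By: "B q = (n q * n q) *\<^sub>R sff_m f' lam' (t q) + y *\<^sub>R d_m f' (t q)"
      unfolding sff_m_def f2[OF q] f1[OF q] y_def by (simp add: vec_eq_iff) (simp add: field_simps)
    have o: "pinner S (sff_p f' lam' (t q)) (d_m f' (t q)) = 0" "pinner S (sff_m f' lam' (t q)) (d_p f' (t q)) = 0"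
      by (simp_all add: sff_p_def sff_m_def pinner_simps c.second_null[OF tq] c.null[OF tq])
    have "pinner S (A q) (d_m f' (t q)) = 0" "pinner S (B q) (d_p f' (t q)) = 0"
      using normal_AB(2,4)[OF qU] mn unfolding f1[OF q] by (simp_all add: pinner_simps)
    then have "x = 0" "y = 0"
      unfolding Ax By by (simp_all add: pinner_simps o c.null[OF tq])
    \<comment> \<open>The mixed derivative of f is normal, so the tangential term with the
      derivative of m must vanish: each null coordinate depends on one null coordinate only.\<close>
    moreover have dm0: "d_m m q = 0"
      using second_null(6)[OF qU] mn unfolding f2[OF q] f1[OF q]
      by (simp add: pinner_simps c.null[OF tq] c.second_null[OF tq])
    have "(m q * n q) *\<^sub>R d_m (d_p f') (t q) = (m q * n q) *\<^sub>R (- ((2 * L0 * c.E (t q)) *\<^sub>R f' (t q)))"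
      using wave_f[OF qU] unfolding f2[OF q] dm0 EE ft[OF q] by (simp add: mult_ac)
    then have "d_m (d_p f') (t q) = - ((2 * L0 * c.E (t q)) *\<^sub>R f' (t q))"
      using mn by (simp only: scaleR_cancel_left) simp
    ultimately show ?thesis using mn Ax By by (simp add: power2_eq_square)
  qed
  then show "zmc_immersion_on S L0 W' f' lam'"
    unfolding c.zmc_iff using W'(2) by blast
  show "q \<in> W \<Longrightarrow> fst (d_p t q) \<noteq> 0" and "q \<in> W \<Longrightarrow> fst (d_m t q) \<noteq> 0"
    and "q \<in> W \<Longrightarrow> A q = (fst (d_p t q))\<^sup>2 *\<^sub>R sff_p f' lam' (t q)"
    and "q \<in> W \<Longrightarrow> B q = (fst (d_m t q))\<^sup>2 *\<^sub>R sff_m f' lam' (t q)"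
    using all unfolding m_def n_def by blast+
qed

end

section \<open>Construction of the normal form\<close>

text \<open>A nonnull vector orthogonal to the given ones exists by a dimension count; that its
  square has the sign opposite to d follows from the signature, after which it only has to be
  scaled.\<close>

lemma frame_completion:
  fixes S :: "'n::finite set"
  assumes dim: "CARD('n) = (if L0 = 0 then 4 else 5)" and index: "card S = (if L0 < 0 then 3 else 2)"
    and E: "E > 0" and d: "d \<in> {1, - 1}"
    and x: "L0 * pinner S x x = (if L0 = 0 then 0 else 1)" "L0 * pinner S P x = 0" "L0 * pinner S M x = 0" "L0 * pinner S A x = 0"
    and PMA: "pinner S P P = 0" "pinner S M M = 0" "pinner S P M = 2 * E" "pinner S A P = 0" "pinner S A M = 0" "pinner S A A = d"
  obtains C where "frame_gram S L0 E d x P M A C"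
proof -
  \<comment> \<open>An orthogonal basis of the tangent plane with squares 4 E and - 4 E, as the
    lemmas on orthogonal systems need nonnull vectors.\<close>
  define u v where "u = P + M" and "v = P - M"
  define X where "X = (if L0 = 0 then {} else {x})"
  have MP: "pinner S M P = 2 * E" using PMA(3) pinner_commute[of S P M] by simp
  have PA: "pinner S P A = 0" "pinner S M A = 0"
    using PMA(4,5) pinner_commute[of S A P] pinner_commute[of S A M] by simp_all
  have sq: "pinner S u u = 4 * E" "pinner S v v = - 4 * E" "pinner S u v = 0" "pinner S v u = 0"
    "pinner S A u = 0" "pinner S u A = 0" "pinner S A v = 0" "pinner S v A = 0"
    by (simp_all add: u_def v_def pinner_simps PMA MP PA)
  have xo: "pinner S w x = 0 \<and> pinner S x w = 0" if "w \<in> {u, v, A}" "L0 \<noteq> 0" for w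
    using x that pinner_commute[of S x w] by (auto simp: u_def v_def pinner_simps)
  have xx: "L0 \<noteq> 0 \<Longrightarrow> pinner S x x = 1 / L0" using x(1) by (auto simp: field_simps)
  have dn: "d \<noteq> 0" using d by auto
  have nz: "pinner S w w \<noteq> 0" if "w \<in> {u, v, A} \<union> X" for w
    using that E PMA(6) sq xx dn by (auto simp: X_def split: if_splits)
  have orth: "pairwise (\<lambda>v w. pinner S v w = 0) ({u, v, A} \<union> X)"
    unfolding pairwise_def using sq xo by (auto simp: X_def)
  have ne: "w \<noteq> w'" if "pinner S w w' = 0" "pinner S w w \<noteq> 0" for w w' using that by auto
  have dist: "u \<noteq> v" "u \<noteq> A" "v \<noteq> A" "L0 \<noteq> 0 \<Longrightarrow> u \<noteq> x" "L0 \<noteq> 0 \<Longrightarrow> v \<noteq> x" "L0 \<noteq> 0 \<Longrightarrow> A \<noteq> x"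
    using ne[of u v] ne[of u A] ne[of v A] ne[of u x] ne[of v x] ne[of A x] sq xo E PMA(6) dn by auto
  have "Suc (card ({u, v, A} \<union> X)) = CARD('n)"
    using dist dim by (auto simp: X_def card_insert_if)
  from orthogonal_vector_exists[OF _ orth nz this]
  obtain z where z: "pinner S z z \<noteq> 0" "\<And>w. w \<in> {u, v, A} \<union> X \<Longrightarrow> pinner S z w = 0"
    by (metis finite.emptyI finite.insertI finite_Un X_def)
  have zw: "pinner S z w = 0 \<and> pinner S w z = 0" if "w \<in> {u, v, A} \<union> X" for w
    using z(2)[OF that] pinner_commute[of S z w] by simp
  have zne: "z \<noteq> u" "z \<noteq> v" "z \<noteq> A" "L0 \<noteq> 0 \<Longrightarrow> z \<noteq> x"
    using z(1) zw[of u] zw[of v] zw[of A] zw[of x] by (auto simp: X_def)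
  have orthz: "pairwise (\<lambda>v w. pinner S v w = 0) (insert z ({u, v, A} \<union> X))"
    using orth zw by (auto simp: pairwise_insert)
  have cS: "card (- S) = (if L0 > 0 then 3 else 2)"
    using dim index by (auto simp: Compl_eq_Diff_UNIV card_Diff_subset split: if_splits)
  \<comment> \<open>Were the signs of z and \<open>A\<close> equal, then z, \<open>A\<close>, one of
    u and v, and the position vector if its square has that sign too, would be one orthogonal vector
    of that sign more than the signature allows.\<close>
  have sgn: "d * pinner S z z < 0"
  proof (rule ccontr)
    assume "\<not> d * pinner S z z < 0"
    then have pos: "d * pinner S z z > 0" using z(1) dn by (simp add: not_less less_le)
    show False
    proof (cases "d = 1")
      case True
      define Y where "Y = insert z ({u, A} \<union> (if L0 > 0 then {x} else {}))"
      have "card Y \<le> card (- S)"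
      proof (rule card_positive_le)
        show "pairwise (\<lambda>v w. pinner S v w = 0) Y"
          by (rule pairwise_subset[OF orthz]) (auto simp: Y_def X_def)
        show "pinner S w w > 0" if "w \<in> Y" for w
          using that pos True E PMA(6) sq xx by (auto simp: Y_def split: if_splits)
      qed (simp add: Y_def)
      moreover have "card Y = (if L0 > 0 then 4 else 3)"
        using dist zne by (auto simp: Y_def card_insert_if)
      ultimately show False using cS by (auto split: if_splits)
    next
      case False
      then have d1: "d = - 1" using d by simp
      define Y where "Y = insert z ({v, A} \<union> (if L0 < 0 then {x} else {}))"
      have "card Y \<le> card S"
      proof (rule card_negative_le)
        show "pairwise (\<lambda>v w. pinner S v w = 0) Y"
          by (rule pairwise_subset[OF orthz]) (auto simp: Y_def X_def)
        show "pinner S w w < 0" if "w \<in> Y" for w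
          using that pos d1 E PMA(6) sq xx by (auto simp: Y_def split: if_splits)
      qed (simp add: Y_def)
      moreover have "card Y = (if L0 < 0 then 4 else 3)"
        using dist zne by (auto simp: Y_def card_insert_if)
      ultimately show False using index by (auto split: if_splits)
    qed
  qed
  define s where "s = sqrt \<bar>pinner S z z\<bar>"
  have s: "s * s = \<bar>pinner S z z\<bar>" "s \<noteq> 0" using z(1) by (simp_all add: s_def)
  define C where "C = (1 / s) *\<^sub>R z"
  have CC: "pinner S C C = - d"
    using sgn d s z(1) by (auto simp: C_def pinner_simps field_simps abs_if split: if_splits)
  have zPM: "pinner S z P = 0" "pinner S z M = 0"
    using zw[of u] zw[of v] by (auto simp: u_def v_def pinner_simps)
  have "frame_gram S L0 E d x P M A C"
    unfolding frame_gram_def using x PMA CC zPM zw[of A] zw[of x] by (auto simp: C_def pinner_simps X_def)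
  then show thesis by (rule that)
qed

text \<open>A primitive of exp w is strictly increasing. Its inverse satisfies psi' = exp (- w psi),
  an equation that expresses the derivative through psi itself and so bootstraps its
  smoothness.\<close>

lemma interval_reparametrization:
  fixes w :: "real \<Rightarrow> real"
  assumes ab: "a < b" and V: "open V" "{a..b} \<subseteq> V" and w: "smooth_on V w"
  obtains phi psi :: "real \<Rightarrow> real" where "\<And>x. x \<in> {a<..<b} \<Longrightarrow> (phi has_real_derivative exp (w x)) (at x)"
    "\<And>x. x \<in> {a<..<b} \<Longrightarrow> psi (phi x) = x" "open (phi ` {a<..<b})" "connected (phi ` {a<..<b})"
    "smooth_on {a<..<b} phi" "smooth_on (phi ` {a<..<b}) psi"
    "\<And>y. y \<in> phi ` {a<..<b} \<Longrightarrow> (psi has_real_derivative exp (- w (psi y))) (at y)"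
proof -
  let ?I = "{a<..<b}"
  have cont: "continuous_on {a..b} (\<lambda>x. exp (w x))"
    by (intro continuous_intros continuous_on_subset[OF smooth_on_continuous_on[OF w] V(2)])
  obtain phi where phi: "\<And>x. x \<in> {a..b} \<Longrightarrow> (phi has_vector_derivative exp (w x)) (at x within {a..b})"
    using antiderivative_continuous[OF cont] by blast
  have der: "(phi has_real_derivative exp (w x)) (at x)" if "x \<in> ?I" for x
    using phi[of x] that at_within_Icc_at[of a x b] by (simp add: has_real_derivative_iff_has_vector_derivative)
  have mono: "phi x < phi y" if "x \<in> ?I" "y \<in> ?I" "x < y" for x y
    using that by (intro DERIV_pos_imp_increasing[OF that(3)] exI conjI) (rule der, auto)
  have inj: "inj_on phi ?I" by (rule inj_onI) (metis mono linorder_neqE_linordered_idom less_irrefl)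
  have cphi: "continuous_on ?I phi"
    using der DERIV_isCont by (blast intro: continuous_at_imp_continuous_on)
  have opn: "open (phi ` ?I)"
    using injective_eq_1d_open_map_UNIV[OF cphi] inj by (auto simp: is_interval_connected_1)
  define psi where "psi = inv_into ?I phi"
  have psi: "psi (phi x) = x" if "x \<in> ?I" for x using inv_into_f_f[OF inj that] by (simp add: psi_def)
  have dpsi: "(psi has_real_derivative exp (- w (psi y))) (at y)" if "y \<in> phi ` ?I" for y
  proof -
    obtain x where x: "x \<in> ?I" "y = phi x" using \<open>y \<in> phi ` ?I\<close> by blast
    have "(psi has_derivative (\<lambda>h. exp (- w x) * h)) (at (phi x))"
      by (rule has_derivative_inverse_strong[where S = ?I, OF _ x(1) cphi psi der[OF x(1), unfolded has_field_derivative_def]])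
        (auto simp: fun_eq_iff simp flip: exp_add mult.assoc)
    then show ?thesis by (simp add: x psi[OF x(1)] has_field_derivative_def)
  qed
  have IV: "?I \<subseteq> V" using V(2) by (auto simp: subset_iff)
  have sphi: "smooth_on ?I phi"
  proof (rule smooth_onI[where f' = "\<lambda>e x. exp (w x) * e"])
    show "smooth_on ?I (\<lambda>x. exp (w x) * e)" for e
      by (intro smooth_on_intros smooth_on_subset[OF IV w] open_greaterThanLessThan)
  qed (use der in \<open>auto simp: has_field_derivative_def\<close>)
  have spsi: "smooth_on (phi ` ?I) psi"
  proof (rule smooth_on_bootstrap[OF opn, where f' = "\<lambda>e y. exp (- w (psi y)) * e"])
    show "continuous_on (phi ` ?I) psi"
      using dpsi DERIV_isCont by (blast intro: continuous_at_imp_continuous_on)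
    fix k e assume k: "differentiable_upto k (phi ` ?I) psi"
    have "smooth_on V (\<lambda>x. exp (- w x) * e)"
      by (intro smooth_on_intros w V)
    then show "differentiable_upto k (phi ` ?I) (\<lambda>y. exp (- w (psi y)) * e)"
      by (rule differentiable_upto_compose[OF opn k]) (use psi IV in auto)
  qed (use dpsi in \<open>auto simp: has_field_derivative_def\<close>)
  have con: "connected (phi ` ?I)" by (rule connected_continuous_image[OF cphi]) simp
  show thesis by (rule that[OF der psi opn con sphi spsi dpsi])
qed

text \<open>Acting on each null coordinate separately, the derivative is diagonal in the null basis.
  A diagonal map with entries a and b is multiplication by the paracomplex number (a + b) / 2 + j (a
  - b) / 2.\<close>

lemma paraholomorphic_on_null:
  fixes I J :: "real set"
  assumes IJ: "open I" "open J" and sm: "smooth_on I phi" "smooth_on J psi"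
    and der: "\<forall>x\<in>I. (phi has_real_derivative phi' x) (at x)"
      "\<forall>x\<in>J. (psi has_real_derivative psi' x) (at x)"
  defines "R \<equiv> to_null -` (I \<times> J)" and "t \<equiv> \<lambda>p. from_null (phi (fst (to_null p)), psi (snd (to_null p)))"
  shows "open R" "paraholomorphic_on R t"
    "\<And>p. p \<in> R \<Longrightarrow> dirder t (1, 1) p = phi' (fst (to_null p)) *\<^sub>R (1, 1)"
    "\<And>p. p \<in> R \<Longrightarrow> dirder t (1, - 1) p = psi' (snd (to_null p)) *\<^sub>R (1, - 1)"
proof -
  note bl = bounded_linear_null
  show oR: "open R" unfolding R_def by (rule open_vimage_linear[OF bl(2) open_Times[OF IJ]])
  have "smooth_on R (\<lambda>p. phi (fst (to_null p)))" "smooth_on R (\<lambda>p. psi (snd (to_null p)))"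
    by (rule smooth_on_compose[OF oR _ sm(1)] smooth_on_compose[OF oR _ sm(2)],
        rule smooth_on_linear_comp[OF bounded_linear_fst oR smooth_on_bounded_linear[OF bl(2) oR]]
        smooth_on_linear_comp[OF bounded_linear_snd oR smooth_on_bounded_linear[OF bl(2) oR]], force simp: R_def)+
  then have st: "smooth_on R t"
    unfolding t_def by (intro smooth_on_linear_comp[OF bl(1) oR] smooth_on_Pair[OF oR])
  have dt: "(t has_derivative pc_mult ((phi' (fst (to_null p)) + psi' (snd (to_null p))) / 2,
      (phi' (fst (to_null p)) - psi' (snd (to_null p))) / 2)) (at p)" if p: "p \<in> R" for p
  proof -
    note n = bounded_linear_imp_has_derivative[OF bl(2), of "at p"]
    have "fst (to_null p) \<in> I" "snd (to_null p) \<in> J" using p by (auto simp: R_def)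
    note h = DERIV_compose_FDERIV[OF der(1)[THEN bspec, OF this(1)] has_derivative_fst[OF n]]
      DERIV_compose_FDERIV[OF der(2)[THEN bspec, OF this(2)] has_derivative_snd[OF n]]
    have "(t has_derivative (\<lambda>e. from_null (fst (to_null e) * phi' (fst (to_null p)), snd (to_null e) * psi' (snd (to_null p))))) (at p)"
      unfolding t_def by (rule bounded_linear.has_derivative[OF bl(1) has_derivative_Pair[OF h]])
    moreover have "from_null (fst (to_null e) * a, snd (to_null e) * b) = pc_mult ((a + b) / 2, (a - b) / 2) e" for e a b
      by (simp add: from_null_def to_null_def pc_mult_def field_simps)
    ultimately show ?thesis by simp
  qed
  show "paraholomorphic_on R t"
    unfolding paraholomorphic_on_def using st dt by blast
  fix p assume p: "p \<in> R"
  show "dirder t (1, 1) p = phi' (fst (to_null p)) *\<^sub>R (1, 1)"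
    "dirder t (1, - 1) p = psi' (snd (to_null p)) *\<^sub>R (1, - 1)"
    using dirder_eqI[OF dt[OF p]] by (simp_all add: pc_mult_def field_simps)
qed

lemma constant_along:
  fixes g :: "paracomplex \<Rightarrow> real" and J :: "real set"
  assumes g: "smooth_on V g" "\<And>p. p \<in> V \<Longrightarrow> dirder g e p = 0"
    and J: "open J" "connected J" "\<And>s. s \<in> J \<Longrightarrow> p + s *\<^sub>R e \<in> V" and s: "s \<in> J" "s' \<in> J"
  shows "g (p + s *\<^sub>R e) = g (p + s' *\<^sub>R e)"
proof (rule has_derivative_zero_unique_connected[OF J(1,2) _ s])
  fix r assume r: "r \<in> J"
  note d = smooth_on_has_derivative[OF g(1) J(3)[OF r]]
  have "((\<lambda>s. g (p + s *\<^sub>R e)) has_derivative (\<lambda>h. dirder g (h *\<^sub>R e) (p + r *\<^sub>R e))) (at r)"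
    by (rule has_derivative_compose[where g = g and f = "\<lambda>s. p + s *\<^sub>R e", OF _ d]) (auto intro!: derivative_eq_intros)
  then show "((\<lambda>s. g (p + s *\<^sub>R e)) has_derivative (\<lambda>h. 0)) (at r)"
    by (simp add: linear_scale[OF has_derivative_linear[OF d]] g(2)[OF J(3)[OF r]])
qed

text \<open>Proportionality of \<open>A\<close> and \<open>B\<close> gives <A, A> <B, B> = <A, B>^2
  > 0, so the two squares share a sign d and can both be normalized to it. Then <A, B> is a sign as
  well, namely \<open>eps\<close>, and the Gauss equation becomes the equation for the new conformal
  factor.\<close>

lemma (in zmc_surface) normal_form_coordinates:
  assumes dim: "CARD('a) = (if L0 = 0 then 4 else 5)" and index: "card S = (if L0 < 0 then 3 else 2)"
    and flat: "K_neq_and_normal_flat_on S L0 U f" and p0: "p0 \<in> U"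
  obtains R R' t t' lam' eps a1 a2 b1 b2 m1 m2 where
    "open R" "p0 \<in> R" "R \<subseteq> U" "open R'" "t ` R = R'" "t' ` R' = R"
    "\<And>p. p \<in> R \<Longrightarrow> t' (t p) = p" "\<And>p. p \<in> R' \<Longrightarrow> t (t' p) = p"
    "paraholomorphic_on R t" "paraholomorphic_on R' t'"
    "conformal_metric_on S R' (\<lambda>p. f (t' p)) lam'" "star_on L0 R' eps lam'"
    "associated_functions_on S L0 R' (\<lambda>p. f (t' p)) lam' a1 a2 b1 b2 m1 m2"
    "double_star_on R' eps lam' a1 a2 b1 b2 m1 m2"
proof -
  note bl = bounded_linear_null
  define g h l where "g p = pinner S (A p) (A p)" and "h p = pinner S (B p) (B p)" and "l p = pinner S (A p) (B p)" for p
  have sm: "smooth_on U g" "smooth_on U h" "smooth_on U l"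
    unfolding g_def[abs_def] h_def[abs_def] l_def[abs_def] by (intro smooth_on_pinner open_U smooth_A smooth_B)+
  have par: "l p \<noteq> 0 \<and> (\<exists>k. B p = k *\<^sub>R A p)" if "p \<in> U" for p
    using flat that unfolding K_neq_and_normal_flat_iff l_def by blast
  have gl: "g p \<noteq> 0" "h p * g p = l p * l p" if "p \<in> U" for p
    using par[OF that] by (auto simp: g_def h_def l_def pinner_simps)
  have dg: "d_m g p = 0" "d_p h p = 0" if "p \<in> U" for p
    unfolding g_def[abs_def] h_def[abs_def] using that pinner_commute[of S "d_p f p" "A p"] pinner_commute[of S "d_m f p" "B p"]
    by (simp_all add: d_m_A d_p_B pinner_simps normal_AB)
  \<comment> \<open>The part of U on which <A, A> and <A, B> keep the signs that they have at
    \<open>p0\<close>, so that logarithms can be taken.\<close>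
  define U1 where "U1 = U \<inter> (\<lambda>p. g p * g p0) -` {0<..} \<inter> (U \<inter> (\<lambda>p. l p * l p0) -` {0<..})"
  have oU1: "open U1" unfolding U1_def
    by (intro open_Int continuous_open_preimage open_U open_greaterThan continuous_on_mult continuous_on_const
        smooth_on_continuous_on[OF sm(1)] smooth_on_continuous_on[OF sm(3)])
  define d eps where "d = sgn (g p0)" and "eps = sgn (l p0)"
  have de: "d \<in> {1, - 1}" "eps \<in> {1, - 1}" "d \<noteq> 0" "eps \<noteq> 0" "d * d = 1"
    using gl(1)[OF p0] par[OF p0] by (auto simp: d_def eps_def sgn_if)
  have U1: "p \<in> U" "d * g p > 0" "d * h p > 0" "eps * l p > 0" if "p \<in> U1" for p
  proof -
    show pU: "p \<in> U" using that by (simp add: U1_def)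
    show dg: "d * g p > 0" and "eps * l p > 0"
      using that unfolding U1_def d_def eps_def by (auto simp: sgn_if zero_less_mult_iff split: if_splits)
    have "(d * h p) * (d * g p) = (l p * l p) * (d * d)" using gl(2)[OF pU] by (simp add: mult_ac)
    also have "\<dots> > 0" using par[OF pU] de by (simp add: zero_less_mult_iff) linarith
    finally show "d * h p > 0" using dg by (simp add: zero_less_mult_iff)
  qed
  have p01: "p0 \<in> U1" using p0 gl(1)[OF p0] par[OF p0] by (simp add: U1_def zero_less_mult_iff) linarith
  have oN: "open (from_null -` U1)" by (rule open_vimage_linear[OF bl(1) oU1])
  obtain x0 y0 where xy0: "to_null p0 = (x0, y0)" by (cases "to_null p0")
  then have p0': "p0 = from_null (x0, y0)" by (metis null_inverse(1))
  obtain a b where ab: "cbox a b \<subseteq> from_null -` U1" "(x0, y0) \<in> box a b"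
  proof -
    have "(x0, y0) \<in> from_null -` U1" using p01 p0' by simp
    from open_contains_cbox[OF oN this] that show thesis by blast
  qed
  obtain s1 s2 e1 e2 where ab': "a = (s1, s2)" "b = (e1, e2)" by (cases a, cases b)
  define I J where "I = {s1<..<e1}" and "J = {s2<..<e2}"
  have x0: "x0 \<in> I" "y0 \<in> J" using ab(2) unfolding ab' I_def J_def by (auto simp: box_def Basis_prod_def)
  have se: "s1 < e1" "s2 < e2" using x0 by (auto simp: I_def J_def)
  have Q: "from_null (x, y) \<in> U1" if "x \<in> {s1..e1}" "y \<in> {s2..e2}" for x y
  proof -
    have "(x, y) \<in> from_null -` U1"
      by (rule subsetD[OF ab(1)]) (use that in \<open>simp add: ab' cbox_Pair_eq\<close>)
    then show ?thesis by simp
  qed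
  have IQ: "I \<subseteq> {s1..e1}" "J \<subseteq> {s2..e2}" by (auto simp: I_def J_def)
  have fn: "from_null (x, y) = from_null (x, 0) + y *\<^sub>R (1, - 1)" "from_null (x, y) = from_null (0, y) + x *\<^sub>R (1, 1)" for x y
    by (simp_all add: from_null_def)
  have smU1: "smooth_on U1 g" "smooth_on U1 h" using sm U1(1) smooth_on_subset by blast+
  have dg1: "\<And>p. p \<in> U1 \<Longrightarrow> d_m g p = 0" "\<And>p. p \<in> U1 \<Longrightarrow> d_p h p = 0" using dg U1(1) by blast+
  have oIJ: "open I" "open J" by (simp_all add: I_def J_def)
  have gx: "g (from_null (x, y)) = g (from_null (x, y0))" if "x \<in> I" "y \<in> J" for x y
  proof -
    have "from_null (x, 0) + s *\<^sub>R (1, - 1) \<in> U1" if "s \<in> J" for s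
      unfolding fn(1)[symmetric] using Q IQ that \<open>x \<in> I\<close> by blast
    from constant_along[OF smU1(1) dg1(1) oIJ(2) _ this that(2) x0(2)]
    show ?thesis unfolding fn(1)[symmetric] by (simp add: J_def)
  qed
  have hy: "h (from_null (x, y)) = h (from_null (x0, y))" if "x \<in> I" "y \<in> J" for x y
  proof -
    have "from_null (0, y) + s *\<^sub>R (1, 1) \<in> U1" if "s \<in> I" for s
      unfolding fn(2)[symmetric] using Q IQ that \<open>y \<in> J\<close> by blast
    from constant_along[OF smU1(2) dg1(2) oIJ(1) _ this that(1) x0(1)]
    show ?thesis unfolding fn(2)[symmetric] by (simp add: I_def)
  qed
  \<comment> \<open>The factor 1/4 is due to <A, A> scaling with the fourth power of the derivative
    of the coordinate change. Each square is read off along one coordinate line through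
    \<open>p0\<close>, since it is constant in the other null coordinate.\<close>
  define w1 w2 where "w1 x = 1 / 4 * ln (d * g (from_null (x, y0)))" and "w2 y = 1 / 4 * ln (d * h (from_null (x0, y)))" for x y
  define V1 V2 where "V1 = (\<lambda>x. from_null (x, y0)) -` U1" and "V2 = (\<lambda>y. from_null (x0, y)) -` U1"
  have cn: "continuous_on UNIV (\<lambda>x. from_null (x, y0))" "continuous_on UNIV (\<lambda>y. from_null (x0, y))"
    unfolding from_null_def by (intro continuous_intros)+
  have oV: "open V1" "open V2" unfolding V1_def V2_def
    using cn oU1 by (auto intro: open_vimage)
  have sn: "smooth_on V1 (\<lambda>x. from_null (x, y0))" "smooth_on V2 (\<lambda>y. from_null (x0, y))"
    by (intro smooth_on_linear_comp[OF bl(1) oV(1)] smooth_on_linear_comp[OF bl(1) oV(2)] smooth_on_Pair smooth_on_id smooth_on_const oV)+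
  have pos: "\<And>x. x \<in> V1 \<Longrightarrow> 0 < d * g (from_null (x, y0))" "\<And>y. y \<in> V2 \<Longrightarrow> 0 < d * h (from_null (x0, y))"
    using U1(2,3) by (simp_all add: V1_def V2_def)
  have sg: "smooth_on V1 (\<lambda>x. g (from_null (x, y0)))"
    by (rule smooth_on_compose[OF oV(1) sn(1) smU1(1)]) (auto simp: V1_def)
  have sh: "smooth_on V2 (\<lambda>y. h (from_null (x0, y)))"
    by (rule smooth_on_compose[OF oV(2) sn(2) smU1(2)]) (auto simp: V2_def)
  have sw: "smooth_on V1 w1" "smooth_on V2 w2"
    unfolding w1_def[abs_def] w2_def[abs_def]
    by (rule smooth_on_mult[OF oV(1) smooth_on_const smooth_on_ln_comp[OF oV(1) smooth_on_mult[OF oV(1) smooth_on_const sg] pos(1)]],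
        assumption)
      (rule smooth_on_mult[OF oV(2) smooth_on_const smooth_on_ln_comp[OF oV(2) smooth_on_mult[OF oV(2) smooth_on_const sh] pos(2)]],
        assumption)
  have IV: "{s1..e1} \<subseteq> V1" "{s2..e2} \<subseteq> V2" using Q x0 IQ by (auto simp: V1_def V2_def)
  obtain phi phi' :: "real \<Rightarrow> real" where phi: "\<And>x. x \<in> I \<Longrightarrow> (phi has_real_derivative exp (w1 x)) (at x)"
    "\<And>x. x \<in> I \<Longrightarrow> phi' (phi x) = x" "open (phi ` I)" "connected (phi ` I)"
    "smooth_on I phi" "smooth_on (phi ` I) phi'"
    "\<And>y. y \<in> phi ` I \<Longrightarrow> (phi' has_real_derivative exp (- w1 (phi' y))) (at y)"
    unfolding I_def by (rule interval_reparametrization[OF se(1) oV(1) IV(1) sw(1)]) blast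
  obtain psi psi' :: "real \<Rightarrow> real" where psi: "\<And>x. x \<in> J \<Longrightarrow> (psi has_real_derivative exp (w2 x)) (at x)"
    "\<And>x. x \<in> J \<Longrightarrow> psi' (psi x) = x" "open (psi ` J)" "connected (psi ` J)"
    "smooth_on J psi" "smooth_on (psi ` J) psi'"
    "\<And>y. y \<in> psi ` J \<Longrightarrow> (psi' has_real_derivative exp (- w2 (psi' y))) (at y)"
    unfolding J_def by (rule interval_reparametrization[OF se(2) oV(2) IV(2) sw(2)]) blast
  define R where "R = to_null -` (I \<times> J)"
  define R' where "R' = to_null -` (phi ` I \<times> psi ` J)"
  define t where "t p = from_null (phi (fst (to_null p)), psi (snd (to_null p)))" for p
  define t' where "t' p = from_null (phi' (fst (to_null p)), psi' (snd (to_null p)))" for p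
  have ders: "\<forall>x\<in>I. (phi has_real_derivative exp (w1 x)) (at x)" "\<forall>x\<in>J. (psi has_real_derivative exp (w2 x)) (at x)"
    "\<forall>y\<in>phi ` I. (phi' has_real_derivative exp (- w1 (phi' y))) (at y)"
    "\<forall>y\<in>psi ` J. (psi' has_real_derivative exp (- w2 (psi' y))) (at y)"
    using phi(1,7) psi(1,7) by blast+
  note pt = paraholomorphic_on_null[OF oIJ phi(5) psi(5) ders(1,2), folded R_def t_def[abs_def]]
  note pt' = paraholomorphic_on_null[OF phi(3) psi(3) phi(6) psi(6) ders(3,4), folded R'_def t'_def[abs_def]]
  have tt: "t' (t p) = p" "t p \<in> R'" if "p \<in> R" for p
    using that phi(2) psi(2) unfolding t_def t'_def R_def R'_def by auto (metis null_inverse(1) prod.collapse)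
  have tt': "t (t' p) = p" "t' p \<in> R" if "p \<in> R'" for p
  proof -
    have "to_null p \<in> phi ` I \<times> psi ` J" using that by (simp only: R'_def vimage_eq)
    then obtain x y where "x \<in> I" "y \<in> J" "to_null p = (phi x, psi y)" by blast
    then show "t (t' p) = p" "t' p \<in> R"
      using phi(2)[of x] psi(2)[of y] null_inverse(1)[of p] by (simp_all add: t_def t'_def R_def)
  qed
  have im: "t ` R = R'" "t' ` R' = R"
  proof -
    have "p \<in> t ` R" if "p \<in> R'" for p using tt'(2)[OF that] tt'(1)[OF that] by (metis imageI)
    then show "t ` R = R'" using tt(2) by blast
    have "p \<in> t' ` R'" if "p \<in> R" for p using tt(2)[OF that] tt(1)[OF that] by (metis imageI)
    then show "t' ` R' = R" using tt'(2) by blast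
  qed
  have p0R: "p0 \<in> R" using x0 xy0 by (simp add: R_def)
  have RU1: "R \<subseteq> U1"
  proof
    fix p assume "p \<in> R"
    then have "to_null p \<in> I \<times> J" by (simp only: R_def vimage_eq)
    then obtain x y where xy: "x \<in> I" "y \<in> J" "to_null p = (x, y)" by blast
    then have "from_null (x, y) \<in> U1" using Q IQ by blast
    then show "p \<in> U1" using null_inverse(1)[of p] xy(3) by simp
  qed
  then have RU: "R \<subseteq> U" using U1 by blast
  define f' where "f' p = f (t' p)" for p
  \<comment> \<open>The new metric coefficient is the old one divided by the two derivatives exp w1
    and exp w2.\<close>
  define lam' where "lam' p = lam (t' p) - 1 / 2 * (w1 (phi' (fst (to_null p))) + w2 (psi' (snd (to_null p))))" for p
  have st': "smooth_on R' t'" using pt'(2) by (simp add: paraholomorphic_on_def)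
  have sub: "t' ` R' \<subseteq> U" using im RU by simp
  have sf': "smooth_on R' f'" unfolding f'_def[abs_def] by (rule smooth_on_compose[OF pt'(1) st' smooth_f sub])
  have sw': "smooth_on R' (\<lambda>p. w1 (phi' (fst (to_null p))))" "smooth_on R' (\<lambda>p. w2 (psi' (snd (to_null p))))"
  proof -
    note sn = smooth_on_linear_comp[OF _ pt'(1) smooth_on_bounded_linear[OF bl(2) pt'(1)]]
    have "smooth_on R' (\<lambda>p. phi' (fst (to_null p)))" "smooth_on R' (\<lambda>p. psi' (snd (to_null p)))"
      by (rule smooth_on_compose[OF pt'(1) sn[OF bounded_linear_fst] phi(6)], force simp: R'_def)
        (rule smooth_on_compose[OF pt'(1) sn[OF bounded_linear_snd] psi(6)], force simp: R'_def)
    note c = smooth_on_compose[OF pt'(1) this(1) sw(1)] smooth_on_compose[OF pt'(1) this(2) sw(2)]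
    show "smooth_on R' (\<lambda>p. w1 (phi' (fst (to_null p))))"
      by (rule c(1)) (use phi(2) IV(1) IQ(1) in \<open>force simp: R'_def\<close>)
    show "smooth_on R' (\<lambda>p. w2 (psi' (snd (to_null p))))"
      by (rule c(2)) (use psi(2) IV(2) IQ(2) in \<open>force simp: R'_def\<close>)
  qed
  have slam': "smooth_on R' lam'" unfolding lam'_def[abs_def]
    by (intro smooth_on_diff smooth_on_mult smooth_on_const smooth_on_add sw' pt'(1) smooth_on_compose[OF pt'(1) st' smooth_lam sub])
  have df': "d_p f' p = exp (- w1 (phi' (fst (to_null p)))) *\<^sub>R d_p f (t' p)"
    "d_m f' p = exp (- w2 (psi' (snd (to_null p)))) *\<^sub>R d_m f (t' p)" if p: "p \<in> R'" for p
  proof -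
    have tU: "t' p \<in> U" using p sub by blast
    have dd: "f differentiable (at (t' p))" "t' differentiable (at p)"
      using tU smooth_on_differentiable[OF st' p] by simp_all
    have lin: "linear (\<lambda>e. dirder f e (t' p))" using dd(1) by (simp add: linear_frechet_derivative)
    show "d_p f' p = exp (- w1 (phi' (fst (to_null p)))) *\<^sub>R d_p f (t' p)"
      "d_m f' p = exp (- w2 (psi' (snd (to_null p)))) *\<^sub>R d_m f (t' p)"
      unfolding f'_def[abs_def] dirder_compose[OF dd(2,1)] pt'(3)[OF p] pt'(4)[OF p] linear_scale[OF lin] by simp_all
  qed
  have conf': "conformal_metric_on S R' f' lam'"
  proof (rule conformal_metric_on_null[OF sf' slam'])
    fix p assume p: "p \<in> R'"
    then have tU: "t' p \<in> U" using sub by blast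
    show "pinner S (d_p f' p) (d_p f' p) = 0" "pinner S (d_m f' p) (d_m f' p) = 0"
      "pinner S (d_p f' p) (d_m f' p) = 2 * exp (2 * lam' p)"
      unfolding df'[OF p] lam'_def by (simp_all add: pinner_simps null[OF tU] flip: exp_add) (simp add: algebra_simps)
  qed
  note change = change_of_coordinates[OF pt(1) RU pt'(1) im(1) pt(2) sf' _ conf']
  have ff: "f q = f' (t q)" if "q \<in> R" for q using tt that by (simp add: f'_def)
  have zmc': "zmc_immersion_on S L0 R' f' lam'" by (rule change(1)[OF ff])
  interpret z: zmc_surface S L0 R' f' lam' by (rule zmc_surfaceI[OF pt'(1) zmc'])
  \<comment> \<open>Both squares equal d, which leaves only a sign in the proportionality factor.
    The sign of <A, B> fixes it as eps / d.\<close>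
  have AB': "pinner S (z.A p) (z.A p) = d \<and> pinner S (z.A p) (z.B p) = eps \<and> z.B p = (eps / d) *\<^sub>R z.A p" if p: "p \<in> R'" for p
  proof -
    define q where "q = t' p"
    have q: "q \<in> R" "t q = p" "q \<in> U1" "q \<in> U" using tt'[OF p] RU1 RU by (auto simp: q_def)
    have "to_null q \<in> I \<times> J" using q(1) by (simp only: R_def vimage_eq)
    then obtain x y where xy: "x \<in> I" "y \<in> J" "to_null q = (x, y)" by blast
    have qxy: "q = from_null (x, y)" using xy(3) by (metis null_inverse(1))
    have V: "from_null (x, y0) \<in> U1" "from_null (x0, y) \<in> U1" using Q xy x0 IQ by blast+
    define m n where "m = exp (w1 x)" and "n = exp (w2 y)"
    have mn: "m > 0" "n > 0" by (simp_all add: m_def n_def)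
    have m4: "m * m * (m * m) = d * g q" "n * n * (n * n) = d * h q"
    proof -
      have "m * m * (m * m) = exp (4 * w1 x)" "n * n * (n * n) = exp (4 * w2 y)"
        by (simp_all add: m_def n_def flip: exp_add)
      then show "m * m * (m * m) = d * g q" "n * n * (n * n) = d * h q"
        using U1(2)[OF V(1)] U1(3)[OF V(2)] gx[OF xy(1,2)] hy[OF xy(1,2)] by (simp_all add: w1_def w2_def qxy)
    qed
    have A: "A q = (m * m) *\<^sub>R z.A p" "B q = (n * n) *\<^sub>R z.B p"
      using change(4)[OF ff q(1)] change(5)[OF ff q(1)] pt(3)[OF q(1)] pt(4)[OF q(1)]
      by (simp_all add: q(2) xy(3) m_def n_def power2_eq_square)
    have "g q = d * g q * pinner S (z.A p) (z.A p)" "h q = d * h q * pinner S (z.B p) (z.B p)"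
      unfolding m4[symmetric] by (simp_all add: g_def h_def A pinner_simps mult_ac)
    then have n1: "d * pinner S (z.A p) (z.A p) = 1" "d * pinner S (z.B p) (z.B p) = 1"
      using U1(2,3)[OF q(3)] by auto
    have dd: "pinner S (z.A p) (z.A p) = d" "pinner S (z.B p) (z.B p) = d"
      using n1 de(1) by auto
    obtain k where k: "B q = k *\<^sub>R A q" using par[OF q(4)] by blast
    define k' where "k' = k * (m * m) / (n * n)"
    have "(n * n) *\<^sub>R z.B p = (n * n) *\<^sub>R (k' *\<^sub>R z.A p)"
      using k mn unfolding A by (simp add: k'_def)
    then have Bk: "z.B p = k' *\<^sub>R z.A p" using mn by (simp only: scaleR_cancel_left) simp
    have "k' * k' * d = d" using dd unfolding Bk by (simp add: pinner_simps dd(1))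
    then have k2: "k' * k' = 1" using de by simp
    then have k1: "k' \<in> {1, - 1}" by (metis insertI1 insertI2 singletonI square_eq_1_iff)
    have "l q = (m * m * (n * n)) * (k' * d)"
      unfolding l_def A Bk by (simp add: pinner_simps dd mult_ac)
    then have "eps * ((m * m * (n * n)) * (k' * d)) > 0" using U1(4)[OF q(3)] by simp
    then have "(m * m * (n * n)) * (eps * (k' * d)) > 0" by (simp only: mult_ac)
    moreover have "m * m * (n * n) > 0" using mn by simp
    ultimately have "eps * (k' * d) > 0" by (metis zero_less_mult_pos)
    then have kd: "k' * d = eps" using k1 de(1,2) by auto
    then have "k' = eps / d" using de by (simp add: field_simps)
    then show ?thesis using dd kd Bk by (simp add: pinner_simps)
  qed
  have adapted: "adapted_on L0 d eps R' lam' f' z.A"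
    unfolding adapted_on_def
  proof (intro conjI ballI slam' sf' z.smooth_A)
    fix p assume p: "p \<in> R'"
    have ABe: "pinner S (z.A p) (z.B p) = eps" using AB'[OF p] by blast
    show "d_p (d_p f') p = (2 * d_p lam' p) *\<^sub>R d_p f' p + 2 *\<^sub>R z.A p" by (rule z.f_pp)
    show "d_m (d_p f') p = - (2 * L0 * exp (2 * lam' p)) *\<^sub>R f' p" using z.wave_f[OF p] by simp
    show "d_m (d_m f') p = (2 * d_m lam' p) *\<^sub>R d_m f' p + (2 * eps / d) *\<^sub>R z.A p"
      using z.f_mm[of p] AB'[OF p] by simp
    show "d_m z.A p = - (eps * exp (- 2 * lam' p)) *\<^sub>R d_p f' p"
      unfolding z.d_m_A[OF p] ABe by (simp add: mult.commute)
    \<comment> \<open>Codazzi does not give the derivative of \<open>A\<close> in its own direction.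
      It is obtained from the derivative of \<open>B\<close>, now a constant multiple of
      \<open>A\<close>.\<close>
    have "d_p z.B p = d_p (\<lambda>p. (eps / d) *\<^sub>R z.A p) p"
      by (rule dirder_cong_open[OF pt'(1) p]) (use AB' in blast)
    also have "\<dots> = (eps / d) *\<^sub>R d_p z.A p" using p by simp
    finally have "(eps / d) *\<^sub>R d_p z.A p = - (z.Ei p * eps) *\<^sub>R d_m f' p"
      using z.d_p_B[OF p, unfolded ABe] by simp
    also have "\<dots> = (eps / d) *\<^sub>R (- (d * exp (- 2 * lam' p)) *\<^sub>R d_m f' p)"
      using de by (simp add: mult.commute)
    finally show "d_p z.A p = - (d * exp (- 2 * lam' p)) *\<^sub>R d_m f' p"
      using de by (simp only: scaleR_cancel_left) simp
  qed
  have star: "star_on L0 R' eps lam'"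
    unfolding star_on_def
  proof (intro conjI ballI de(2) slam')
    fix p assume p: "p \<in> R'"
    show "d_u (d_u lam') p - d_v (d_v lam') p = - L0 * exp (2 * lam' p) + eps * exp (- 2 * lam' p)"
      unfolding z.wave_lam[OF p] z.gauss_equation[OF p] AB'[OF p, THEN conjunct2, THEN conjunct1]
      by (simp add: mult.commute)
  qed
  define p1 where "p1 = t p0"
  have p1: "p1 \<in> R'" using tt(2)[OF p0R] by (simp add: p1_def)
  obtain C where C: "frame_gram S L0 (exp (2 * lam' p1)) d (f' p1) (d_p f' p1) (d_m f' p1) (z.A p1) C"
    by (rule frame_completion[OF dim index exp_gt_zero de(1) z.position(1)[OF p1] z.position(2)[OF p1]
          z.position(2)[OF p1] z.normal_AB(3)[OF p1] z.null(1)[OF p1] z.null(2)[OF p1] z.null(3)[OF p1]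
          z.normal_AB(1)[OF p1] z.normal_AB(2)[OF p1] AB'[OF p1, THEN conjunct1]])
  have conR': "connected R'"
    unfolding R'_def from_null_image[symmetric]
    by (intro connected_continuous_image linear_continuous_on bl(1) connected_Times phi(4) psi(4))
  have gram: "frame_gram S L0 (exp (2 * lam' p)) d (f' p) (d_p f' p) (d_m f' p) (z.A p) C" if "p \<in> R'" for p
    by (rule frame_gram_propagates[OF dim pt'(1) conR' de(3) adapted p1 C that])
  \<comment> \<open>These belong to the choice a = exp (- lam'), b = d exp (- lam'), whose ratio is
    constant; therefore \<open>m1\<close> and \<open>m2\<close> vanish.\<close>
  define a1 a2 b1 b2 :: "paracomplex \<Rightarrow> real"
    where "a1 p = (1 + eps / d) / 4 * (exp (- lam' p) + d * exp (- lam' p))"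
      and "a2 p = (1 - eps / d) / 4 * (exp (- lam' p) + d * exp (- lam' p))"
      and "b1 p = (1 + eps / d) / 4 * (exp (- lam' p) - d * exp (- lam' p))"
      and "b2 p = (1 - eps / d) / 4 * (exp (- lam' p) - d * exp (- lam' p))" for p
  have rep: "star_rep R' d (eps / d) lam' a1 a2 b1 b2 (\<lambda>_. 0) (\<lambda>_. 0) (\<lambda>p. exp (- lam' p)) (\<lambda>p. d * exp (- lam' p))"
    unfolding star_rep_def
  proof (intro conjI ballI)
    show "smooth_on R' (\<lambda>p. exp (- lam' p))" "smooth_on R' (\<lambda>p. d * exp (- lam' p))"
      by (intro smooth_on_intros pt'(1) slam')+
    fix p assume p: "p \<in> R'"
    show "exp (- lam' p) * (d * exp (- lam' p)) = d * exp (- 2 * lam' p)"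
      by (simp flip: exp_add)
  qed (simp_all add: a1_def a2_def b1_def b2_def)
  have assoc: "associated_functions_on S L0 R' f' lam' a1 a2 b1 b2 (\<lambda>_. 0) (\<lambda>_. 0)"
    by (rule associated_functions_if_adapted[OF pt'(1) de(3) adapted gram rep])
  \<comment> \<open>All four P and Q functions are - lam', with c = 0 and the signs 1 and d, in
    agreement with d = ep em exp (- c).\<close>
  have dstar: "double_star_on R' eps lam' a1 a2 b1 b2 (\<lambda>_. 0) (\<lambda>_. 0)"
    unfolding double_star_on_def
  proof (rule exI[of _ "\<lambda>p. - lam' p"], rule exI[of _ "\<lambda>p. - lam' p"], rule exI[of _ "\<lambda>p. - lam' p"],
      rule exI[of _ "\<lambda>p. - lam' p"], rule exI[of _ 0], rule exI[of _ 1], rule exI[of _ d],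
      intro conjI ballI de(1) smooth_on_minus[OF pt'(1) slam'])
  qed (use de(1) in \<open>auto simp: Let_def a1_def a2_def b1_def b2_def field_simps\<close>)
  show thesis
    by (rule that[OF pt(1) p0R RU pt'(1) im tt(1) tt'(1) pt(2) pt'(2) conf'[unfolded f'_def[abs_def]] star
          assoc[unfolded f'_def[abs_def]] dstar])
qed

section \<open>Charts\<close>

lemma paraholomorphic_on_cong:
  assumes U: "open U" and f: "paraholomorphic_on U f" and fg: "\<And>p. p \<in> U \<Longrightarrow> f p = g p"
  shows "paraholomorphic_on U g"
  unfolding paraholomorphic_on_def
proof (intro conjI ballI)
  show "smooth_on U g"
    using f by (intro smooth_on_cong[OF U fg]) (simp_all add: paraholomorphic_on_def)
  fix p assume p: "p \<in> U"
  then obtain z where "(f has_derivative pc_mult z) (at p)" using f by (auto simp: paraholomorphic_on_def)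
  from has_derivative_transform_within_open[OF this U p fg]
  show "\<exists>z. (g has_derivative pc_mult z) (at p)" by blast
qed

lemma paraholomorphic_on_subset: "V \<subseteq> U \<Longrightarrow> paraholomorphic_on U f \<Longrightarrow> paraholomorphic_on V f"
  unfolding paraholomorphic_on_def using smooth_on_subset by blast

lemma paraholomorphic_on_compose:
  assumes U: "open U" and f: "paraholomorphic_on U f" and g: "paraholomorphic_on V g" and fU: "f ` U \<subseteq> V"
  shows "paraholomorphic_on U (\<lambda>p. g (f p))"
  unfolding paraholomorphic_on_def
proof (intro conjI ballI)
  have sm: "smooth_on U f" "smooth_on V g" using f g unfolding paraholomorphic_on_def by blast+
  show "smooth_on U (\<lambda>p. g (f p))" by (rule smooth_on_compose[OF U sm fU])
  fix p assume p: "p \<in> U"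
  obtain z where z: "(f has_derivative pc_mult z) (at p)" using f p unfolding paraholomorphic_on_def by blast
  have fp: "f p \<in> V" using p fU by blast
  obtain w where w: "(g has_derivative pc_mult w) (at (f p))" using g fp unfolding paraholomorphic_on_def by blast
  have "((\<lambda>p. g (f p)) has_derivative (\<lambda>e. pc_mult w (pc_mult z e))) (at p)"
    by (rule has_derivative_compose[where f = f and g = g, OF z w])
  moreover have "(\<lambda>e. pc_mult w (pc_mult z e)) = pc_mult (pc_mult w z)"
    by (simp add: fun_eq_iff pc_mult_def algebra_simps)
  ultimately have "((\<lambda>p. g (f p)) has_derivative pc_mult (pc_mult w z)) (at p)" by (simp only:)
  then show "\<exists>z. ((\<lambda>p. g (f p)) has_derivative pc_mult z) (at p)" by blast
qed

lemma is_chartD: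
  assumes "is_chart C"
  shows "open (fst C)" "open (chart_image C)" "continuous_on (fst C) (snd C)"
    "continuous_on (chart_image C) (chart_inv C)"
    "\<And>x. x \<in> fst C \<Longrightarrow> chart_inv C (snd C x) = x"
    "\<And>p. p \<in> chart_image C \<Longrightarrow> snd C (chart_inv C p) = p"
    "\<And>p. p \<in> chart_image C \<Longrightarrow> chart_inv C p \<in> fst C"
  using assms unfolding is_chart_def homeomorphism_def by blast+

lemma open_chart_image:
  assumes C: "is_chart C" and X: "open X"
  shows "open (snd C ` (fst C \<inter> X))"
proof -
  have "snd C ` (fst C \<inter> X) = chart_image C \<inter> chart_inv C -` X"
  proof (intro equalityI subsetI)
    fix p assume "p \<in> snd C ` (fst C \<inter> X)"
    then show "p \<in> chart_image C \<inter> chart_inv C -` X" using is_chartD(5)[OF C] by auto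
  next
    fix p assume p: "p \<in> chart_image C \<inter> chart_inv C -` X"
    then have "snd C (chart_inv C p) = p" "chart_inv C p \<in> fst C \<inter> X"
      using is_chartD(6,7)[OF C, of p] by auto
    then show "p \<in> snd C ` (fst C \<inter> X)" by (metis imageI)
  qed
  then show ?thesis
    using continuous_open_preimage[OF is_chartD(4,2)[OF C] X] by simp
qed

text \<open>Transition maps of the new chart factor through the old ones, in one direction with t
  and in the other with t'; both factors are therefore required to be paraholomorphic.\<close>

lemma reparametrized_chart:
  fixes C :: "'m::{t2_space, second_countable_topology} chart"
  assumes C: "local_coordinate \<A> C" and \<A>: "\<And>D. D \<in> \<A> \<Longrightarrow> is_chart D"
    and R: "open R" "R \<subseteq> chart_image C" "open R'" "t ` R = R'" "t' ` R' = R"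
    and inv: "\<And>p. p \<in> R \<Longrightarrow> t' (t p) = p" "\<And>p. p \<in> R' \<Longrightarrow> t (t' p) = p"
    and par: "paraholomorphic_on R t" "paraholomorphic_on R' t'"
  defines "C' \<equiv> (fst C \<inter> snd C -` R, t \<circ> snd C)"
  shows "local_coordinate \<A> C'" "chart_image C' = R'" "\<And>p. p \<in> R' \<Longrightarrow> chart_inv C' p = chart_inv C (t' p)"
proof -
  have chC: "is_chart C" and cmp: "\<And>D. D \<in> \<A> \<Longrightarrow> compatible_charts C D"
    using C by (auto simp: local_coordinate_def)
  note c = is_chartD[OF chC]
  let ?O = "fst C \<inter> snd C -` R"
  have cO: "snd C ` ?O = R" using R(2) by auto
  have ci: "chart_inv C (t' p) \<in> ?O \<and> (t \<circ> snd C) (chart_inv C (t' p)) = p" if "p \<in> R'" for p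
  proof -
    have "t' p \<in> R" "t' p \<in> chart_image C" using that R by auto
    then show ?thesis using c(6,7)[of "t' p"] inv(2)[OF that] by simp
  qed
  have left: "chart_inv C (t' ((t \<circ> snd C) x)) = x" if "x \<in> ?O" for x using that inv(1) c(5) by simp
  have inj: "inj_on (t \<circ> snd C) ?O" by (rule inj_on_inverseI[where g = "\<lambda>p. chart_inv C (t' p)"]) (rule left)
  show im: "chart_image C' = R'" unfolding C'_def fst_conv snd_conv image_comp[symmetric] cO by (rule R(4))
  show inv': "chart_inv C' p = chart_inv C (t' p)" if "p \<in> R'" for p
    unfolding C'_def using inv_into_f_eq[OF inj] ci[OF that] by simp
  have oO: "open ?O" by (rule continuous_open_preimage[OF c(3,1) R(1)])
  have ct: "continuous_on R t" "continuous_on R' t'"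
    using par by (auto simp: paraholomorphic_on_def intro: smooth_on_continuous_on)
  have chC': "is_chart C'"
    unfolding is_chart_def
  proof (intro conjI)
    show "open (fst C')" using oO by (simp add: C'_def)
    show "open (chart_image C')" using R im by simp
    show "homeomorphism (fst C') (chart_image C') (snd C') (chart_inv C')"
      unfolding im
    proof (rule homeomorphismI)
      show "continuous_on (fst C') (snd C')"
        unfolding C'_def fst_conv snd_conv
        by (rule continuous_on_compose) (auto intro: continuous_on_subset[OF c(3)] continuous_on_subset[OF ct(1)])
      have "continuous_on R' (\<lambda>p. chart_inv C (t' p))"
        by (rule continuous_on_compose2[OF c(4) ct(2)]) (use R in auto)
      then show "continuous_on R' (chart_inv C')" by (rule continuous_on_eq) (simp add: inv')
      show "snd C' ` fst C' \<subseteq> R'" using im by simp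
      show "chart_inv C' ` R' \<subseteq> fst C'" using inv' ci by (auto simp: C'_def)
      show "chart_inv C' (snd C' x) = x" if "x \<in> fst C'" for x
      proof -
        have "snd C' x \<in> R'" using im that by blast
        from inv'[OF this] show ?thesis using left[of x] that by (simp add: C'_def)
      qed
      show "snd C' (chart_inv C' p) = p" if "p \<in> R'" for p
        using ci[OF that] inv'[OF that] by (simp add: C'_def)
    qed
  qed
  show "local_coordinate \<A> C'"
    unfolding local_coordinate_def
  proof (intro conjI chC' ballI)
    fix D assume D: "D \<in> \<A>"
    note chD = \<A>[OF D] and cd = cmp[OF D, unfolded compatible_charts_def]
    note d = is_chartD[OF chD]
    let ?X = "snd C' ` (fst C' \<inter> fst D)" and ?Y = "snd D ` (fst C' \<inter> fst D)"
    have oX: "open ?X" by (rule open_chart_image[OF chC' d(1)])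
    have oY: "open ?Y" using open_chart_image[OF chD is_chartD(1)[OF chC']] by (simp add: Int_commute)
    have XR: "?X \<subseteq> R'" using im by blast
    have tX: "t' ` ?X \<subseteq> snd C ` (fst C \<inter> fst D)"
    proof
      fix q assume "q \<in> t' ` ?X"
      then obtain y where y0: "y \<in> fst C' \<inter> fst D" "q = t' (snd C' y)" by blast
      then have y: "y \<in> fst C \<inter> fst D" "snd C y \<in> R" "q = t' (t (snd C y))" by (simp_all add: C'_def)
      then show "q \<in> snd C ` (fst C \<inter> fst D)" using inv(1)[OF y(2)] by simp
    qed
    have "paraholomorphic_on ?X (\<lambda>p. (snd D \<circ> chart_inv C) (t' p))"
      by (rule paraholomorphic_on_compose[OF oX paraholomorphic_on_subset[OF XR par(2)] cd[THEN conjunct1] tX])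
    then have 1: "paraholomorphic_on ?X (snd D \<circ> chart_inv C')"
    proof (rule paraholomorphic_on_cong[OF oX])
      fix p assume "p \<in> ?X"
      then have "p \<in> R'" using XR by blast
      from inv'[OF this] show "(snd D \<circ> chart_inv C) (t' p) = (snd D \<circ> chart_inv C') p" by simp
    qed
    have YD: "?Y \<subseteq> snd D ` (fst C \<inter> fst D)" by (auto simp: C'_def)
    have sY: "(snd C \<circ> chart_inv D) ` ?Y \<subseteq> R" using d(5) by (auto simp: C'_def)
    have "paraholomorphic_on ?Y (\<lambda>p. t ((snd C \<circ> chart_inv D) p))"
      by (rule paraholomorphic_on_compose[OF oY paraholomorphic_on_subset[OF YD cd[THEN conjunct2]] par(1) sY])
    then have 2: "paraholomorphic_on ?Y (snd C' \<circ> chart_inv D)"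
      by (rule paraholomorphic_on_cong[OF oY]) (simp add: C'_def)
    show "compatible_charts C' D" unfolding compatible_charts_def using 1 2 by blast
  qed
qed

section \<open>Locality of the surface data\<close>

lemma conformal_metric_on_cong:
  assumes "open U" "\<And>p. p \<in> U \<Longrightarrow> f p = g p" "conformal_metric_on S U f lam"
  shows "conformal_metric_on S U g lam"
  using assms(3) dirder_cong_open[OF assms(1) _ assms(2)]
  unfolding conformal_metric_on_def induced_metric_def by simp

lemma conformal_metric_on_subset: "V \<subseteq> U \<Longrightarrow> conformal_metric_on S U f lam \<Longrightarrow> conformal_metric_on S V f lam"
  unfolding conformal_metric_on_def using smooth_on_subset by blast

text \<open>On an open set the derivatives of f, the covariant derivatives and the normal spaces
  depend on the germ of f only, so the same normal frame serves both maps.\<close>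

lemma associated_functions_on_cong:
  assumes U: "open U" and fg: "\<And>p. p \<in> U \<Longrightarrow> f p = g p"
    and f: "associated_functions_on S L0 U f lam a1 a2 b1 b2 m1 m2"
  shows "associated_functions_on S L0 U g lam a1 a2 b1 b2 m1 m2"
proof -
  have d: "dirder f e p = dirder g e p" if "p \<in> U" for e p
    by (rule dirder_cong_open[OF U that fg])
  have dd: "dirder (dirder f e) e' p = dirder (dirder g e) e' p" if "p \<in> U" for e e' p
    by (rule dirder_cong_open[OF U that d])
  have c: "cov S L0 f e (dirder f e') p = cov S L0 g e (dirder g e') p" "cov S L0 f e N p = cov S L0 g e N p"
    if "p \<in> U" for e e' N p
    using that by (simp_all add: cov_def dd fg)
  have n: "normal_space S L0 f p = normal_space S L0 g p" if "p \<in> U" for p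
    using that by (simp add: normal_space_def d fg)
  obtain N1 N2 where N: "normal_frame_on S L0 U f lam N1 N2" and
    eqs: "\<forall>p\<in>U. let T1 = d_u f; T2 = d_v f; D1 = cov S L0 f (1, 0); D2 = cov S L0 f (0, 1);
           lu = d_u lam p; lv = d_v lam p in
         D1 T1 p = lu *\<^sub>R T1 p + lv *\<^sub>R T2 p + a1 p *\<^sub>R N1 p + b1 p *\<^sub>R N2 p \<and>
         D1 T2 p = lv *\<^sub>R T1 p + lu *\<^sub>R T2 p + a2 p *\<^sub>R N1 p + b2 p *\<^sub>R N2 p \<and>
         D2 T1 p = lv *\<^sub>R T1 p + lu *\<^sub>R T2 p + a2 p *\<^sub>R N1 p + b2 p *\<^sub>R N2 p \<and>
         D2 T2 p = lu *\<^sub>R T1 p + lv *\<^sub>R T2 p + a1 p *\<^sub>R N1 p + b1 p *\<^sub>R N2 p \<and>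
         D1 N1 p = - a1 p *\<^sub>R T1 p + a2 p *\<^sub>R T2 p + lu *\<^sub>R N1 p + m1 p *\<^sub>R N2 p \<and>
         D1 N2 p = b1 p *\<^sub>R T1 p - b2 p *\<^sub>R T2 p + m1 p *\<^sub>R N1 p + lu *\<^sub>R N2 p \<and>
         D2 N1 p = - a2 p *\<^sub>R T1 p + a1 p *\<^sub>R T2 p + lv *\<^sub>R N1 p + m2 p *\<^sub>R N2 p \<and>
         D2 N2 p = b2 p *\<^sub>R T1 p - b1 p *\<^sub>R T2 p + m2 p *\<^sub>R N1 p + lv *\<^sub>R N2 p"
    using f unfolding associated_functions_on_def by blast
  show ?thesis
    unfolding associated_functions_on_def
  proof (rule exI[of _ N1], rule exI[of _ N2], intro conjI ballI)
    show "normal_frame_on S L0 U g lam N1 N2"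
      using N n unfolding normal_frame_on_def by simp
    fix p assume p: "p \<in> U"
    note e = bspec[OF eqs p, unfolded Let_def c(1)[OF p] c(2)[OF p, of _ N1] c(2)[OF p, of _ N2] d[OF p]]
    show "let T1 = d_u g; T2 = d_v g; D1 = cov S L0 g (1, 0); D2 = cov S L0 g (0, 1);
           lu = d_u lam p; lv = d_v lam p in
         D1 T1 p = lu *\<^sub>R T1 p + lv *\<^sub>R T2 p + a1 p *\<^sub>R N1 p + b1 p *\<^sub>R N2 p \<and>
         D1 T2 p = lv *\<^sub>R T1 p + lu *\<^sub>R T2 p + a2 p *\<^sub>R N1 p + b2 p *\<^sub>R N2 p \<and>
         D2 T1 p = lv *\<^sub>R T1 p + lu *\<^sub>R T2 p + a2 p *\<^sub>R N1 p + b2 p *\<^sub>R N2 p \<and>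
         D2 T2 p = lu *\<^sub>R T1 p + lv *\<^sub>R T2 p + a1 p *\<^sub>R N1 p + b1 p *\<^sub>R N2 p \<and>
         D1 N1 p = - a1 p *\<^sub>R T1 p + a2 p *\<^sub>R T2 p + lu *\<^sub>R N1 p + m1 p *\<^sub>R N2 p \<and>
         D1 N2 p = b1 p *\<^sub>R T1 p - b2 p *\<^sub>R T2 p + m1 p *\<^sub>R N1 p + lu *\<^sub>R N2 p \<and>
         D2 N1 p = - a2 p *\<^sub>R T1 p + a1 p *\<^sub>R T2 p + lv *\<^sub>R N1 p + m2 p *\<^sub>R N2 p \<and>
         D2 N2 p = b2 p *\<^sub>R T1 p - b1 p *\<^sub>R T2 p + m2 p *\<^sub>R N1 p + lv *\<^sub>R N2 p"
      unfolding Let_def by (rule e)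
  qed
qed

lemma associated_functions_on_subset:
  assumes "V \<subseteq> U" "associated_functions_on S L0 U f lam a1 a2 b1 b2 m1 m2"
  shows "associated_functions_on S L0 V f lam a1 a2 b1 b2 m1 m2"
proof -
  have frame: "normal_frame_on S L0 U f lam N1 N2 \<Longrightarrow> normal_frame_on S L0 V f lam N1 N2" for N1 N2
    using assms(1) smooth_on_subset unfolding normal_frame_on_def by blast
  \<comment> \<open>The pointwise equations enter as an arbitrary predicate, so restriction becomes
    pure logic and the system need not be spelled out again.\<close>
  have ex: "\<exists>N1 N2. P' N1 N2 \<and> (\<forall>p\<in>V. Q N1 N2 p)"
    if "\<exists>N1 N2. P N1 N2 \<and> (\<forall>p\<in>U. Q N1 N2 p)" "\<And>N1 N2. P N1 N2 \<Longrightarrow> P' N1 N2"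
    for P P' :: "'d \<Rightarrow> 'd \<Rightarrow> bool" and Q
    using that assms(1) by blast
  show ?thesis
    unfolding associated_functions_on_def
    by (rule ex[OF assms(2)[unfolded associated_functions_on_def]]) (rule frame)
qed

lemma star_rep_subset:
  "V \<subseteq> U \<Longrightarrow> star_rep U d k lam a1 a2 b1 b2 m1 m2 a b \<Longrightarrow> star_rep V d k lam a1 a2 b1 b2 m1 m2 a b"
  unfolding star_rep_def using smooth_on_subset by blast

section \<open>The theorem\<close>

lemma normal_form_chart:
  fixes S :: "'n::finite set" and F :: "'m::{t2_space, second_countable_topology} \<Rightarrow> real^'n"
  assumes dim: "CARD('n) = (if L0 = 0 then 4 else 5)" and index: "card S = (if L0 < 0 then 3 else 2)"
    and \<A>: "lorentz_surface \<A>" and C: "C \<in> \<A>" and x: "x \<in> fst C"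
    and zmc: "zmc_immersion_on S L0 (chart_image C) (F \<circ> chart_inv C) lam"
    and flat: "K_neq_and_normal_flat_on S L0 (chart_image C) (F \<circ> chart_inv C)"
  shows "\<exists>C lam eps a1 a2 b1 b2 m1 m2.
    local_coordinate \<A> C \<and> x \<in> fst C \<and>
    conformal_metric_on S (chart_image C) (F \<circ> chart_inv C) lam \<and>
    star_on L0 (chart_image C) eps lam \<and>
    associated_functions_on S L0 (chart_image C) (F \<circ> chart_inv C) lam a1 a2 b1 b2 m1 m2 \<and>
    double_star_on (chart_image C) eps lam a1 a2 b1 b2 m1 m2"
proof -
  have charts: "\<And>D. D \<in> \<A> \<Longrightarrow> is_chart D" and lc: "local_coordinate \<A> C"
    using \<A> C by (auto simp: lorentz_surface_def local_coordinate_def)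
  note c = is_chartD[OF charts[OF C]]
  interpret zmc_surface S L0 "chart_image C" "F \<circ> chart_inv C" lam by (rule zmc_surfaceI[OF c(2) zmc])
  have p: "snd C x \<in> chart_image C" using x by blast
  show ?thesis
  proof (rule normal_form_coordinates[OF dim index flat p])
  fix R R' t t' lam' eps a1 a2 b1 b2 m1 m2
  assume R: "open R" "snd C x \<in> R" "R \<subseteq> chart_image C" "open R'" "t ` R = R'" "t' ` R' = R"
    "\<And>p. p \<in> R \<Longrightarrow> t' (t p) = p" "\<And>p. p \<in> R' \<Longrightarrow> t (t' p) = p"
    "paraholomorphic_on R t" "paraholomorphic_on R' t'"
    and nf: "conformal_metric_on S R' (\<lambda>p. (F \<circ> chart_inv C) (t' p)) lam'" "star_on L0 R' eps lam'"
    "associated_functions_on S L0 R' (\<lambda>p. (F \<circ> chart_inv C) (t' p)) lam' a1 a2 b1 b2 m1 m2"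
    "double_star_on R' eps lam' a1 a2 b1 b2 m1 m2"
  define C' where "C' = (fst C \<inter> snd C -` R, t \<circ> snd C)"
  have lcC': "local_coordinate \<A> C'" "chart_image C' = R'"
    unfolding C'_def by (rule reparametrized_chart[OF lc charts R(1,3-10)]; assumption)+
  have inv': "chart_inv C' p = chart_inv C (t' p)" if p: "p \<in> R'" for p
    unfolding C'_def
    by (rule reparametrized_chart[OF lc charts R(1,3-10)]; (assumption | rule p))
  have eq: "(F \<circ> chart_inv C) (t' p) = (F \<circ> chart_inv C') p" if "p \<in> R'" for p
    using inv'[OF that] by simp
  have xC': "x \<in> fst C'" using x R(2) by (simp add: C'_def)
  have conf2: "conformal_metric_on S R' (F \<circ> chart_inv C') lam'"
    by (rule conformal_metric_on_cong[OF R(4) eq nf(1)])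
  have assoc2: "associated_functions_on S L0 R' (F \<circ> chart_inv C') lam' a1 a2 b1 b2 m1 m2"
    by (rule associated_functions_on_cong[OF R(4) eq nf(3)])
  show ?thesis
    by (rule exI[of _ C'], rule exI[of _ lam'], rule exI[of _ eps], rule exI[of _ a1], rule exI[of _ a2],
        rule exI[of _ b1], rule exI[of _ b2], rule exI[of _ m1], rule exI[of _ m2], unfold lcC'(2))
      (intro conjI lcC'(1) xC' conf2 nf(2) assoc2 nf(4))
  qed
qed

text \<open>The normal form is given in its own coordinates, whereas the conclusion concerns a chart
  of the atlas. On an overlap \<open>A\<close> and \<open>B\<close> change by nonzero factors only,
  and the algebraic criterion for the conclusion is pointwise.\<close>

lemma flat_if_normal_form_charts:
  fixes S :: "'n::finite set" and F :: "'m::{t2_space, second_countable_topology} \<Rightarrow> real^'n"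
  assumes \<A>: "lorentz_surface \<A>" and C: "C \<in> \<A>"
    and zmc: "zmc_immersion_on S L0 (chart_image C) (F \<circ> chart_inv C) lam"
    and nf: "\<And>x. \<exists>C lam eps a1 a2 b1 b2 m1 m2.
    local_coordinate \<A> C \<and> x \<in> fst C \<and>
    conformal_metric_on S (chart_image C) (F \<circ> chart_inv C) lam \<and>
    star_on L0 (chart_image C) eps lam \<and>
    associated_functions_on S L0 (chart_image C) (F \<circ> chart_inv C) lam a1 a2 b1 b2 m1 m2 \<and>
    double_star_on (chart_image C) eps lam a1 a2 b1 b2 m1 m2"
  shows "K_neq_and_normal_flat_on S L0 (chart_image C) (F \<circ> chart_inv C)"
proof -
  have chC: "is_chart C" using \<A> C by (auto simp: lorentz_surface_def)
  note c = is_chartD[OF chC]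
  let ?f = "F \<circ> chart_inv C"
  interpret zmc_surface S L0 "chart_image C" ?f lam by (rule zmc_surfaceI[OF c(2) zmc])
  show ?thesis
    unfolding K_neq_and_normal_flat_iff
  proof
    fix p assume p: "p \<in> chart_image C"
    define x where "x = chart_inv C p"
    have x: "x \<in> fst C" "snd C x = p" using c(6,7)[OF p] by (simp_all add: x_def)
    obtain C' lam' eps a1 a2 b1 b2 m1 m2 where
      C': "local_coordinate \<A> C'" "x \<in> fst C'" and
      conf': "conformal_metric_on S (chart_image C') (F \<circ> chart_inv C') lam'" and
      star': "star_on L0 (chart_image C') eps lam'" and
      assoc': "associated_functions_on S L0 (chart_image C') (F \<circ> chart_inv C') lam' a1 a2 b1 b2 m1 m2" and
      ds': "double_star_on (chart_image C') eps lam' a1 a2 b1 b2 m1 m2"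
      using nf[of x] by (elim exE conjE) (rule that)
    have chC': "is_chart C'" and cmp: "compatible_charts C' C"
      using C' C by (auto simp: local_coordinate_def)
    note c' = is_chartD[OF chC']
    let ?f' = "F \<circ> chart_inv C'" and ?t = "snd C' \<circ> chart_inv C"
    \<comment> \<open>The images of the overlap in the two charts; the transition map between them
      is the change of coordinates.\<close>
    define W W' where "W = snd C ` (fst C' \<inter> fst C)" and "W' = snd C' ` (fst C' \<inter> fst C)"
    have oW: "open W" "open W'"
      using open_chart_image[OF chC c'(1)] open_chart_image[OF chC' c(1)] by (simp_all add: W_def W'_def Int_commute)
    have sub: "W \<subseteq> chart_image C" "W' \<subseteq> chart_image C'" by (auto simp: W_def W'_def)
    have par: "paraholomorphic_on W' (snd C \<circ> chart_inv C')" "paraholomorphic_on W ?t"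
      using cmp unfolding compatible_charts_def W_def W'_def by blast+
    have im: "?t ` W = W'" unfolding W_def W'_def image_image using c(5) by (intro image_cong) auto
    have im': "(snd C \<circ> chart_inv C') ` W' \<subseteq> chart_image C"
      using c'(5) by (auto simp: W'_def)
    have "smooth_on W' (\<lambda>q. ?f ((snd C \<circ> chart_inv C') q))"
      by (rule smooth_on_compose[OF oW(2) _ smooth_f im']) (use par(1) in \<open>simp add: paraholomorphic_on_def\<close>)
    then have sf': "smooth_on W' ?f'"
    proof (rule smooth_on_cong[OF oW(2), rotated])
      fix q assume "q \<in> W'"
      then obtain y where "y \<in> fst C'" "y \<in> fst C" "q = snd C' y" by (auto simp only: W'_def)
      then show "?f ((snd C \<circ> chart_inv C') q) = ?f' q" using c(5) c'(5) by simp
    qed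
    have ff: "?f q = ?f' (?t q)" if "q \<in> W" for q
      using that c(5) c'(5) by (auto simp: W_def)
    note change = change_of_coordinates[OF oW(1) sub(1) oW(2) im par(2) sf' ff conformal_metric_on_subset[OF sub(2) conf']]
    have pW: "p \<in> W" unfolding W_def using x C'(2) by blast
    have zmc': "zmc_immersion_on S L0 W' ?f' lam'" by (rule change(1))
    have e: "eps \<in> {1, -1}" "smooth_on (chart_image C') lam'" using star' by (auto simp: star_on_def)
    obtain d a b where d: "d \<noteq> 0" and rep: "star_rep (chart_image C') d (eps / d) lam' a1 a2 b1 b2 m1 m2 a b"
      by (rule star_rep_if_double_star[OF c'(2) e(2,1) ds'])
    obtain A' N where A': "adapted_on L0 d eps W' lam' ?f' A'" and
      gram: "\<And>p. p \<in> W' \<Longrightarrow> frame_gram S L0 (exp (2 * lam' p)) d (?f' p) (d_p ?f' p) (d_m ?f' p) (A' p) (N p)"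
      by (rule adapted_if_associated[OF oW(2) zmc' d associated_functions_on_subset[OF sub(2) assoc'] star_rep_subset[OF sub(2) rep]]) (rule that)
    interpret z: zmc_surface S L0 W' ?f' lam' by (rule zmc_surfaceI[OF oW(2) zmc'])
    have e0: "eps \<noteq> 0" using e(1) by auto
    have "K_neq_and_normal_flat_on S L0 W' ?f'" by (rule zmc_if_adapted(2)[OF oW(2) d A' gram]) (assumption, rule e0)
    moreover have tp: "?t p \<in> W'" using im pW by blast
    ultimately obtain k where k: "pinner S (z.A (?t p)) (z.B (?t p)) \<noteq> 0" "z.B (?t p) = k *\<^sub>R z.A (?t p)"
      unfolding z.K_neq_and_normal_flat_iff by blast
    define m n where "m = fst (d_p ?t p)" and "n = fst (d_m ?t p)"
    have mn: "m \<noteq> 0" "n \<noteq> 0" and AB: "A p = m\<^sup>2 *\<^sub>R z.A (?t p)" "B p = n\<^sup>2 *\<^sub>R z.B (?t p)"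
      unfolding m_def n_def
      by (rule change(2)[OF _ pW], assumption, rule change(3)[OF _ pW], assumption,
          rule change(4)[OF _ pW], assumption, rule change(5)[OF _ pW])
    have "pinner S (A p) (B p) \<noteq> 0" unfolding AB using mn k(1) by (simp add: pinner_simps)
    moreover have "B p = (n\<^sup>2 * k / m\<^sup>2) *\<^sub>R A p" unfolding AB k(2) using mn by simp
    ultimately show "pinner S (A p) (B p) \<noteq> 0 \<and> (\<exists>k. B p = k *\<^sub>R A p)" by blast
  qed
qed

section \<open>Existence and uniqueness for prescribed functions, and the conclusion\<close>

lemma surface_exists:
  fixes S :: "'n::finite set"
  assumes dim: "CARD('n) = (if L0 = 0 then 4 else 5)" and index: "card S = (if L0 < 0 then 3 else 2)"
    and \<Omega>: "open \<Omega>" "p \<in> \<Omega>" and star: "star_on L0 \<Omega> eps lam"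
    and ds: "double_star_on \<Omega> eps lam a1 a2 b1 b2 m1 m2"
  shows "\<exists>U (f :: paracomplex \<Rightarrow> real^'n). open U \<and> connected U \<and> p \<in> U \<and> U \<subseteq> \<Omega> \<and>
    zmc_immersion_on S L0 U f lam \<and> associated_functions_on S L0 U f lam a1 a2 b1 b2 m1 m2 \<and>
    K_neq_and_normal_flat_on S L0 U f"
proof -
  have e: "eps \<in> {1, -1}" and lam: "smooth_on \<Omega> lam" using star by (auto simp: star_on_def)
  obtain d a b where d: "d \<noteq> 0" and rep: "star_rep \<Omega> d (eps / d) lam a1 a2 b1 b2 m1 m2 a b"
    by (rule star_rep_if_double_star[OF \<Omega>(1) lam e ds])
  have wave: "d_m (d_p lam) q = - L0 * exp (2 * lam q) + eps * exp (- 2 * lam q)" if "q \<in> \<Omega>" for q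
  proof -
    have "d_u (d_u lam) q - d_v (d_v lam) q = d_m (d_p lam) q"
      unfolding second_dirder_coords[OF \<Omega>(1) that lam] by (simp add: field_simps)
    then show ?thesis using star that unfolding star_on_def by metis
  qed
  obtain U and f A :: "paracomplex \<Rightarrow> real^'n" and C where U: "open U" "connected U" "p \<in> U" "U \<subseteq> \<Omega>" and
    f: "adapted_on L0 d eps U lam f A" and
    gram: "\<And>q. q \<in> U \<Longrightarrow> frame_gram S L0 (exp (2 * lam q)) d (f q) (d_p f q) (d_m f q) (A q) C"
    by (rule adapted_surface_exists[OF dim index \<Omega> lam d], erule wave, rule that)
  have e0: "eps \<noteq> 0" using e by auto
  have z: "zmc_immersion_on S L0 U f lam" by (rule zmc_if_adapted(1)[OF U(1) d f gram])
  have k: "K_neq_and_normal_flat_on S L0 U f"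
    by (rule zmc_if_adapted(2)[OF U(1) d f gram]) (assumption, rule e0)
  have as: "associated_functions_on S L0 U f lam a1 a2 b1 b2 m1 m2"
    by (rule associated_functions_if_adapted[OF U(1) d f gram star_rep_subset[OF U(4) rep]])
  show ?thesis by (rule exI[of _ U], rule exI[of _ f]) (intro conjI U z k as)
qed

text \<open>Both surfaces yield adapted equations with the same d, because \<open>a\<close>,
  \<open>b\<close> and d are extracted from the prescribed functions before any surface
  enters.\<close>

lemma surface_unique:
  fixes S :: "'n::finite set"
  assumes dim: "CARD('n) = (if L0 = 0 then 4 else 5)" and \<Omega>: "open \<Omega>" and star: "star_on L0 \<Omega> eps lam"
    and ds: "double_star_on \<Omega> eps lam a1 a2 b1 b2 m1 m2" and U: "open U" "connected U" "U \<subseteq> \<Omega>"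
    and f: "zmc_immersion_on S L0 U f lam" "associated_functions_on S L0 U f lam a1 a2 b1 b2 m1 m2"
    and f': "zmc_immersion_on S L0 U f' lam" "associated_functions_on S L0 U f' lam a1 a2 b1 b2 m1 m2"
  shows "\<exists>\<Phi>. isometry_sf S L0 \<Phi> \<and> (\<forall>p\<in>U. f' p = \<Phi> (f p))"
proof -
  have e: "eps \<in> {1, -1}" and lam: "smooth_on \<Omega> lam" using star by (auto simp: star_on_def)
  obtain d a b where d: "d \<noteq> 0" and rep: "star_rep \<Omega> d (eps / d) lam a1 a2 b1 b2 m1 m2 a b"
    by (rule star_rep_if_double_star[OF \<Omega> lam e ds])
  note r = star_rep_subset[OF U(3) rep]
  obtain A C where A: "adapted_on L0 d eps U lam f A" "smooth_on U C"
    "\<And>p. p \<in> U \<Longrightarrow> d_p C p = 0" "\<And>p. p \<in> U \<Longrightarrow> d_m C p = 0"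
    "\<And>p. p \<in> U \<Longrightarrow> frame_gram S L0 (exp (2 * lam p)) d (f p) (d_p f p) (d_m f p) (A p) (C p)"
    by (rule adapted_if_associated[OF U(1) f(1) d f(2) r]) (rule that)
  obtain A' C' where A': "adapted_on L0 d eps U lam f' A'" "smooth_on U C'"
    "\<And>p. p \<in> U \<Longrightarrow> d_p C' p = 0" "\<And>p. p \<in> U \<Longrightarrow> d_m C' p = 0"
    "\<And>p. p \<in> U \<Longrightarrow> frame_gram S L0 (exp (2 * lam p)) d (f' p) (d_p f' p) (d_m f' p) (A' p) (C' p)"
    by (rule adapted_if_associated[OF U(1) f'(1) d f'(2) r]) (rule that)
  show ?thesis by (rule unique_up_to_isometry[OF dim U(1,2) d A(1) A'(1) A(2-5) A'(2-5)])
qed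

theorem theorem5p1:
  fixes L0 :: real and S :: "'n::finite set"
  assumes dim: "CARD('n) = (if L0 = 0 then 4 else 5)"
    and index: "card S = (if L0 < 0 then 3 else 2)"
  shows
    "(\<forall>(A :: 'm::{t2_space, second_countable_topology} chart set) (F :: 'm \<Rightarrow> real^'n).
        lorentz_surface A \<and>
        (\<forall>C\<in>A. \<exists>lam. zmc_immersion_on S L0 (chart_image C) (F \<circ> chart_inv C) lam) \<longrightarrow>
        ((\<forall>C\<in>A. K_neq_and_normal_flat_on S L0 (chart_image C) (F \<circ> chart_inv C))
         \<longleftrightarrow>
         (\<forall>x. \<exists>C lam eps a1 a2 b1 b2 m1 m2.
            local_coordinate A C \<and> x \<in> fst C \<and>
            conformal_metric_on S (chart_image C) (F \<circ> chart_inv C) lam \<and>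
            star_on L0 (chart_image C) eps lam \<and>
            associated_functions_on S L0 (chart_image C) (F \<circ> chart_inv C) lam a1 a2 b1 b2 m1 m2 \<and>
            double_star_on (chart_image C) eps lam a1 a2 b1 b2 m1 m2)))
     \<and>
     (\<forall>\<Omega> eps lam a1 a2 b1 b2 m1 m2.
        open \<Omega> \<and> star_on L0 \<Omega> eps lam \<and> double_star_on \<Omega> eps lam a1 a2 b1 b2 m1 m2 \<longrightarrow>
        (\<forall>p\<in>\<Omega>. \<exists>U f. open U \<and> connected U \<and> p \<in> U \<and> U \<subseteq> \<Omega> \<and>
           zmc_immersion_on S L0 U f lam \<and>
           associated_functions_on S L0 U f lam a1 a2 b1 b2 m1 m2 \<and>
           K_neq_and_normal_flat_on S L0 U f) \<and>
        (\<forall>U f f'. open U \<and> connected U \<and> U \<subseteq> \<Omega> \<and>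
           zmc_immersion_on S L0 U f lam \<and>
           associated_functions_on S L0 U f lam a1 a2 b1 b2 m1 m2 \<and>
           zmc_immersion_on S L0 U f' lam \<and>
           associated_functions_on S L0 U f' lam a1 a2 b1 b2 m1 m2 \<longrightarrow>
           (\<exists>\<Phi>. isometry_sf S L0 \<Phi> \<and> (\<forall>p\<in>U. f' p = \<Phi> (f p)))))"
proof (intro conjI allI impI ballI, goal_cases)
  case (1 A F)
  then have A: "lorentz_surface A"
    and zmc: "\<And>C. C \<in> A \<Longrightarrow> \<exists>lam. zmc_immersion_on S L0 (chart_image C) (F \<circ> chart_inv C) lam" by blast+
  show ?case
  proof (intro iffI allI ballI)
    fix x
    assume flat: "\<forall>C\<in>A. K_neq_and_normal_flat_on S L0 (chart_image C) (F \<circ> chart_inv C)"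
    have "x \<in> (\<Union>C\<in>A. fst C)" using A by (simp add: lorentz_surface_def)
    then obtain C where C: "C \<in> A" "x \<in> fst C" by blast
    obtain lam where "zmc_immersion_on S L0 (chart_image C) (F \<circ> chart_inv C) lam" using zmc[OF C(1)] by blast
    from normal_form_chart[OF dim index A C this bspec[OF flat C(1)]]
    show "\<exists>C lam eps a1 a2 b1 b2 m1 m2.
        local_coordinate A C \<and> x \<in> fst C \<and>
        conformal_metric_on S (chart_image C) (F \<circ> chart_inv C) lam \<and>
        star_on L0 (chart_image C) eps lam \<and>
        associated_functions_on S L0 (chart_image C) (F \<circ> chart_inv C) lam a1 a2 b1 b2 m1 m2 \<and>
        double_star_on (chart_image C) eps lam a1 a2 b1 b2 m1 m2" .
  next
    fix C
    assume nf: "\<forall>x. \<exists>C lam eps a1 a2 b1 b2 m1 m2.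
        local_coordinate A C \<and> x \<in> fst C \<and>
        conformal_metric_on S (chart_image C) (F \<circ> chart_inv C) lam \<and>
        star_on L0 (chart_image C) eps lam \<and>
        associated_functions_on S L0 (chart_image C) (F \<circ> chart_inv C) lam a1 a2 b1 b2 m1 m2 \<and>
        double_star_on (chart_image C) eps lam a1 a2 b1 b2 m1 m2" and C: "C \<in> A"
    obtain lam where "zmc_immersion_on S L0 (chart_image C) (F \<circ> chart_inv C) lam" using zmc[OF C] by blast
    from flat_if_normal_form_charts[OF A C this spec[OF nf]]
    show "K_neq_and_normal_flat_on S L0 (chart_image C) (F \<circ> chart_inv C)" .
  qed
next
  case (2 \<Omega> eps lam a1 a2 b1 b2 m1 m2 p)
  then show ?case
    by (intro surface_exists[OF dim index 2(1)[THEN conjunct1] 2(2) 2(1)[THEN conjunct2, THEN conjunct1]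
          2(1)[THEN conjunct2, THEN conjunct2]])
next
  case (3 \<Omega> eps lam a1 a2 b1 b2 m1 m2 U f f')
  then have h: "open \<Omega>" "star_on L0 \<Omega> eps lam" "double_star_on \<Omega> eps lam a1 a2 b1 b2 m1 m2"
    "open U" "connected U" "U \<subseteq> \<Omega>"
    "zmc_immersion_on S L0 U f lam" "associated_functions_on S L0 U f lam a1 a2 b1 b2 m1 m2"
    "zmc_immersion_on S L0 U f' lam" "associated_functions_on S L0 U f' lam a1 a2 b1 b2 m1 m2"
    by blast+
  show ?case by (rule surface_unique[OF dim h])
qed

end
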